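(* Let $K$ be a field and let $t\ge 2$, $j\ge 1$, $k\ge 1$ be integers. Then $$e(H_t(j,k))=e(L_{t-1}(j))\,e(L_t(k)),$$ where $H_t(j,k)$, $L_{t-1}(j)$ and $L_t(k)$ are the pfaffian ideals of ladders defined in the context.
   Context: Let $X=(x_{ij})$ be a skew-symmetric $n\times n$ matrix of indeterminates over $K$ ($x_{ij}$, $i<j$, independent indeterminates, $x_{ji}=-x_{ij}$, $x_{ii}=0$), with $n$ large enough for all index ranges below, and $R=K[X]=K[x_{ij}\mid i<j]$ standard graded. For integers $1\le a<b\le n$ and $u\ge 1$ let $P(a,b;u)\subseteq R$ be the ideal generated by the $2u$-pfaffians of $X$ with indices in $\{a,\ldots,b\}$, i.e. the pfaffians of the submatrices of $X$ with rows and columns indexed by the same $2u$-element subset of $\{a,a+1,\ldots,b\}$. The pfaffian ideal of the ladder with upper corners $(a_1,b_1),\ldots,(a_s,b_s)$ and vector $\mathbf{t}=(t_1,\ldots,t_s)$ is $\sum_{m=1}^s P(a_m,b_m;t_m)$. For $u,k\ge1$, $L_u(k)$ is the pfaffian ideal of the ladder with upper corners $(1,2u+1),(2,2u+2),\ldots,(k,2u+k)$ and $\mathbf{t}=(u,\ldots,u)$, that is, $L_u(k)=\sum_{m=1}^{k}P(m,2u+m;u)$. $H_t(j,k)$ is the pfaffian ideal of the ladder with the $j+k$ upper corners $(1,2t-1),(2,2t),\ldots,(j,2t+j-2),(j+1,2t+j+1),\ldots,(j+k,2t+j+k)$ and $\mathbf{t}=(t-1,\ldots,t-1,t,\ldots,t)$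 with $j$ entries equal to $t-1$ followed by $k$ entries equal to $t$; that is, $H_t(j,k)=\sum_{m=1}^{j}P(m,2t+m-2;t-1)+\sum_{m=j+1}^{j+k}P(m,2t+m;t)$. For a homogeneous ideal $I\subset R$, $e(I)$ denotes the multiplicity (degree) of $R/I$. *)

theory Defs
  imports
    "HOL-Library.Poly_Mapping"
    "HOL-Algebra.Embedded_Algebras"
    "HOL-Algebra.QuotRing"
    "HOL-Computational_Algebra.Polynomial"
    "HOL-Combinatorics.Permutations"
begin

section \<open>The polynomial ring of a generic skew-symmetric matrix\<close>

text \<open>
  Variables are indexed by pairs; the pair \<open>(i, j)\<close> with \<open>i < j\<close> stands for the indeterminate
  \<open>x\<^sub>i\<^sub>j\<close>.  A monomial is a finitely supported exponent vector.
\<close>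

type_synonym skew_mon = "(nat \<times> nat) \<Rightarrow>\<^sub>0 nat"
type_synonym 'k skew_poly = "skew_mon \<Rightarrow>\<^sub>0 'k"

definition skew_vars :: "nat \<Rightarrow> (nat \<times> nat) set" where
  "skew_vars n = {(i, j). 1 \<le> i \<and> i < j \<and> j \<le> n}"

text \<open>
  The type \<open>'k skew_poly\<close> has infinitely many variables;  \<open>K[x\<^sub>i\<^sub>j | 1 \<le> i < j \<le> n]\<close> is the subring
  of the polynomials that involve only the variables in \<open>skew_vars n\<close>.
\<close>

definition skew_ring :: "nat \<Rightarrow> 'k::field skew_poly ring" where
  "skew_ring n =
     \<lparr>carrier = {p. \<forall>m\<in>Poly_Mapping.keys p. Poly_Mapping.keys m \<subseteq> skew_vars n},
      monoid.mult = \<lambda>p q. p * q, one = 1, zero = 0, add = \<lambda>p q. p + q\<rparr>"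

definition skew_const :: "'k::field \<Rightarrow> 'k skew_poly" where
  "skew_const c = Poly_Mapping.single 0 c"

definition skew_var :: "nat \<times> nat \<Rightarrow> 'k::field skew_poly" where
  "skew_var v = Poly_Mapping.single (Poly_Mapping.single v 1) 1"

definition skew_matrix :: "nat \<Rightarrow> nat \<Rightarrow> 'k::field skew_poly" where
  "skew_matrix i j =
     (if i < j then skew_var (i, j) else if j < i then - skew_var (j, i) else 0)"

definition total_degree :: "skew_mon \<Rightarrow> nat" where
  "total_degree m = (\<Sum>v\<in>Poly_Mapping.keys m. Poly_Mapping.lookup m v)"

definition homogeneous_part :: "nat \<Rightarrow> nat \<Rightarrow> 'k::field skew_poly set" where
  "homogeneous_part n d =
     {p \<in> carrier (skew_ring n). \<forall>m\<in>Poly_Mapping.keys p. total_degree m = d}"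


section \<open>Pfaffians and ladder pfaffian ideals\<close>

text \<open>
  The pfaffian of the \<open>2u \<times> 2u\<close> matrix \<open>A\<close> (rows and columns indexed from \<open>0\<close>).  The permutations
  \<open>\<sigma>\<close> over which the sum runs are the normalized representatives of the perfect matchings
  \<open>{{\<sigma> 0, \<sigma> 1}, {\<sigma> 2, \<sigma> 3}, \<dots>}\<close> of \<open>{0, \<dots>, 2u - 1}\<close>, so that no division by \<open>2^u u!\<close> is needed and
  the definition is valid in every characteristic.
\<close>

definition pfaffian :: "nat \<Rightarrow> (nat \<Rightarrow> nat \<Rightarrow> 'a::comm_ring_1) \<Rightarrow> 'a" where
  "pfaffian u A =
     (\<Sum>\<sigma> | \<sigma> permutes {..<2 * u} \<and>
            (\<forall>i<u. \<sigma> (2 * i) < \<sigma> (2 * i + 1)) \<and>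
            (\<forall>i. i + 1 < u \<longrightarrow> \<sigma> (2 * i) < \<sigma> (2 * (i + 1))).
        of_int (sign \<sigma>) * (\<Prod>i<u. A (\<sigma> (2 * i)) (\<sigma> (2 * i + 1))))"

text \<open>The pfaffian of the submatrix of \<open>X\<close> with rows and columns in \<open>S\<close>, where \<open>|S| = 2u\<close>.\<close>

definition sub_pfaffian :: "nat \<Rightarrow> nat set \<Rightarrow> 'k::field skew_poly" where
  "sub_pfaffian u S =
     pfaffian u (\<lambda>i j. skew_matrix (sorted_list_of_set S ! i) (sorted_list_of_set S ! j))"

definition pfaffian_ideal :: "nat \<Rightarrow> nat \<Rightarrow> nat \<Rightarrow> nat \<Rightarrow> 'k::field skew_poly set" where
  "pfaffian_ideal n a b u =
     Idl\<^bsub>skew_ring n\<^esub> {sub_pfaffian u S | S. S \<subseteq> {a..b} \<and> card S = 2 * u}"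

text \<open>
  A ladder together with its vector \<open>t\<close> is given by the list of the triples \<open>(a\<^sub>m, b\<^sub>m, t\<^sub>m)\<close>.
\<close>

definition ladder_ideal :: "nat \<Rightarrow> (nat \<times> nat \<times> nat) list \<Rightarrow> 'k::field skew_poly set" where
  "ladder_ideal n cs =
     foldr (\<lambda>(a, b, u) I. pfaffian_ideal n a b u <+>\<^bsub>skew_ring n\<^esub> I) cs {\<zero>\<^bsub>skew_ring n\<^esub>}"

definition L_ideal :: "nat \<Rightarrow> nat \<Rightarrow> nat \<Rightarrow> 'k::field skew_poly set" where
  "L_ideal n u k = ladder_ideal n (map (\<lambda>m. (m, 2 * u + m, u)) [1..<k + 1])"

definition H_ideal :: "nat \<Rightarrow> nat \<Rightarrow> nat \<Rightarrow> nat \<Rightarrow> 'k::field skew_poly set" where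
  "H_ideal n t j k = ladder_ideal n
     (map (\<lambda>m. (m, 2 * t + m - 2, t - 1)) [1..<j + 1] @
      map (\<lambda>m. (m, 2 * t + m, t)) [j + 1..<j + k + 1])"


section \<open>Multiplicity\<close>

text \<open>
  \<open>hilbert_function n I d\<close> is the dimension of \<open>(R/I)\<^sub>d\<close> over \<open>K\<close>, with \<open>K\<close> and \<open>R\<^sub>d\<close> represented by
  their images in \<open>R/I\<close>.
\<close>

definition hilbert_function :: "nat \<Rightarrow> 'k::field skew_poly set \<Rightarrow> nat \<Rightarrow> nat" where
  "hilbert_function n I d =
     ring.dim (skew_ring n Quot I)
       (range (\<lambda>c. I +>\<^bsub>skew_ring n\<^esub> skew_const c))
       ((\<lambda>p. I +>\<^bsub>skew_ring n\<^esub> p) ` homogeneous_part n d)"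

definition hilbert_polynomial :: "nat \<Rightarrow> 'k::field skew_poly set \<Rightarrow> rat poly" where
  "hilbert_polynomial n I =
     (THE p. \<forall>\<^sub>F d in sequentially. of_nat (hilbert_function n I d) = poly p (of_nat d))"

text \<open>
  \<open>e(R/I) = (\<delta> - 1)! \<cdot> (leading coefficient of the Hilbert polynomial)\<close> if \<open>\<delta> = dim R/I > 0\<close>, where
  \<open>\<delta> - 1\<close> is the degree of the Hilbert polynomial; and \<open>e(R/I)\<close> is the length of \<open>R/I\<close> if \<open>\<delta> = 0\<close>,
  that is, if the Hilbert polynomial vanishes.
\<close>

definition graded_multiplicity :: "nat \<Rightarrow> 'k::field skew_poly set \<Rightarrow> rat" where
  "graded_multiplicity n I =
     (let p = hilbert_polynomial n I in
      if p = 0 then of_nat (\<Sum>d | hilbert_function n I d \<noteq> 0. hilbert_function n I d)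
      else fact (degree p) * lead_coeff p)"

end

theory Submission
  imports Defs "HOL-Library.Multiset_Order" "HOL-Library.Nat_Bijection"
begin

text \<open>
  For a lexicographic term order, the leading monomial of a pfaffian is the product along its
  antidiagonal. The generators of the three ladder ideals are Groebner bases with these squarefree
  leading monomials. This is shown by induction: a \<open>(2h + 1)\<close>-window \<open>W\<close> of maximal size is replaced
  by the window \<open>W'\<close> without the two end points, which gives an ideal \<open>J\<close>, or by the pfaffians of
  \<open>W\<close> without one of its two end points, which gives an ideal \<open>N\<close> contained in \<open>I\<close> and \<open>J\<close>. A Pluecker
  relation yields \<open>f I \<subseteq> g J + N\<close> with pfaffians \<open>f\<close>, \<open>g\<close> whose leading monomials involve only
  variables that do not occur in the initial ideal of \<open>N\<close>, and the leading terms of \<open>I\<close> can be read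
  off from this.

  The multiplicity is then the number of faces of maximal size of the Stanley-Reisner complex of the
  initial ideal. The leading monomials that come from a window with center \<open>c\<close> only involve variables
  \<open>x\<^sub>a\<^sub>b\<close> with \<open>2c - 1 \<le> a + b \<le> 2c + 1\<close>. Hence the two parts of \<open>H\<^sub>t(j, k)\<close> have initial ideals in
  disjoint sets of variables, its complex is a join, and the numbers of maximal faces multiply.
\<close>

section \<open>Leading monomials\<close>

text \<open>No S-pairs are computed: in(I) \<subseteq> in(N) + x in(J), where x is the variable of
  the two end points of the window, so I inherits the Groebner property from N and J. The obstacle
  is to find a class of ideals that is closed under both replacements. Deleting a window leaves the
  pfaffians of the window without one end, and these become isolated generators if no neighbouring
  window supplies them. Hence the second kind of generator, \<open>pairwin\<close>, a window of even
  size with a half-integer center. The leading monomials of f and g lie on the antidiagonal a + b =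
  2c, which is avoided by the other windows and by every \<open>pairwin\<close>; so they are
  nonzerodivisors modulo in(N). Choosing a window of maximal height forces a neighbour to have
  height h or h - 1, and then it supplies the end pfaffian as a generator or through a single row
  expansion.\<close>

abbreviation "mkeys \<equiv> Poly_Mapping.keys"
abbreviation "mlookup \<equiv> Poly_Mapping.lookup"
abbreviation "msingle \<equiv> Poly_Mapping.single"

text \<open>
  Only the ranks of pairs \<open>(a, b)\<close> with \<open>a \<le> b\<close> matter: the larger column, and then the smaller row, is
  more significant. The other branch makes the rank injective on all pairs.
\<close>

definition var_rank :: "nat \<times> nat \<Rightarrow> nat" where
  "var_rank v = (case v of (a, b) \<Rightarrow> if a \<le> b then 2 * (b * b + (b - a)) else 2 * prod_encode (a, b) + 1)"

text \<open>Before doubling, the ranks of column b lie between b * b and b * b + b, below the square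
  where the next column starts; inside a column, b - a grows as the row a decreases.\<close>

lemma var_rank_less:
  assumes "a \<le> b" "c \<le> d" "b < d \<or> b = d \<and> c < a"
  shows "var_rank (a, b) < var_rank (c, d)"
proof -
  have "b * b + (b - a) < d * d + (d - c)" if "b < d"
  proof -
    have "b * b + b < (b + 1) * (b + 1)" by simp
    also have "\<dots> \<le> d * d" using that by (intro mult_le_mono) auto
    finally show ?thesis by linarith
  qed
  then show ?thesis using assms by (auto simp: var_rank_def)
qed

text \<open>The parity of the rank tells the two branches apart; in the first one,
  \<open>var_rank_less\<close> separates distinct pairs. Injectivity lets \<open>mon_mset\<close>
  determine the monomial.\<close>

lemma inj_var_rank: "inj var_rank"
proof (rule injI)
  fix v w assume eq: "var_rank v = var_rank w"
  obtain a b c d where vw: "v = (a, b)" "w = (c, d)" by (metis surj_pair)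
  show "v = w"
  proof (cases "a \<le> b")
    case True
    then have cd: "c \<le> d" using eq unfolding vw var_rank_def by (auto split: if_splits) presburger
    have "\<not> var_rank (a, b) < var_rank (c, d)" "\<not> var_rank (c, d) < var_rank (a, b)"
      using eq vw by auto
    then have "\<not> (b < d \<or> b = d \<and> c < a)" "\<not> (d < b \<or> d = b \<and> a < c)"
      using var_rank_less True cd by blast+
    then show ?thesis unfolding vw by auto
  next
    case False
    then have "\<not> c \<le> d" using eq unfolding vw var_rank_def by (auto split: if_splits) presburger
    then have "prod_encode (a, b) = prod_encode (c, d)" using eq False unfolding vw var_rank_def by simp
    then show ?thesis unfolding vw by (simp only: prod_encode_eq)
  qed
qed

text \<open>
  Monomials are compared through the multiset extension of the order of their variables. This is
  the lexicographic term order, and it inherits well-foundedness and compatibility with addition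
  from the library.
\<close>

definition mon_mset :: "skew_mon \<Rightarrow> nat multiset" where
  "mon_mset m = (\<Sum>v\<in>mkeys m. replicate_mset (mlookup m v) (var_rank v))"

lemma count_mon_mset: "count (mon_mset m) (var_rank v) = mlookup m v"
proof -
  have "count (mon_mset m) (var_rank v) = (\<Sum>w\<in>mkeys m. if w = v then mlookup m w else 0)"
    unfolding mon_mset_def count_sum by (intro sum.cong) (auto dest: injD[OF inj_var_rank])
  also have "\<dots> = mlookup m v" by (simp add: sum.delta in_keys_iff)
  finally show ?thesis .
qed

lemma count_mon_mset_outside: "k \<notin> range var_rank \<Longrightarrow> count (mon_mset m) k = 0"
  unfolding mon_mset_def count_sum by (intro sum.neutral) auto

lemma mon_mset_eqI:
  "(\<And>v. count A (var_rank v) = count B (var_rank v)) \<Longrightarrow>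
   (\<And>k. k \<notin> range var_rank \<Longrightarrow> count A k = count B k) \<Longrightarrow> A = B"
  by (rule multiset_eqI) (metis rangeE)

lemma mon_mset_plus: "mon_mset (m + m') = mon_mset m + mon_mset m'"
  by (rule mon_mset_eqI) (simp_all add: count_mon_mset count_mon_mset_outside lookup_add)

lemma mon_mset_eq_iff [simp]: "mon_mset m = mon_mset m' \<longleftrightarrow> m = m'"
  by (metis count_mon_mset poly_mapping_eqI)

lemma mon_mset_zero [simp]: "mon_mset 0 = {#}"
  by (simp add: mon_mset_def)

lemma poly_mapping_sum_single:
  "p = (\<Sum>m\<in>mkeys p. msingle m (mlookup p m))"
  by (rule poly_mapping_eqI) (auto simp: lookup_sum lookup_single when_def sum.delta in_keys_iff)

lemma times_sum_single:
  "p * q = (\<Sum>(m, m')\<in>mkeys p \<times> mkeys q. msingle (m + m') (mlookup p m * mlookup q m'))"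
  by (subst (1) poly_mapping_sum_single[of p], subst (1) poly_mapping_sum_single[of q])
     (simp add: sum_product mult_single sum.cartesian_product)

lemma keys_times_subset:
  assumes "m \<in> mkeys (p * q)" obtains a b where "a \<in> mkeys p" "b \<in> mkeys q" "m = a + b"
  using assms keys_mult by blast

text \<open>The maximum is unique because the order is total and \<open>mon_mset\<close> is
  injective. \<open>lm 0\<close> is unspecified, hence the hypotheses p \<noteq> 0 below.\<close>

definition lm :: "'k::field skew_poly \<Rightarrow> skew_mon" where
  "lm p = (THE m. m \<in> mkeys p \<and> (\<forall>m'\<in>mkeys p. mon_mset m' \<le> mon_mset m))"

lemma lm_eqI:
  assumes "m \<in> mkeys p" "\<And>m'. m' \<in> mkeys p \<Longrightarrow> mon_mset m' \<le> mon_mset m"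
  shows "lm p = m"
  unfolding lm_def
proof (rule the_equality)
  fix m'' assume "m'' \<in> mkeys p \<and> (\<forall>m'\<in>mkeys p. mon_mset m' \<le> mon_mset m'')"
  then have "mon_mset m'' = mon_mset m" using assms by (intro order_antisym) auto
  then show "m'' = m" by simp
qed (use assms in auto)

lemma
  assumes "p \<noteq> 0"
  shows lm_in_keys: "lm p \<in> mkeys p"
    and lm_max: "m \<in> mkeys p \<Longrightarrow> mon_mset m \<le> mon_mset (lm p)"
proof -
  have ne: "mkeys p \<noteq> {}" using assms by simp
  obtain x where x: "x \<in> mkeys p" "mon_mset x = Max (mon_mset ` mkeys p)"
    using Max_in[of "mon_mset ` mkeys p"] ne by fastforce
  have "lm p = x" by (rule lm_eqI) (use x in \<open>auto intro: Max_ge\<close>)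
  then show "lm p \<in> mkeys p" "m \<in> mkeys p \<Longrightarrow> mon_mset m \<le> mon_mset (lm p)"
    using x by auto
qed

lemma lm_less: "m \<in> mkeys p \<Longrightarrow> m \<noteq> lm p \<Longrightarrow> mon_mset m < mon_mset (lm p)"
  by (metis keys_zero empty_iff lm_max mon_mset_eq_iff order_le_neq_trans)

lemma lookup_lm: "p \<noteq> 0 \<Longrightarrow> mlookup p (lm p) \<noteq> 0"
  using lm_in_keys by (simp add: in_keys_iff)

text \<open>Addition is strictly compatible with the order, so the pair of leading monomials is the
  only pair of keys with this sum and nothing cancels. Integrality of the ring and multiplicativity
  of \<open>lm\<close> follow.\<close>

lemma lookup_times_lm:
  assumes "p \<noteq> 0" "q \<noteq> 0"
  shows "mlookup (p * q) (lm p + lm q) = mlookup p (lm p) * mlookup q (lm q)"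
proof -
  have "m + m' = lm p + lm q \<longleftrightarrow> (m, m') = (lm p, lm q)" if "m \<in> mkeys p" "m' \<in> mkeys q" for m m'
  proof
    assume eq: "m + m' = lm p + lm q"
    have le: "mon_mset m \<le> mon_mset (lm p)" "mon_mset m' \<le> mon_mset (lm q)"
      using that assms by (auto intro: lm_max)
    have "mon_mset m + mon_mset m' = mon_mset (lm p) + mon_mset (lm q)"
      using eq by (metis mon_mset_plus)
    then have "mon_mset m = mon_mset (lm p) \<and> mon_mset m' = mon_mset (lm q)"
      using le by (metis add_less_le_mono add_le_less_mono order_less_irrefl order_le_neq_trans)
    then show "(m, m') = (lm p, lm q)" by simp
  qed simp
  then have "mlookup (p * q) (lm p + lm q) =
      (\<Sum>x\<in>mkeys p \<times> mkeys q. if x = (lm p, lm q) then mlookup p (lm p) * mlookup q (lm q) else 0)"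
    unfolding times_sum_single lookup_sum
    by (intro sum.cong) (fastforce simp: lookup_single when_def)+
  also have "\<dots> = mlookup p (lm p) * mlookup q (lm q)"
    using assms by (simp add: sum.delta lm_in_keys)
  finally show ?thesis .
qed

lemma times_neq_zero: "p \<noteq> 0 \<Longrightarrow> q \<noteq> 0 \<Longrightarrow> p * q \<noteq> (0 :: 'k::field skew_poly)"
  using lookup_times_lm[of p q] lookup_lm[of p] lookup_lm[of q] by auto

lemma lm_times:
  assumes "p \<noteq> 0" "q \<noteq> 0" shows "lm (p * q) = lm p + lm q"
proof (rule lm_eqI)
  show "lm p + lm q \<in> mkeys (p * q)"
    using assms by (simp add: in_keys_iff lookup_times_lm lookup_lm)
  fix m assume "m \<in> mkeys (p * q)"
  then obtain a b where "a \<in> mkeys p" "b \<in> mkeys q" "m = a + b" by (rule keys_times_subset)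
  then show "mon_mset m \<le> mon_mset (lm p + lm q)"
    using assms by (simp add: mon_mset_plus add_mono lm_max)
qed

lemma lm_uminus [simp]: "lm (- p) = lm p"
  by (simp add: lm_def in_keys_iff)

lemma keys_minus_subset: "mkeys (p - q) \<subseteq> mkeys p \<union> mkeys (q :: 'a \<Rightarrow>\<^sub>0 'b::ab_group_add)"
  by (auto simp: in_keys_iff lookup_minus)

text \<open>Distinct leading monomials cannot cancel, so the larger one survives. Which one it is
  stays open, since \<open>lm_link\<close> can treat both cases.\<close>

lemma lm_diff:
  assumes "p \<noteq> 0" "q \<noteq> 0" "lm p \<noteq> lm q"
  shows "p - q \<noteq> 0" "lm (p - q) \<in> {lm p, lm q}"
proof -
  have *: "x - y \<noteq> 0 \<and> lm (x - y) = lm x"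
    if "x \<noteq> 0" "y \<noteq> 0" "mon_mset (lm y) < mon_mset (lm x)" for x y :: "'a skew_poly"
  proof -
    have "lm x \<notin> mkeys y" using that(3) lm_max[OF that(2), of "lm x"] by (meson leD)
    then have k: "lm x \<in> mkeys (x - y)" 
      using lookup_lm[OF that(1)] unfolding in_keys_iff lookup_minus by (metis diff_0_right)
    moreover have "lm (x - y) = lm x"
    proof (rule lm_eqI[OF k])
      fix m' assume "m' \<in> mkeys (x - y)"
      then have "m' \<in> mkeys x \<or> m' \<in> mkeys y" using keys_minus_subset[of x y] by (meson UnE subsetD)
      then show "mon_mset m' \<le> mon_mset (lm x)"
        using that(3) lm_max[OF that(1), of m'] lm_max[OF that(2), of m'] by (meson order.strict_implies_order order_trans)
    qed
    ultimately show ?thesis by auto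
  qed
  have "mon_mset (lm p) \<noteq> mon_mset (lm q)" using assms by simp
  then consider "mon_mset (lm q) < mon_mset (lm p)" | "mon_mset (lm p) < mon_mset (lm q)"
    by (meson linorder_neqE)
  then have "p - q \<noteq> 0 \<and> lm (p - q) \<in> {lm p, lm q}"
  proof cases
    case 1 then show ?thesis using *[OF assms(1,2)] by simp
  next
    case 2
    then show ?thesis using *[OF assms(2,1)] lm_uminus[of "q - p"] by auto
  qed
  then show "p - q \<noteq> 0" "lm (p - q) \<in> {lm p, lm q}" by auto
qed

lemma lookup_skew_const_times [simp]: "mlookup (skew_const c * p) m = c * mlookup p m"
  unfolding skew_const_def mult_map_scale_conv_mult[symmetric]
  by (simp add: Poly_Mapping.map.rep_eq when_def)

text \<open>One step of the division algorithm: c makes the two leading terms cancel.\<close>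

lemma lm_cancel:
  assumes "p \<noteq> 0" "q \<noteq> 0" "lm p = lm q"
    and c: "c = mlookup p (lm p) / mlookup q (lm q)"
    and r: "r = p - skew_const c * q" "r \<noteq> 0"
  shows "mon_mset (lm r) < mon_mset (lm p)"
proof -
  have "lm p \<notin> mkeys r"
    using assms lookup_lm[OF assms(2)] by (simp add: in_keys_iff lookup_minus)
  moreover have "lm r \<in> mkeys r" using r lm_in_keys by blast
  ultimately have "lm r \<noteq> lm p" by metis
  have "lm r \<in> mkeys p \<or> lm r \<in> mkeys q"
    using \<open>lm r \<in> mkeys r\<close> unfolding r by (auto simp: in_keys_iff lookup_minus)
  then show ?thesis using \<open>lm r \<noteq> lm p\<close> assms(3) lm_less by metis
qed

text \<open>Well-founded induction on the leading monomial: while it is the leading monomial of some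
  element of N, a scalar multiple of that element is subtracted. Only the head is reduced, so it
  suffices that N is a subspace.\<close>

lemma reduce_mod_subspace:
  assumes N: "\<And>p q. p \<in> N \<Longrightarrow> q \<in> N \<Longrightarrow> p + q \<in> N" "0 \<in> N"
    "\<And>c p. p \<in> N \<Longrightarrow> skew_const c * p \<in> N"
  shows "\<exists>\<nu>\<in>N. q - \<nu> = 0 \<or> lm (q - \<nu>) \<notin> lm ` (N - {0 :: 'k::field skew_poly})"
proof (induction "mon_mset (lm q)" arbitrary: q rule: less_induct)
  case less
  show ?case
  proof (cases "q = 0 \<or> lm q \<notin> lm ` (N - {0})")
    case True
    then show ?thesis using N(2) by (intro bexI[of _ 0]) auto
  next
    case False
    then obtain \<nu> where \<nu>: "\<nu> \<in> N" "\<nu> \<noteq> 0" "lm q = lm \<nu>" by auto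
    define c where "c = mlookup q (lm q) / mlookup \<nu> (lm \<nu>)"
    define r where "r = q - skew_const c * \<nu>"
    show ?thesis
    proof (cases "r = 0")
      case True
      then show ?thesis using N(3)[OF \<nu>(1), of c] unfolding r_def by blast
    next
      case False
      then have "mon_mset (lm r) < mon_mset (lm q)"
        using lm_cancel[of q \<nu> c r] \<open>\<not> (q = 0 \<or> _)\<close> \<nu> c_def r_def by auto
      from less[OF this] obtain \<mu> where "\<mu> \<in> N" "r - \<mu> = 0 \<or> lm (r - \<mu>) \<notin> lm ` (N - {0})" by blast
      moreover have "r - \<mu> = q - (skew_const c * \<nu> + \<mu>)" by (simp add: r_def)
      ultimately show ?thesis using N \<nu>(1) by (intro bexI[of _ "skew_const c * \<nu> + \<mu>"]) auto
    qed
  qed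
qed

text \<open>
  The step of the induction over ladders: an element of \<open>I\<close> is transported to \<open>J\<close> by multiplication
  by \<open>f\<close> and division by \<open>g\<close> modulo \<open>N\<close>. The leading terms of the two products lie outside of the
  initial ideal of \<open>N\<close>, so they have to cancel.
\<close>

lemma lm_link:
  assumes N: "\<And>p q. p \<in> N \<Longrightarrow> q \<in> N \<Longrightarrow> p + q \<in> N" "0 \<in> N"
    "\<And>c p. p \<in> N \<Longrightarrow> skew_const c * p \<in> N" "\<And>p. p \<in> N \<Longrightarrow> g * p \<in> N"
    and J: "\<And>q \<nu>. q \<in> J \<Longrightarrow> \<nu> \<in> N \<Longrightarrow> q - \<nu> \<in> J"
    and f0: "f \<noteq> 0" and g0: "g \<noteq> (0 :: 'k::field skew_poly)"
    and fg: "lm g = x + lm f"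
    and LN: "\<And>m. m \<in> lm ` (N - {0}) \<longleftrightarrow> m \<in> MN \<and> m \<in> V"
    and V: "\<And>m m'. m + m' \<in> V \<longleftrightarrow> m \<in> V \<and> m' \<in> V"
    and f_reg: "\<And>m. lm f + m \<in> MN \<Longrightarrow> m \<in> MN"
    and g_reg: "\<And>m. lm g + m \<in> MN \<Longrightarrow> m \<in> MN"
    and p: "p \<noteq> 0" "lm p \<in> V" "f * p = g * q + \<nu>" "q \<in> J" "\<nu> \<in> N" and JV: "\<And>q. q \<in> J \<Longrightarrow> q \<noteq> 0 \<Longrightarrow> lm q \<in> V"
  shows "lm p \<in> MN \<or> (\<exists>q\<in>J. q \<noteq> 0 \<and> lm p = x + lm q)"
proof (rule disjCI)
  assume no: "\<not> (\<exists>q\<in>J. q \<noteq> 0 \<and> lm p = x + lm q)"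
  obtain \<mu> where \<mu>: "\<mu> \<in> N" "q - \<mu> = 0 \<or> lm (q - \<mu>) \<notin> lm ` (N - {0})"
    using reduce_mod_subspace[OF N(1-3)] by blast
  \<comment> \<open>r represents q modulo N with a leading monomial outside in(N); the correction
    goes into \<rho>.\<close>
  define r where "r = q - \<mu>"
  define \<rho> where "\<rho> = \<nu> + g * \<mu>"
  have r: "r \<in> J" "r = 0 \<or> lm r \<notin> lm ` (N - {0})" and \<rho>: "\<rho> \<in> N"
    using \<mu> J p N unfolding r_def \<rho>_def by auto
  have eq: "f * p - g * r = \<rho>"
    unfolding r_def \<rho>_def p(3) by (simp add: algebra_simps)
  have fp: "f * p \<noteq> 0" "lm (f * p) = lm f + lm p" using f0 p(1) by (auto simp: lm_times times_neq_zero)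
  have in_MN: "lm z \<in> MN" if "z \<in> N" "z \<noteq> 0" for z using LN[of "lm z"] that by auto
  show "lm p \<in> MN"
  proof (cases "r = 0")
    case True
    then have "f * p \<in> N" using eq \<rho> by simp
    then show ?thesis using in_MN fp f_reg by metis
  next
    case False
    then have gr: "g * r \<noteq> 0" "lm (g * r) = lm g + lm r" using g0 by (auto simp: lm_times times_neq_zero)
    have "lm (f * p) \<noteq> lm (g * r)"
    proof
      assume "lm (f * p) = lm (g * r)"
      then have "lm f + lm p = lm f + (x + lm r)" using fp gr fg by (simp add: ac_simps)
      then have "lm p = x + lm r" by simp
      then show False using no r False by blast
    qed
    \<comment> \<open>Without cancellation, one of the two leading monomials is that of \<rho> \<in>
      N. It is not the one of g * r, by the choice of r and the regularity of
      \<open>lm g\<close>.\<close>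
    from lm_diff[OF fp(1) gr(1) this] eq in_MN[OF \<rho>]
    have "lm (f * p) \<in> MN \<or> lm (g * r) \<in> MN" by auto
    moreover have "lm (g * r) \<notin> MN"
      using r False LN[of "lm r"] JV[OF r(1)] g_reg[of "lm r"] gr(2) by auto
    ultimately show ?thesis using fp f_reg by metis
  qed
qed

section \<open>Expansion of pfaffians\<close>

text \<open>The increasing enumeration of the positions other than 0 and k + 1, those left when 0 is
  paired with k + 1.\<close>

definition skip2 :: "nat \<Rightarrow> nat \<Rightarrow> nat" where
  "skip2 k i = (if i < k then i + 1 else i + 2)"

text \<open>The permutation listing 0, then k + 1, then the other positions in order: a product of k
  adjacent transpositions, hence of sign (- 1) ^ k.\<close>

definition cyc :: "nat \<Rightarrow> nat \<Rightarrow> nat" where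
  "cyc k i = (if i = 0 then 0 else if i = 1 then k + 1 else skip2 k (i - 2))"

lemma skip2_less_iff [simp]: "skip2 k i < skip2 k j \<longleftrightarrow> i < j"
  by (auto simp: skip2_def)

lemma skip2_eq_iff [simp]: "skip2 k i = skip2 k j \<longleftrightarrow> i = j"
  by (auto simp: skip2_def)

lemma cyc_Suc: "cyc (Suc k) = transpose (k + 1) (k + 2) \<circ> cyc k"
  by (auto simp: fun_eq_iff cyc_def skip2_def transpose_def)

lemma cyc_0: "cyc 0 = id"
  by (auto simp: fun_eq_iff cyc_def skip2_def)

lemma cyc_permutes: "cyc k permutes {..<k + 2}"
proof (induction k)
  case (Suc k)
  have "cyc k permutes {..<Suc k + 2}" by (rule permutes_subset[OF Suc]) auto
  then show ?case unfolding cyc_Suc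
    by (rule permutes_compose) (auto intro: permutes_swap_id)
qed (simp only: cyc_0 permutes_id)

lemma sign_cyc: "sign (cyc k) = (- 1) ^ k"
proof (induction k)
  case (Suc k)
  have "permutation (cyc k)" by (rule permutes_imp_permutation[OF _ cyc_permutes]) simp
  then show ?case unfolding cyc_Suc
    by (subst sign_compose) (simp_all only: Suc permutation_swap_id sign_swap_id, simp_all)
qed (simp add: cyc_0)

definition matching_perms :: "nat \<Rightarrow> (nat \<Rightarrow> nat) set" where
  "matching_perms u = {\<sigma>. \<sigma> permutes {..<2 * u} \<and>
            (\<forall>i<u. \<sigma> (2 * i) < \<sigma> (2 * i + 1)) \<and>
            (\<forall>i. i + 1 < u \<longrightarrow> \<sigma> (2 * i) < \<sigma> (2 * (i + 1)))}"

text \<open>The inverse of removing the pair of 0, namely (0, k + 1), from a normalized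
  matching.\<close>

definition extend_matching :: "nat \<Rightarrow> (nat \<Rightarrow> nat) \<Rightarrow> nat \<Rightarrow> nat" where
  "extend_matching k \<tau> i = (if i = 0 then 0 else if i = 1 then k + 1 else skip2 k (\<tau> (i - 2)))"

lemma extend_matching_simps [simp]:
  "extend_matching k \<tau> 0 = 0" "extend_matching k \<tau> (Suc 0) = k + 1"
  "extend_matching k \<tau> (Suc (Suc i)) = skip2 k (\<tau> i)"
  by (auto simp: extend_matching_def)

text \<open>The map factors as \<open>cyc k\<close> after a copy of \<tau> moved by two places, and
  moving keeps the sign.\<close>

lemma extend_matching_permutes:
  assumes \<tau>: "\<tau> permutes {..<n}" and k: "k \<le> n"
  shows "extend_matching k \<tau> permutes {..<n + 2}"
    and "sign (extend_matching k \<tau>) = (- 1) ^ k * sign \<tau>"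
proof -
  define L where "L = map_permutation {..<n} (\<lambda>i. i + 2) \<tau>"
  have img: "(\<lambda>i. i + 2) ` {..<n} = {2..<n + 2}"
    by (metis image_add_atLeastLessThan' lessThan_atLeast0 add_0)
  have bij: "bij_betw (\<lambda>i. i + 2) {..<n} {2..<n + 2}"
    using img by (simp add: bij_betw_def inj_on_def)
  have perm: "L permutes {2..<n + 2}" unfolding L_def by (rule map_permutation_permutes[OF bij \<tau>])
  have l: "L i = (if i < 2 then i else \<tau> (i - 2) + 2)" for i
  proof (cases "i \<in> {2..<n + 2}")
    case True
    then have "L (i - 2 + 2) = \<tau> (i - 2) + 2"
      unfolding L_def by (intro map_permutation_apply) (auto simp: inj_on_def)
    then show ?thesis using True by (simp del: add_2_eq_Suc')
  next
    case False
    then show ?thesis using permutes_not_in[OF perm False] permutes_not_in[OF \<tau>, of "i - 2"] by auto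
  qed
  have eq: "extend_matching k \<tau> = cyc k \<circ> L"
    by (auto simp: fun_eq_iff l extend_matching_def cyc_def)
  have p1: "L permutes {..<n + 2}" by (rule permutes_subset[OF perm]) auto
  have p2: "cyc k permutes {..<n + 2}" by (rule permutes_subset[OF cyc_permutes]) (use k in auto)
  show "extend_matching k \<tau> permutes {..<n + 2}" unfolding eq by (rule permutes_compose[OF p1 p2])
  have "sign L = sign \<tau>" unfolding L_def by (rule sign_map_permutation[OF _ \<tau>]) (auto simp: inj_on_def)
  moreover have "permutation L" "permutation (cyc k)"
    using p1 p2 permutes_imp_permutation by blast+
  ultimately show "sign (extend_matching k \<tau>) = (- 1) ^ k * sign \<tau>"
    unfolding eq by (simp add: sign_compose sign_cyc)
qed

text \<open>If 0 were taken at an odd position, or at an even position other than 0, normalization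
  would require a smaller value somewhere.\<close>

lemma matching_perms_0:
  assumes "\<sigma> \<in> matching_perms (Suc u)" shows "\<sigma> 0 = 0"
proof -
  have \<sigma>: "\<sigma> permutes {..<2 * Suc u}" "\<And>i. i < Suc u \<Longrightarrow> \<sigma> (2 * i) < \<sigma> (2 * i + 1)"
    "\<And>i. i + 1 < Suc u \<Longrightarrow> \<sigma> (2 * i) < \<sigma> (2 * (i + 1))"
    using assms by (auto simp: matching_perms_def)
  have "0 \<in> \<sigma> ` {..<2 * Suc u}" unfolding permutes_image[OF \<sigma>(1)] by simp
  then obtain x where x: "x < 2 * Suc u" "\<sigma> x = 0" by auto
  show ?thesis
  proof (cases "even x")
    case True
    then obtain i where i: "x = 2 * i" by (elim evenE)
    show ?thesis
    proof (cases i)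
      case (Suc i')
      then show ?thesis using \<sigma>(3)[of i'] x i by auto
    qed (use x i in auto)
  next
    case False
    then obtain i where "x = 2 * i + 1" by (elim oddE)
    then show ?thesis using \<sigma>(2)[of i] x by auto
  qed
qed

text \<open>A normalized matching amounts to the partner k + 1 of 0 and the matching induced on the
  other positions; \<open>skip2 k\<close> is strictly increasing, so it respects
  normalization.\<close>

lemma matching_perms_Suc:
  "matching_perms (Suc u) = (\<lambda>(k, \<tau>). extend_matching k \<tau>) ` ({..2 * u} \<times> matching_perms u)"
proof (intro equalityI subsetI)
  fix \<sigma> assume s: "\<sigma> \<in> matching_perms (Suc u)"
  then have \<sigma>: "\<sigma> permutes {..<2 * Suc u}" "\<And>i. i < Suc u \<Longrightarrow> \<sigma> (2 * i) < \<sigma> (2 * i + 1)"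
    "\<And>i. i + 1 < Suc u \<Longrightarrow> \<sigma> (2 * i) < \<sigma> (2 * (i + 1))"
    by (auto simp: matching_perms_def)
  have \<sigma>0: "\<sigma> 0 = 0" by (rule matching_perms_0[OF s])
  have inj: "\<sigma> x = \<sigma> y \<longleftrightarrow> x = y" for x y using permutes_inj[OF \<sigma>(1)] by (auto dest: injD)
  have lt: "\<sigma> x < 2 * u + 2 \<longleftrightarrow> x < 2 * u + 2" for x
    using permutes_in_image[OF \<sigma>(1), of x] by auto
  define k where "k = \<sigma> 1 - 1"
  have k1: "\<sigma> 1 = k + 1" using inj[of 1 0] \<sigma>0 by (simp add: k_def)
  have k: "k \<le> 2 * u" using lt[of 1] k1 by simp
  \<comment> \<open>\<open>un\<close> inverts \<open>skip2 k\<close> away from 0 and k + 1.\<close>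
  define un where "un x = (if x \<le> k then x - 1 else x - 2)" for x
  have un: "skip2 k (un x) = x" if "x \<noteq> 0" "x \<noteq> k + 1" for x
    using that by (auto simp: skip2_def un_def)
  \<comment> \<open>Beyond 2 * u the value is i because \<open>permutes\<close> demands the identity
    there.\<close>
  define \<tau> where "\<tau> i = (if i < 2 * u then un (\<sigma> (i + 2)) else i)" for i
  have sk: "skip2 k (\<tau> i) = \<sigma> (i + 2)" for i
  proof (cases "i < 2 * u")
    case True
    have "\<sigma> (i + 2) \<noteq> 0" "\<sigma> (i + 2) \<noteq> k + 1"
      using inj[of "i + 2" 0] inj[of "i + 2" 1] \<sigma>0 k1 by auto
    then show ?thesis using un True by (simp add: \<tau>_def)
  next
    case False
    then show ?thesis using permutes_not_in[OF \<sigma>(1), of "i + 2"] k by (simp add: \<tau>_def skip2_def)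
  qed
  have inj_\<tau>: "\<tau> x = \<tau> y \<longleftrightarrow> x = y" for x y
    using sk[of x] sk[of y] inj[of "x + 2" "y + 2"] skip2_eq_iff[of k "\<tau> x" "\<tau> y"] by auto
  have "\<tau> i < 2 * u" if "i < 2 * u" for i
    using sk[of i] lt[of "i + 2"] that k by (auto simp: skip2_def split: if_splits)
  then have "bij_betw \<tau> {..<2 * u} {..<2 * u}"
    unfolding bij_betw_def by (intro conjI endo_inj_surj inj_onI) (auto simp: inj_\<tau>)
  then have p\<tau>: "\<tau> permutes {..<2 * u}"
    by (rule bij_imp_permutes) (simp add: \<tau>_def)
  have "\<tau> (2 * i) < \<tau> (2 * i + 1)" if "i < u" for i
    using \<sigma>(2)[of "i + 1"] that sk[of "2 * i"] sk[of "2 * i + 1"]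
    by (subst skip2_less_iff[of k, symmetric]) simp
  moreover have "\<tau> (2 * i) < \<tau> (2 * (i + 1))" if "i + 1 < u" for i
    using \<sigma>(3)[of "i + 1"] that sk[of "2 * i"] sk[of "2 * (i + 1)"]
    by (subst skip2_less_iff[of k, symmetric]) simp
  ultimately have \<tau>: "\<tau> \<in> matching_perms u" using p\<tau> by (simp add: matching_perms_def)
  have "\<sigma> i = extend_matching k \<tau> i" for i
  proof (cases "i < 2")
    case True
    then show ?thesis using \<sigma>0 k1 by (cases "i = 0") (auto simp: extend_matching_def dest: less_2_cases)
  next
    case False
    then have "i - 2 + 2 = i" by simp
    then have "skip2 k (\<tau> (i - 2)) = \<sigma> i" using sk[of "i - 2"] by (simp only:)
    then show ?thesis using False by (simp add: extend_matching_def)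
  qed
  then have "\<sigma> = extend_matching k \<tau>" by blast
  then show "\<sigma> \<in> (\<lambda>(k, \<tau>). extend_matching k \<tau>) ` ({..2 * u} \<times> matching_perms u)"
    using k \<tau> by auto
next
  fix \<sigma> assume "\<sigma> \<in> (\<lambda>(k, \<tau>). extend_matching k \<tau>) ` ({..2 * u} \<times> matching_perms u)"
  then obtain k \<tau> where k: "k \<le> 2 * u" and t: "\<tau> \<in> matching_perms u" and s: "\<sigma> = extend_matching k \<tau>"
    by auto
  from t have \<tau>: "\<tau> permutes {..<2 * u}" "\<And>i. i < u \<Longrightarrow> \<tau> (2 * i) < \<tau> (2 * i + 1)"
    "\<And>i. i + 1 < u \<Longrightarrow> \<tau> (2 * i) < \<tau> (2 * (i + 1))"
    by (auto simp: matching_perms_def)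
  have "\<sigma> permutes {..<2 * Suc u}" using extend_matching_permutes(1)[OF \<tau>(1) k] s by simp
  moreover have "\<sigma> (2 * i) < \<sigma> (2 * i + 1)" if "i < Suc u" for i
    using that \<tau>(2) unfolding s by (cases i) auto
  moreover have "\<sigma> (2 * i) < \<sigma> (2 * (i + 1))" if "i + 1 < Suc u" for i
  proof (cases i)
    case 0
    then show ?thesis unfolding s by (simp add: numeral_2_eq_2) (simp add: skip2_def)
  next
    case (Suc i')
    then show ?thesis using \<tau>(3)[of i'] that unfolding s by simp
  qed
  ultimately show "\<sigma> \<in> matching_perms (Suc u)" by (simp add: matching_perms_def)
qed

lemma inj_extend_matching: "inj_on (\<lambda>(k, \<tau>). extend_matching k \<tau>) A"
proof (rule inj_onI, clarify)
  fix k \<tau> k' \<tau>' assume eq: "extend_matching k \<tau> = extend_matching k' \<tau>'"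
  have "k = k'" using fun_cong[OF eq, of 1] by simp
  moreover have "\<tau> i = \<tau>' i" for i using fun_cong[OF eq, of "i + 2"] \<open>k = k'\<close> by simp
  ultimately show "k = k' \<and> \<tau> = \<tau>'" by auto
qed

lemma pfaffian_0 [simp]: "pfaffian 0 A = 1"
proof -
  have "matching_perms 0 = {id}" by (auto simp: matching_perms_def permutes_id)
  then show ?thesis unfolding pfaffian_def matching_perms_def[symmetric] by simp
qed

text \<open>Expansion along row 0: matchings are grouped by the partner k + 1 of 0, and (- 1) ^ k is
  the sign of \<open>cyc k\<close>.\<close>

lemma pfaffian_Suc:
  "pfaffian (Suc u) A =
    (\<Sum>k\<le>2 * u. (- 1) ^ k * A 0 (k + 1) * pfaffian u (\<lambda>i j. A (skip2 k i) (skip2 k j)))"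
proof -
  define F where "F u A \<sigma> = of_int (sign \<sigma>) * (\<Prod>i<u. A (\<sigma> (2 * i)) (\<sigma> (2 * i + 1)))"
    for u and A :: "nat \<Rightarrow> nat \<Rightarrow> 'a" and \<sigma> :: "nat \<Rightarrow> nat"
  have pf: "pfaffian u A = sum (F u A) (matching_perms u)" for u A
    by (simp add: pfaffian_def F_def matching_perms_def)
  have "F (Suc u) A (extend_matching k \<tau>) =
      (- 1) ^ k * A 0 (k + 1) * F u (\<lambda>i j. A (skip2 k i) (skip2 k j)) \<tau>"
    if "k \<le> 2 * u" "\<tau> \<in> matching_perms u" for k \<tau>
  proof -
    have "\<tau> permutes {..<2 * u}" using that(2) by (simp add: matching_perms_def)
    then show ?thesis unfolding F_def prod.lessThan_Suc_shift
      using extend_matching_permutes(2)[of \<tau> "2 * u" k] that(1) by simp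
  qed
  then have "pfaffian (Suc u) A = (\<Sum>(k, \<tau>)\<in>{..2 * u} \<times> matching_perms u.
      (- 1) ^ k * A 0 (k + 1) * F u (\<lambda>i j. A (skip2 k i) (skip2 k j)) \<tau>)"
    unfolding pf matching_perms_Suc sum.reindex[OF inj_extend_matching]
    by (intro sum.cong) auto
  then show ?thesis unfolding pf by (simp add: sum.cartesian_product[symmetric] sum_distrib_left)
qed

lemma pfaffian_cong:
  assumes "\<And>i j. i < 2 * u \<Longrightarrow> j < 2 * u \<Longrightarrow> A i j = B i j"
  shows "pfaffian u A = pfaffian u B"
  unfolding pfaffian_def
proof (intro sum.cong arg_cong2[of _ _ _ _ times] prod.cong refl)
  fix \<sigma> i assume "\<sigma> \<in> {\<sigma>. \<sigma> permutes {..<2 * u} \<and> (\<forall>i<u. \<sigma> (2 * i) < \<sigma> (2 * i + 1)) \<and>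
      (\<forall>i. i + 1 < u \<longrightarrow> \<sigma> (2 * i) < \<sigma> (2 * (i + 1)))}" "i \<in> {..<u}"
  then have \<sigma>: "\<sigma> permutes {..<2 * u}" and "i < u" by auto
  then have "2 * i < 2 * u" "2 * i + 1 < 2 * u" by auto
  then show "A (\<sigma> (2 * i)) (\<sigma> (2 * i + 1)) = B (\<sigma> (2 * i)) (\<sigma> (2 * i + 1))"
    using permutes_in_image[OF \<sigma>] by (intro assms) auto
qed

section \<open>Pfaffians indexed by sets and their expansion along an arbitrary row\<close>

definition pf :: "nat set \<Rightarrow> 'k::field skew_poly" where
  "pf S = sub_pfaffian (card S div 2) S"

definition xvar :: "nat \<Rightarrow> nat \<Rightarrow> 'k::field skew_poly" where
  "xvar i j = skew_var (min i j, max i j)"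

definition between :: "nat \<Rightarrow> nat \<Rightarrow> nat set" where
  "between i j = {min i j<..<max i j}"

text \<open>Together with the unsigned variables \<open>xvar\<close>, this sign is symmetric in i
  and j, so one formula covers the expansion along every row.\<close>

definition chord_sign :: "nat set \<Rightarrow> nat \<Rightarrow> nat \<Rightarrow> 'k::field skew_poly" where
  "chord_sign S i j = (- 1) ^ card (S \<inter> between i j)"

lemma pf_empty [simp]: "pf {} = 1"
  by (simp add: pf_def sub_pfaffian_def)

lemma sub_pfaffian_eq_pf: "card S = 2 * u \<Longrightarrow> sub_pfaffian u S = pf S"
  by (simp add: pf_def)

lemma xvar_commute: "xvar i j = xvar j i"
  by (simp add: xvar_def min.commute max.commute)

lemma between_commute: "between i j = between j i"
  by (simp add: between_def min.commute max.commute)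

lemma chord_sign_commute: "chord_sign S i j = chord_sign S j i"
  by (simp add: chord_sign_def between_commute)

text \<open>This is \<open>pfaffian_Suc\<close> transported along the sorted list of S.\<close>

lemma pf_expand_Min:
  fixes S :: "nat set"
  assumes S: "finite S" "even (card S)" "S \<noteq> {}"
  defines "m \<equiv> Min S"
  shows "pf S = (\<Sum>j\<in>S - {m}. chord_sign S m j * xvar m j * pf (S - {m, j}) :: 'k::field skew_poly)"
proof -
  define l where "l = sorted_list_of_set S"
  obtain u where u: "card S = 2 * Suc u"
    using S by (metis card_0_eq evenE mult_0_right not0_implies_Suc)
  have l: "sorted_wrt (<) l" "set l = S" "length l = 2 * u + 2" "distinct l"
    using S u by (auto simp: l_def)
  have mono: "l ! i < l ! j \<longleftrightarrow> i < j" if "i < length l" "j < length l" for i j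
    using that l(1) by (metis sorted_wrt_nth_less linorder_neqE_nat order_less_asym order_less_irrefl)
  have inj: "l ! i = l ! j \<longleftrightarrow> i = j" if "i < length l" "j < length l" for i j
    using that l(4) by (simp add: nth_eq_iff_index_eq)
  have Sl: "S = (!) l ` {..<2 * u + 2}"
    using l by (metis atLeast_upt map_nth set_map)
  have "l ! 0 \<in> S" using l by (metis nth_mem zero_less_Suc add_2_eq_Suc')
  moreover have "l ! 0 \<le> x" if "x \<in> S" for x
  proof -
    obtain i where "i < 2 * u + 2" "x = l ! i" using \<open>x \<in> S\<close> by (subst (asm) Sl) auto
    then show ?thesis using mono[of 0 i] l(3) by (cases "i = 0") auto
  qed
  ultimately have m: "m = l ! 0" unfolding m_def using S(1) by (intro Min_eqI) auto
  have bij: "bij_betw (\<lambda>k. l ! (k + 1)) {..2 * u} (S - {m})"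
  proof (rule bij_betw_imageI)
    show "inj_on (\<lambda>k. l ! (k + 1)) {..2 * u}"
      by (rule inj_onI) (use inj l(3) in auto)
    show "(\<lambda>k. l ! (k + 1)) ` {..2 * u} = S - {m}"
    proof (intro equalityI subsetI)
      fix x assume "x \<in> (\<lambda>k. l ! (k + 1)) ` {..2 * u}"
      then obtain k where "k \<le> 2 * u" "x = l ! (k + 1)" by auto
      then show "x \<in> S - {m}" unfolding Sl m using inj[of "k + 1" 0] l(3) by auto
    next
      fix x assume "x \<in> S - {m}"
      then obtain i where "i < 2 * u + 2" "x = l ! i" "i \<noteq> 0" unfolding Sl m by auto
      then show "x \<in> (\<lambda>k. l ! (k + 1)) ` {..2 * u}" by (intro image_eqI[of _ _ "i - 1"]) auto
    qed
  qed
  have "(- 1) ^ k * skew_matrix (l ! 0) (l ! (k + 1)) *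
        pfaffian u (\<lambda>i j. skew_matrix (l ! skip2 k i) (l ! skip2 k j)) =
      chord_sign S m (l ! (k + 1)) * xvar m (l ! (k + 1)) * (pf (S - {m, l ! (k + 1)}) :: 'k skew_poly)"
    if k: "k \<in> {..2 * u}" for k
  proof -
    let ?j = "l ! (k + 1)"
    have mj: "m < ?j" unfolding m using mono[of 0 "k + 1"] k l(3) by auto
    \<comment> \<open>The entries at 1, ..., k are those under the chord from m to the entry at k +
      1, so \<open>chord_sign\<close> equals (- 1) ^ k.\<close>
    have "S \<inter> between m ?j = (!) l ` {1..<k + 1}"
    proof (intro equalityI subsetI)
      fix x assume "x \<in> S \<inter> between m ?j"
      then obtain i where "i < 2 * u + 2" "x = l ! i" "l ! 0 < l ! i" "l ! i < l ! (k + 1)"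
        unfolding Sl m between_def using mj m by auto
      then show "x \<in> (!) l ` {1..<k + 1}" using mono[of 0 i] mono[of i "k + 1"] k l(3) by auto
    next
      fix x assume "x \<in> (!) l ` {1..<k + 1}"
      then obtain i where "1 \<le> i" "i < k + 1" "x = l ! i" by auto
      then show "x \<in> S \<inter> between m ?j"
        unfolding Sl between_def using mj mono[of 0 i] mono[of i "k + 1"] k l(3) m by auto
    qed
    moreover have "inj_on ((!) l) {1..<k + 1}" by (rule inj_onI) (use inj k l(3) in auto)
    ultimately have card: "card (S \<inter> between m ?j) = k" by (simp add: card_image)
    have list: "sorted_list_of_set (S - {m, ?j}) = map (\<lambda>i. l ! skip2 k i) [0..<2 * u]"
    proof (rule strict_sorted_equal)
      show "sorted_wrt (<) (map (\<lambda>i. l ! skip2 k i) [0..<2 * u])"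
        by (subst sorted_wrt_map, rule sorted_wrt_mono_rel[of _ "(<)"])
           (use k l(3) in \<open>auto simp: mono skip2_def\<close>)
      have "S - {m, ?j} = (\<lambda>i. l ! skip2 k i) ` {..<2 * u}"
      proof (intro equalityI subsetI)
        fix x assume "x \<in> S - {m, ?j}"
        then obtain i where "i < 2 * u + 2" "x = l ! i" "i \<noteq> 0" "i \<noteq> k + 1" unfolding Sl m by auto
        moreover from this have "skip2 k (if i \<le> k then i - 1 else i - 2) = i" by (auto simp: skip2_def)
        ultimately show "x \<in> (\<lambda>i. l ! skip2 k i) ` {..<2 * u}" using k
          by (intro image_eqI[of _ _ "if i \<le> k then i - 1 else i - 2"]) auto
      next
        fix x assume "x \<in> (\<lambda>i. l ! skip2 k i) ` {..<2 * u}"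
        then obtain i where i: "i < 2 * u" "x = l ! skip2 k i" by auto
        have "skip2 k i < 2 * u + 2" "skip2 k i \<noteq> 0" "skip2 k i \<noteq> k + 1" using i by (auto simp: skip2_def)
        then show "x \<in> S - {m, ?j}" using i inj[of "skip2 k i" 0] inj[of "skip2 k i" "k + 1"] k l(3)
          unfolding m by (auto simp: Sl)
      qed
      then show "set (sorted_list_of_set (S - {m, ?j})) = set (map (\<lambda>i. l ! skip2 k i) [0..<2 * u])"
        using S(1) by (simp add: atLeast0LessThan)
    qed auto
    have "?j \<in> S" "m \<in> S" using k unfolding Sl m by auto
    then have card': "card (S - {m, ?j}) = 2 * u" using u mj S(1) by (simp add: card_Diff_subset)
    have "pf (S - {m, ?j}) = (pfaffian u (\<lambda>i j. skew_matrix (l ! skip2 k i) (l ! skip2 k j)) :: 'k skew_poly)"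
      unfolding pf_def card' sub_pfaffian_def list
      by simp (rule pfaffian_cong, simp)
    then show ?thesis using mj unfolding chord_sign_def card
      by (simp add: skew_matrix_def xvar_def m)
  qed
  then have "pf S = (\<Sum>k\<in>{..2 * u}. chord_sign S m (l ! (k + 1)) * xvar m (l ! (k + 1)) *
      (pf (S - {m, l ! (k + 1)}) :: 'k skew_poly))"
    unfolding pf_def[of S] sub_pfaffian_def u l_def[symmetric]
    by (simp add: pfaffian_Suc)
  then show ?thesis using sum.reindex_bij_betw[OF bij, of "\<lambda>j. chord_sign S m j * xvar m j * pf (S - {m, j})"]
    by simp
qed

lemma finite_between [simp]: "finite (between i j)"
  by (simp add: between_def)

lemma chord_sign_remove:
  assumes "a \<in> S"
  shows "chord_sign (S - {a}) i j = chord_sign S i j * (if a \<in> between i j then - 1 else 1)"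
proof (cases "a \<in> between i j")
  case True
  then have *: "S \<inter> between i j = insert a ((S - {a}) \<inter> between i j)" using assms by auto
  have "card (S \<inter> between i j) = Suc (card ((S - {a}) \<inter> between i j))"
    unfolding * by (subst card_insert_disjoint) auto
  then show ?thesis using True by (simp add: chord_sign_def)
next
  case False
  then have "(S - {a}) \<inter> between i j = S \<inter> between i j" by auto
  then show ?thesis using False by (simp add: chord_sign_def)
qed

lemma chord_sign_remove2:
  assumes "a \<in> S" "b \<in> S" "a \<noteq> b"
  shows "chord_sign (S - {a, b}) i j = (chord_sign S i j *
    ((if a \<in> between i j then - 1 else 1) * (if b \<in> between i j then - 1 else 1)) :: 'k::field skew_poly)"
proof -
  have "chord_sign (S - {a} - {b}) i j =
      (chord_sign (S - {a}) i j * (if b \<in> between i j then - 1 else 1) :: 'k skew_poly)"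
    by (rule chord_sign_remove) (use assms in auto)
  then show ?thesis unfolding Diff_insert2[of S a "{b}"] chord_sign_remove[OF assms(1)] mult.assoc .
qed

text \<open>Deleting the ends of one chord flips the sign of the other exactly when the chords
  cross, and crossing is symmetric.\<close>

lemma chord_sign_crossing:
  assumes "a \<in> S" "b \<in> S" "c \<in> S" "d \<in> S" "distinct [a, b, c, d]"
  shows "chord_sign S a b * chord_sign (S - {a, b}) c d =
         (chord_sign S c d * chord_sign (S - {c, d}) a b :: 'k::field skew_poly)"
proof -
  have ne: "a \<noteq> b" "c \<noteq> d" using assms(5) by auto
  have 3: "(if a \<in> between c d then - 1 else 1) * (if b \<in> between c d then - 1 else 1) =
      ((if c \<in> between a b then - 1 else 1) * (if d \<in> between a b then - 1 else 1) :: 'k skew_poly)"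
    using assms(5) by (auto simp: between_def min_def max_def split: if_splits)
  show ?thesis unfolding chord_sign_remove2[OF assms(1,2) ne(1)] chord_sign_remove2[OF assms(3,4) ne(2)] 3
    by (simp only: mult.left_commute)
qed

lemma sum_ordered_pairs:
  assumes "finite A"
  shows "(\<Sum>i\<in>A. \<Sum>j\<in>A - {i}. h i j) = (\<Sum>j\<in>A. \<Sum>i\<in>A - {j}. h i j)"
proof -
  have "(\<Sum>i\<in>A. \<Sum>j\<in>A - {i}. h i j) = (\<Sum>i\<in>A. \<Sum>j\<in>{j\<in>A. i \<noteq> j}. h i j)"
    by (intro sum.cong) auto
  also have "\<dots> = (\<Sum>j\<in>A. \<Sum>i\<in>{i\<in>A. i \<noteq> j}. h i j)"
    using assms by (intro sum.swap_restrict) auto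
  also have "\<dots> = (\<Sum>j\<in>A. \<Sum>i\<in>A - {j}. h i j)"
    by (intro sum.cong) auto
  finally show ?thesis .
qed

lemma mult_exchange:
  fixes a :: "'a::comm_semiring_0"
  assumes "a * b = c * d"
  shows "a * x * (b * y * z) = c * y * (d * x * z)"
proof -
  have "a * x * (b * y * z) = (a * b) * (x * y * z)" by (simp only: ac_simps)
  also have "\<dots> = c * y * (d * x * z)" unfolding assms by (simp only: ac_simps)
  finally show ?thesis .
qed

text \<open>For i other than m = Min S: expand along m, expand by induction along i the minors that
  still contain i, exchange the sums, and recognize by induction expansions along m.
  \<open>chord_sign_crossing\<close> matches the signs.\<close>

lemma pf_expand:
  assumes "finite S" "even (card S)" "i \<in> S"
  shows "pf S = (\<Sum>j\<in>S - {i}. chord_sign S i j * xvar i j * pf (S - {i, j}) :: 'k::field skew_poly)"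
  using assms
proof (induction "card S" arbitrary: S i rule: less_induct)
  case less
  define m where "m = Min S"
  have mS: "m \<in> S" unfolding m_def by (rule Min_in) (use less.prems in auto)
  have exp_m: "pf S = (\<Sum>j\<in>S - {m}. chord_sign S m j * xvar m j * pf (S - {m, j}) :: 'k skew_poly)"
    unfolding m_def by (rule pf_expand_Min) (use less.prems in auto)
  show ?case
  proof (cases "i = m")
    case False
    let ?A = "S - {i, m}"
    have card: "card (S - {a, b}) = card S - 2" "2 \<le> card S" if "a \<in> S" "b \<in> S" "a \<noteq> b" for a b
      using that less.prems(1) card_mono[of S "{a, b}"] by (auto simp: card_Diff_subset)
    have IH: "pf (S - {a, b}) = (\<Sum>j\<in>S - {a, b} - {c}. chord_sign (S - {a, b}) c j * xvar c j * pf (S - {a, b} - {c, j}) :: 'k skew_poly)"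
      if "a \<in> S" "b \<in> S" "a \<noteq> b" "c \<in> S" "c \<noteq> a" "c \<noteq> b" for a b c
      using card[OF that(1-3)] less.prems that by (intro less.hyps) auto
    \<comment> \<open>The term l = i is set aside because its minor no longer contains i; it becomes
      the term j = m of the new expansion.\<close>
    have "pf S = chord_sign S m i * xvar m i * pf (S - {m, i}) +
        (\<Sum>l\<in>?A. chord_sign S m l * xvar m l * (pf (S - {m, l}) :: 'k skew_poly))"
    proof -
      have A: "S - {m} - {i} = ?A" by auto
      have "finite (S - {m})" "i \<in> S - {m}" using less.prems False by auto
      then show ?thesis unfolding exp_m A[symmetric] by (rule sum.remove)
    qed
    also have "(\<Sum>l\<in>?A. chord_sign S m l * xvar m l * (pf (S - {m, l}) :: 'k skew_poly)) =
        (\<Sum>l\<in>?A. \<Sum>j\<in>?A - {l}. chord_sign S m l * xvar m l *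
          (chord_sign (S - {m, l}) i j * xvar i j * pf (S - {m, l} - {i, j})))"
    proof (intro sum.cong refl)
      fix l assume l: "l \<in> ?A"
      have *: "S - {m, l} - {i} = ?A - {l}" by auto
      show "chord_sign S m l * xvar m l * (pf (S - {m, l}) :: 'k skew_poly) =
        (\<Sum>j\<in>?A - {l}. chord_sign S m l * xvar m l *
          (chord_sign (S - {m, l}) i j * xvar i j * pf (S - {m, l} - {i, j})))"
        unfolding sum_distrib_left[symmetric] *[symmetric]
        by (subst IH[of m l i]) (use l mS less.prems False in auto)
    qed
    also have "\<dots> = (\<Sum>j\<in>?A. \<Sum>l\<in>?A - {j}. chord_sign S m l * xvar m l *
          (chord_sign (S - {m, l}) i j * xvar i j * pf (S - {m, l} - {i, j})))"
      by (rule sum_ordered_pairs) (use less.prems in auto)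
    also have "\<dots> = (\<Sum>j\<in>?A. chord_sign S i j * xvar i j * pf (S - {i, j}))"
    proof (intro sum.cong refl)
      fix j assume j: "j \<in> ?A"
      have *: "S - {i, j} - {m} = ?A - {j}" by auto
      show "(\<Sum>l\<in>?A - {j}. chord_sign S m l * xvar m l *
          (chord_sign (S - {m, l}) i j * xvar i j * pf (S - {m, l} - {i, j}))) =
          chord_sign S i j * xvar i j * (pf (S - {i, j}) :: 'k skew_poly)"
      proof (subst IH[of i j m])
        show "(\<Sum>l\<in>?A - {j}. chord_sign S m l * xvar m l *
          (chord_sign (S - {m, l}) i j * xvar i j * pf (S - {m, l} - {i, j}))) =
          chord_sign S i j * xvar i j * (\<Sum>l\<in>S - {i, j} - {m}.
            chord_sign (S - {i, j}) m l * xvar m l * (pf (S - {i, j} - {m, l}) :: 'k skew_poly))"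
          unfolding sum_distrib_left *
        proof (intro sum.cong refl)
          fix l assume l: "l \<in> ?A - {j}"
          have sets: "S - {m, l} - {i, j} = S - {i, j} - {m, l}" by auto
          have "chord_sign S m l * chord_sign (S - {m, l}) i j =
              (chord_sign S i j * chord_sign (S - {i, j}) m l :: 'k skew_poly)"
            by (rule chord_sign_crossing) (use l j mS less.prems False in auto)
          then show "chord_sign S m l * xvar m l *
              (chord_sign (S - {m, l}) i j * xvar i j * pf (S - {m, l} - {i, j})) =
              chord_sign S i j * xvar i j *
              (chord_sign (S - {i, j}) m l * xvar m l * (pf (S - {i, j} - {m, l}) :: 'k skew_poly))"
            unfolding sets by (rule mult_exchange)
        qed
      qed (use j mS less.prems False in auto)
    qed
    also have "chord_sign S m i * xvar m i * pf (S - {m, i}) +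
        (\<Sum>j\<in>?A. chord_sign S i j * xvar i j * pf (S - {i, j})) =
        (\<Sum>j\<in>S - {i}. chord_sign S i j * xvar i j * (pf (S - {i, j}) :: 'k skew_poly))"
    proof -
      have A: "S - {i} - {m} = ?A" "S - {m, i} = ?A" by auto
      have "finite (S - {i})" "m \<in> S - {i}" using less.prems mS False by auto
      then show ?thesis unfolding chord_sign_commute[of S m i] xvar_commute[of m i] A(2)
        using sum.remove[of "S - {i}" m "\<lambda>j. chord_sign S i j * xvar i j * (pf (S - {i, j}) :: 'k skew_poly)"]
        unfolding A(1) by (simp only:)
    qed
    finally show ?thesis .
  qed (use exp_m in simp)
qed

section \<open>A Pluecker relation\<close>

definition pos_sign :: "nat set \<Rightarrow> nat \<Rightarrow> 'k::field skew_poly" where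
  "pos_sign S i = (- 1) ^ card (S \<inter> {..<i})"

definition less_sign :: "nat \<Rightarrow> nat \<Rightarrow> 'k::field skew_poly" where
  "less_sign i j = (if i < j then 1 else - 1)"

lemma pos_sign_square [simp]: "pos_sign S i * pos_sign S i = 1"
  by (simp add: pos_sign_def flip: power_add mult_2)

lemma pos_sign_square_left [simp]: "pos_sign S i * (pos_sign S i * x) = x"
  by (simp flip: mult.assoc)

text \<open>The points below b are those below a, the point a, and those in between; the point a
  accounts for the minus sign. The factored form separates a from b, as the double sums below
  require.\<close>

lemma chord_sign_eq_pos_sign:
  assumes "finite S" "a \<in> S" "b \<in> S" "a \<noteq> b"
  shows "chord_sign S a b = (- (pos_sign S a * pos_sign S b) :: 'k::field skew_poly)"
proof -
  have *: "chord_sign S a b = (- (pos_sign S a * pos_sign S b) :: 'k skew_poly)"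
    if "a \<in> S" "b \<in> S" "a < b" for a b
  proof -
    have "S \<inter> {..<b} = (S \<inter> {..<a}) \<union> insert a (S \<inter> between a b)"
      using that by (auto simp: between_def)
    moreover have "card ((S \<inter> {..<a}) \<union> insert a (S \<inter> between a b)) =
        card (S \<inter> {..<a}) + Suc (card (S \<inter> between a b))"
      using that assms(1) by (subst card_Un_disjoint) (auto simp: between_def)
    ultimately have "card (S \<inter> {..<b}) = card (S \<inter> {..<a}) + Suc (card (S \<inter> between a b))" by simp
    then have "(pos_sign S b :: 'k skew_poly) = - (pos_sign S a * chord_sign S a b)"
      unfolding pos_sign_def chord_sign_def by (simp add: power_add)
    then have "pos_sign S a * pos_sign S b = - (pos_sign S a * pos_sign S a * (chord_sign S a b :: 'k skew_poly))"
      by (simp add: mult.assoc)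
    then show ?thesis by simp
  qed
  show ?thesis
  proof (cases "a < b")
    case False
    then have "b < a" using assms by simp
    from *[OF assms(3,2) this] show ?thesis by (simp add: chord_sign_commute mult.commute)
  qed (use *[OF assms(2,3)] in simp)
qed

lemma pos_sign_insert:
  assumes "finite T" "j \<notin> T" "l \<in> T"
  shows "pos_sign (insert j T) l = (pos_sign T l * less_sign l j :: 'k::field skew_poly)"
proof (cases "j < l")
  case True
  then have "insert j T \<inter> {..<l} = insert j (T \<inter> {..<l})" by auto
  then show ?thesis using True assms by (simp add: pos_sign_def less_sign_def)
next
  case False
  then have "insert j T \<inter> {..<l} = T \<inter> {..<l}" using assms by auto
  moreover have "l < j" using False assms by (metis linorder_neqE_nat)
  ultimately show ?thesis by (simp add: pos_sign_def less_sign_def)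
qed

lemma skew_matrix_xvar: "i \<noteq> j \<Longrightarrow> skew_matrix i j = less_sign i j * xvar i j"
  by (auto simp: skew_matrix_def less_sign_def xvar_def)

lemma skew_matrix_skew: "skew_matrix i j = - skew_matrix j i"
  by (auto simp: skew_matrix_def)

text \<open>For odd T the signed pfaffians \<open>pf (T - {l})\<close> act as cofactors: this vector
  lies in the kernel of the submatrix of T, and its pairing with a row j outside T is
  \<open>pf (insert j T)\<close> up to sign.\<close>

definition row_pairing :: "nat set \<Rightarrow> nat \<Rightarrow> 'k::field skew_poly" where
  "row_pairing T j = (\<Sum>l\<in>T. pos_sign T l * skew_matrix l j * pf (T - {l}))"

lemma row_pairing_outside:
  assumes "finite T" "odd (card T)" "j \<notin> T"
  shows "row_pairing T j = (- pos_sign T j * pf (insert j T) :: 'k::field skew_poly)"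
proof -
  have "(pf (insert j T) :: 'k skew_poly) = (\<Sum>l\<in>insert j T - {j}. chord_sign (insert j T) j l * xvar j l * pf (insert j T - {j, l}))"
    by (rule pf_expand) (use assms in auto)
  also have "\<dots> = (\<Sum>l\<in>T. - pos_sign T j * (pos_sign T l * skew_matrix l j * pf (T - {l})))"
  proof (rule sum.cong)
    fix l assume l: "l \<in> T"
    have "insert j T - {j, l} = T - {l}" using assms l by auto
    moreover have "l \<noteq> j" using l assms by auto
    moreover have "(pos_sign (insert j T) j :: 'k skew_poly) = pos_sign T j"
      unfolding pos_sign_def by (rule arg_cong[where f = "\<lambda>A. (- 1) ^ card A"]) auto
    ultimately show "chord_sign (insert j T) j l * xvar j l * pf (insert j T - {j, l}) =
       - pos_sign T j * (pos_sign T l * skew_matrix l j * (pf (T - {l}) :: 'k skew_poly))"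
      using l assms by (simp add: chord_sign_eq_pos_sign pos_sign_insert skew_matrix_xvar xvar_commute[of j l] algebra_simps)
  qed (use assms in auto)
  also have "\<dots> = - pos_sign T j * row_pairing T j"
    unfolding row_pairing_def sum_distrib_left ..
  finally have "- pos_sign T j * pf (insert j T) = pos_sign T j * pos_sign T j * (row_pairing T j :: 'k skew_poly)"
    by (simp add: mult.assoc)
  then show ?thesis by simp
qed

lemma sum_antisymmetric_pairs:
  fixes h :: "nat \<Rightarrow> nat \<Rightarrow> 'a::ab_group_add"
  assumes "finite A" "\<And>i j. i \<in> A \<Longrightarrow> j \<in> A \<Longrightarrow> i < j \<Longrightarrow> h i j = - h j i"
  shows "(\<Sum>i\<in>A. \<Sum>j\<in>A - {i}. h i j) = 0"
proof -
  have "(\<Sum>i\<in>A. \<Sum>j\<in>A - {i}. h i j) = (\<Sum>i\<in>A. (\<Sum>j\<in>{j\<in>A. i < j}. h i j) + (\<Sum>j\<in>{j\<in>A. j < i}. h i j))"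
    using assms(1) by (intro sum.cong refl, subst sum.union_disjoint[symmetric]) (auto intro!: sum.cong)
  also have "\<dots> = (\<Sum>i\<in>A. \<Sum>j\<in>{j\<in>A. i < j}. h i j) + (\<Sum>j\<in>A. \<Sum>i\<in>{i\<in>A. j < i}. h i j)"
    using sum.swap_restrict[OF assms(1) assms(1), of h "\<lambda>i j. j < i"] by (simp add: sum.distrib)
  also have "(\<Sum>j\<in>A. \<Sum>i\<in>{i\<in>A. j < i}. h i j) = (\<Sum>j\<in>A. \<Sum>i\<in>{i\<in>A. j < i}. - h j i)"
    using assms(2) by (intro sum.cong refl) (metis (mono_tags, lifting) mem_Collect_eq minus_equation_iff)
  finally show ?thesis by (simp add: sum_negf)
qed

text \<open>A repeated row: expanding each \<open>pf (T - {l})\<close> along j gives a double sum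
  that is antisymmetric in l and r. The terms cancel in pairs, without division by 2, so
  characteristic 2 is covered.\<close>

lemma row_pairing_inside:
  assumes "finite T" "odd (card T)" "j \<in> T"
  shows "row_pairing T j = (0 :: 'k::field skew_poly)"
proof -
  let ?A = "T - {j}"
  define h :: "nat \<Rightarrow> nat \<Rightarrow> 'k skew_poly" where
    "h l r = pos_sign T l * skew_matrix l j * (chord_sign (T - {l}) j r * xvar j r * pf (T - {l} - {j, r}))" for l r
  have "row_pairing T j = (\<Sum>l\<in>?A. pos_sign T l * skew_matrix l j * (pf (T - {l}) :: 'k skew_poly))"
  proof -
    have "(skew_matrix j j :: 'k skew_poly) = 0" by (simp add: skew_matrix_def)
    then show ?thesis unfolding row_pairing_def sum.remove[OF assms(1,3)] by simp
  qed
  also have "\<dots> = (\<Sum>l\<in>?A. \<Sum>r\<in>?A - {l}. h l r)"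
  proof (intro sum.cong refl)
    fix l assume l: "l \<in> ?A"
    have "?A - {l} = T - {l} - {j}" by auto
    moreover have "(pf (T - {l}) :: 'k skew_poly) = (\<Sum>r\<in>T - {l} - {j}. chord_sign (T - {l}) j r * xvar j r * pf (T - {l} - {j, r}))"
      by (rule pf_expand) (use l assms in auto)
    ultimately show "pos_sign T l * skew_matrix l j * (pf (T - {l}) :: 'k skew_poly) = (\<Sum>r\<in>?A - {l}. h l r)"
      unfolding h_def by (simp add: sum_distrib_left)
  qed
  also have "\<dots> = 0"
  proof (rule sum_antisymmetric_pairs)
    fix l r assume lr: "l \<in> ?A" "r \<in> ?A" "l < r"
    have sets: "T - {l} - {j, r} = T - {r} - {j, l}" by auto
    have s: "less_sign l j * (if l \<in> between j r then - 1 else 1) =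
        - (less_sign r j * (if r \<in> between j l then - 1 else 1) :: 'k skew_poly)"
      using lr by (auto simp: less_sign_def between_def)
    have c: "chord_sign (T - {l}) j r = (- (pos_sign T j * pos_sign T r) * (if l \<in> between j r then - 1 else 1) :: 'k skew_poly)"
      "chord_sign (T - {r}) j l = (- (pos_sign T j * pos_sign T l) * (if r \<in> between j l then - 1 else 1) :: 'k skew_poly)"
      using lr assms by (simp_all only: chord_sign_remove Diff_iff) (subst chord_sign_eq_pos_sign; auto)+
    have "h l r = - (pos_sign T l * pos_sign T j * pos_sign T r * xvar l j * xvar r j * pf (T - {r} - {j, l})) *
        (less_sign l j * (if l \<in> between j r then - 1 else 1))"
      using lr unfolding h_def sets c by (simp add: skew_matrix_xvar xvar_commute[of j r] algebra_simps)
    moreover have "h r l = - (pos_sign T l * pos_sign T j * pos_sign T r * xvar l j * xvar r j * pf (T - {r} - {j, l})) *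
        (less_sign r j * (if r \<in> between j l then - 1 else 1))"
      using lr unfolding h_def c by (simp add: skew_matrix_xvar xvar_commute[of j l] algebra_simps)
    ultimately show "h l r = - h r l" unfolding s by simp
  qed (use assms in auto)
  finally show ?thesis .
qed

text \<open>The bilinear sum of the matrix against the cofactor vectors of W and T is evaluated
  twice. Summing over W first gives 0 since T \<subseteq> W; summing over T first leaves the terms
  with j outside T.\<close>

lemma pf_pluecker:
  assumes W: "finite W" "odd (card W)" and T: "T \<subseteq> W" "odd (card T)"
  shows "(\<Sum>j\<in>W - T. pos_sign W j * pos_sign T j * pf (W - {j}) * pf (insert j T)) = (0 :: 'k::field skew_poly)"
proof -
  have fT: "finite T" using T W finite_subset by blast
  have "(\<Sum>j\<in>W. pos_sign W j * pf (W - {j}) * row_pairing T j) =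
      (\<Sum>l\<in>T. pos_sign T l * pf (T - {l}) * (- row_pairing W l) :: 'k skew_poly)"
    unfolding row_pairing_def sum_distrib_left sum_negf[symmetric]
    by (subst sum.swap, intro sum.cong refl, subst skew_matrix_skew) (simp add: algebra_simps)
  also have "\<dots> = 0"
    using T(1) by (intro sum.neutral) (simp add: row_pairing_inside[OF W] subset_iff)
  finally have "(\<Sum>j\<in>W. pos_sign W j * pf (W - {j}) * row_pairing T j) = (0 :: 'k skew_poly)" .
  moreover have "(\<Sum>j\<in>W. pos_sign W j * pf (W - {j}) * row_pairing T j) =
      (\<Sum>j\<in>W - T. pos_sign W j * pf (W - {j}) * (row_pairing T j :: 'k skew_poly))"
    by (rule sum.mono_neutral_right) (use T W in \<open>auto simp: row_pairing_inside[OF fT T(2)]\<close>)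
  moreover have "(\<Sum>j\<in>W - T. pos_sign W j * pf (W - {j}) * (row_pairing T j :: 'k skew_poly)) =
      - (\<Sum>j\<in>W - T. pos_sign W j * pos_sign T j * pf (W - {j}) * pf (insert j T))"
    unfolding sum_negf[symmetric]
    by (intro sum.cong refl) (simp add: row_pairing_outside[OF fT T(2)] algebra_simps)
  ultimately show ?thesis by simp
qed

section \<open>Leading monomials of pfaffians\<close>

lemma size_mon_mset: "size (mon_mset m) = total_degree m"
  by (simp add: mon_mset_def total_degree_def)

lemma total_degree_plus: "total_degree (m + m') = total_degree m + total_degree m'"
  by (simp flip: size_mon_mset add: mon_mset_plus)

lemma total_degree_zero [simp]: "total_degree 0 = 0"
  by (simp add: total_degree_def)

lemma total_degree_single [simp]: "total_degree (msingle v c) = c"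
  by (simp add: total_degree_def)

lemma keys_plus_nat: "mkeys (m + m') = mkeys m \<union> mkeys (m' :: 'a \<Rightarrow>\<^sub>0 nat)"
  by (auto simp: in_keys_iff lookup_add)

lemma mon_mset_lessI:
  assumes "v0 \<in> mkeys k0" "\<And>v. v \<in> mkeys k \<Longrightarrow> var_rank v < var_rank v0"
  shows "mon_mset k < mon_mset k0"
  unfolding less_multiset\<^sub>H\<^sub>O
proof (intro conjI allI impI)
  have c0: "count (mon_mset k0) (var_rank v0) > 0" using assms(1) by (simp add: count_mon_mset in_keys_iff)
  have c: "count (mon_mset k) (var_rank v0) = 0"
    using assms(2)[of v0] by (auto simp: count_mon_mset in_keys_iff)
  show "mon_mset k \<noteq> mon_mset k0" using c c0 by (metis less_irrefl)
  fix y assume y: "count (mon_mset k0) y < count (mon_mset k) y"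
  then have "y \<in> range var_rank" using count_mon_mset_outside[of y k] by fastforce
  then obtain v where v: "y = var_rank v" by blast
  then have "v \<in> mkeys k" using y by (simp add: count_mon_mset in_keys_iff)
  then have "y < var_rank v0" using assms(2) v by blast
  then show "\<exists>x>y. count (mon_mset k) x < count (mon_mset k0) x" using c c0 by (intro exI[of _ "var_rank v0"]) simp
qed

lemma lm_single: "c \<noteq> 0 \<Longrightarrow> lm (msingle m c) = m"
  by (rule lm_eqI) auto

lemma lm_one [simp]: "lm 1 = 0"
  using lm_single[of 1 0] by simp

lemma lm_add_smaller:
  assumes "p \<noteq> 0" "\<And>k. k \<in> mkeys r \<Longrightarrow> mon_mset k < mon_mset (lm p)"
  shows "p + r \<noteq> 0 \<and> lm (p + r) = lm p"
proof -
  have "lm p \<notin> mkeys r" using assms(2) by auto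
  then have k: "lm p \<in> mkeys (p + r)"
    using lookup_lm[OF assms(1)] by (simp add: in_keys_iff lookup_add)
  have "lm (p + r) = lm p"
  proof (rule lm_eqI[OF k])
    fix m assume "m \<in> mkeys (p + r)"
    then have "m \<in> mkeys p \<or> m \<in> mkeys r" using keys_add[of p r] by (meson UnE subsetD)
    then show "mon_mset m \<le> mon_mset (lm p)"
      using assms(2) lm_max[OF assms(1)] by (meson less_imp_le)
  qed
  moreover have "p + r \<noteq> 0" using k by (metis empty_iff keys_zero)
  ultimately show ?thesis by simp
qed

lemma minus_one_power_cases: "(- 1) ^ n = (1 :: 'a::ring_1) \<or> (- 1) ^ n = (- 1 :: 'a)"
  by (cases "even n") auto

lemma keys_uminus [simp]: "mkeys (- p) = mkeys (p :: 'a \<Rightarrow>\<^sub>0 'b::ab_group_add)"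
  by (auto simp: in_keys_iff)

lemma keys_chord_sign_times: "mkeys (chord_sign S i j * p) = mkeys p"
  using minus_one_power_cases[of "card (S \<inter> between i j)", where ?'a = "'a skew_poly"]
  unfolding chord_sign_def by (elim disjE) simp_all

lemma keys_xvar_times:
  assumes "k \<in> mkeys (xvar i j * p)"
  obtains k' where "k' \<in> mkeys p" "k = msingle (min i j, max i j) 1 + k'"
  using keys_times_subset[OF assms] unfolding xvar_def skew_var_def by auto

lemma keys_pf:
  assumes "finite S" "even (card S)" "k \<in> mkeys (pf S :: 'k::field skew_poly)"
  shows "total_degree k = card S div 2 \<and> mkeys k \<subseteq> {(a, b). a \<in> S \<and> b \<in> S \<and> a < b}"
  using assms
proof (induction "card S" arbitrary: S k rule: less_induct)
  case less
  show ?case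
  proof (cases "S = {}")
    case True
    then show ?thesis using less.prems by (auto simp: total_degree_def)
  next
    case False
    define m where "m = Min S"
    have mS: "m \<in> S" unfolding m_def by (rule Min_in) (use less.prems False in auto)
    from less.prems(3) have "k \<in> mkeys (\<Sum>j\<in>S - {m}. chord_sign S m j * xvar m j * pf (S - {m, j}) :: 'k skew_poly)"
      by (subst (asm) pf_expand[OF less.prems(1,2) mS])
    then obtain j where j: "j \<in> S" "j \<noteq> m" and "k \<in> mkeys (chord_sign S m j * xvar m j * pf (S - {m, j}) :: 'k skew_poly)"
      using keys_sum by fast
    then have "k \<in> mkeys (xvar m j * pf (S - {m, j}) :: 'k skew_poly)"
      by (simp add: mult.assoc keys_chord_sign_times)
    then obtain k' where k': "k' \<in> mkeys (pf (S - {m, j}) :: 'k skew_poly)" "k = msingle (min m j, max m j) 1 + k'"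
      by (rule keys_xvar_times)
    have card: "card (S - {m, j}) = card S - 2" "2 \<le> card S"
      using j mS less.prems(1) card_mono[of S "{m, j}"] by (auto simp: card_Diff_subset)
    have "total_degree k' = card (S - {m, j}) div 2 \<and> mkeys k' \<subseteq> {(a, b). a \<in> S - {m, j} \<and> b \<in> S - {m, j} \<and> a < b}"
      by (rule less.hyps) (use card less.prems k' in auto)
    then show ?thesis using k'(2) card j mS
      by (auto simp: total_degree_plus keys_plus_nat min_def max_def)
  qed
qed

text \<open>The nested matching pairs the smallest with the largest index and continues inwards;
  this is the antidiagonal of the submatrix of S. The value 0 is the monomial 1.\<close>

function anti_mon :: "nat set \<Rightarrow> skew_mon" where
  "anti_mon S = (if finite S \<and> 2 \<le> card S
     then msingle (Min S, Max S) 1 + anti_mon (S - {Min S, Max S}) else 0)"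
  by auto
termination
proof (relation "measure card", simp_all, clarify)
  fix S :: "nat set" assume "finite S" "2 \<le> card S"
  then have "Min S \<in> S" by (intro Min_in) auto
  then show "card (S - {Min S, Max S}) < card S" using \<open>finite S\<close> by (intro psubset_card_mono) auto
qed

declare anti_mon.simps [simp del]

lemma anti_mon_empty [simp]: "anti_mon {} = 0"
  by (subst anti_mon.simps) simp

lemma anti_mon_eq:
  assumes "finite S" "a \<in> S" "b \<in> S" "a < b" "\<And>x. x \<in> S \<Longrightarrow> a \<le> x \<and> x \<le> b"
  shows "anti_mon S = msingle (a, b) 1 + anti_mon (S - {a, b})"
proof -
  have "Min S = a" "Max S = b" using assms by (auto intro: Min_eqI Max_eqI)
  moreover have "card {a, b} \<le> card S" by (rule card_mono) (use assms in auto)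
  ultimately show ?thesis using assms by (subst anti_mon.simps) auto
qed

lemma Min_less_Max:
  assumes "finite S" "2 \<le> card (S :: nat set)" shows "Min S < Max S"
proof (rule ccontr)
  assume "\<not> Min S < Max S"
  have "S \<subseteq> {Min S}"
  proof
    fix x assume "x \<in> S"
    then have "Min S \<le> x" "x \<le> Max S" using assms by auto
    then show "x \<in> {Min S}" using \<open>\<not> Min S < Max S\<close> by auto
  qed
  then have "card S \<le> card {Min S}" by (intro card_mono) auto
  then show False using assms by simp
qed

lemma keys_anti_mon:
  "mkeys (anti_mon S) \<subseteq> {(a, b). a \<in> S \<and> b \<in> S \<and> a < b}"
proof (induction S rule: anti_mon.induct)
  case (1 S)
  show ?case
  proof (cases "finite S \<and> 2 \<le> card S")
    case True
    then have "finite S" "S \<noteq> {}" by auto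
    then have "Min S \<in> S" "Max S \<in> S" by (rule Min_in, rule Max_in)
    moreover have "Min S < Max S" using Min_less_Max True by simp
    moreover have "anti_mon S = msingle (Min S, Max S) 1 + anti_mon (S - {Min S, Max S})"
      using True by (subst anti_mon.simps) simp
    ultimately show ?thesis using 1[OF True] by (simp only: keys_plus_nat) auto
  qed (subst anti_mon.simps, auto)
qed

text \<open>Squarefreeness holds because the inner pairs avoid \<open>Min S\<close>.\<close>

lemma lookup_anti_mon_le: "mlookup (anti_mon S) v \<le> 1"
proof (induction S rule: anti_mon.induct)
  case (1 S)
  show ?case
  proof (cases "finite S \<and> 2 \<le> card S")
    case True
    have "(Min S, Max S) \<notin> mkeys (anti_mon (S - {Min S, Max S}))"
      using keys_anti_mon[of "S - {Min S, Max S}"] by auto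
    moreover have "anti_mon S = msingle (Min S, Max S) 1 + anti_mon (S - {Min S, Max S})"
      using True by (subst anti_mon.simps) simp
    ultimately show ?thesis using 1[OF True]
      by (simp only: lookup_add) (auto simp: lookup_single when_def in_keys_iff)
  qed (subst anti_mon.simps, auto)
qed

text \<open>Expand along M = Max S. Among the variables with indices in S, the one of (m, M) with m
  = Min S has the highest rank, and it occurs only in the term j = m, whose minor is handled by
  induction.\<close>

lemma lm_pf:
  assumes "finite S" "even (card S)"
  shows "(pf S :: 'k::field skew_poly) \<noteq> 0 \<and> lm (pf S :: 'k skew_poly) = anti_mon S"
  using assms
proof (induction "card S" arbitrary: S rule: less_induct)
  case less
  show ?case
  proof (cases "S = {}")
    case False
    then have c2: "2 \<le> card S" using less.prems by (metis card_0_eq dvd_imp_le gr0I)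
    define m where "m = Min S"
    define M where "M = Max S"
    have mM: "m \<in> S" "M \<in> S" "m < M" and bd: "\<And>x. x \<in> S \<Longrightarrow> m \<le> x \<and> x \<le> M"
      using less.prems False c2 Min_less_Max unfolding m_def M_def by auto
    let ?t = "\<lambda>j. chord_sign S M j * xvar M j * pf (S - {M, j}) :: 'k skew_poly"
    have "pf S = (\<Sum>j\<in>S - {M}. ?t j)" by (rule pf_expand[OF less.prems mM(2)])
    also have "\<dots> = ?t m + (\<Sum>j\<in>S - {M} - {m}. ?t j)"
      by (rule sum.remove) (use less.prems mM in auto)
    finally have eq: "pf S = ?t m + (\<Sum>j\<in>S - {M} - {m}. ?t j)" .
    have card: "card (S - {M, m}) = card S - 2"
      using mM less.prems(1) by (auto simp: card_Diff_subset)
    have IH: "(pf (S - {M, m}) :: 'k skew_poly) \<noteq> 0 \<and> lm (pf (S - {M, m}) :: 'k skew_poly) = anti_mon (S - {M, m})"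
      by (rule less.hyps) (use card c2 less.prems in auto)
    have xv: "(xvar M m :: 'k skew_poly) = msingle (msingle (m, M) 1) 1"
      using mM by (simp add: xvar_def skew_var_def)
    have xv0: "(xvar M m :: 'k skew_poly) \<noteq> 0" unfolding xv by (metis keys_single keys_zero one_neq_zero insert_not_empty)
    have "lm (xvar M m * pf (S - {M, m}) :: 'k skew_poly) = msingle (m, M) 1 + anti_mon (S - {M, m})"
      using IH xv0 by (simp add: lm_times) (simp add: xv lm_single)
    moreover have "(xvar M m * pf (S - {M, m}) :: 'k skew_poly) \<noteq> 0" using IH xv0 by (simp add: times_neq_zero)
    moreover have "anti_mon S = msingle (m, M) 1 + anti_mon (S - {M, m})"
      using anti_mon_eq[of S m M] less.prems mM bd by (simp add: insert_commute)
    ultimately have t: "?t m \<noteq> 0" "lm (?t m) = anti_mon S"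
      using minus_one_power_cases[of "card (S \<inter> between M m)", where ?'a = "'k skew_poly"]
      unfolding chord_sign_def mult.assoc by (elim disjE; simp)+
    have key: "(m, M) \<in> mkeys (anti_mon S)"
      unfolding \<open>anti_mon S = _\<close> by (simp add: keys_plus_nat)
    have "mon_mset k < mon_mset (lm (?t m))" if k: "k \<in> mkeys (\<Sum>j\<in>S - {M} - {m}. ?t j)" for k
    proof -
      obtain j where j: "j \<in> S" "j \<noteq> M" "j \<noteq> m" "k \<in> mkeys (?t j)" using keys_sum k by fast
      then have "k \<in> mkeys (xvar M j * pf (S - {M, j}) :: 'k skew_poly)"
        by (simp add: mult.assoc keys_chord_sign_times)
      then obtain k' where k': "k' \<in> mkeys (pf (S - {M, j}) :: 'k skew_poly)" "k = msingle (min M j, max M j) 1 + k'"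
        by (rule keys_xvar_times)
      have jM: "m < j" "j < M" using j bd[of j] by auto
      have cj: "card (S - {M, j}) = card S - 2" using mM j less.prems(1) by (auto simp: card_Diff_subset)
      have kk: "mkeys k' \<subseteq> {(a, b). a \<in> S - {M, j} \<and> b \<in> S - {M, j} \<and> a < b}"
        using keys_pf[OF _ _ k'(1)] less.prems cj by auto
      show ?thesis unfolding t(2)
      proof (rule mon_mset_lessI[OF key])
        fix v assume "v \<in> mkeys k"
        then have "v = (j, M) \<or> v \<in> mkeys k'" using k'(2) jM by (auto simp: keys_plus_nat)
        then obtain a b where v: "v = (a, b)" "a \<le> b" "b < M \<or> b = M \<and> m < a"
        proof
          assume "v = (j, M)" then show thesis using jM that by auto
        next
          assume "v \<in> mkeys k'"
          then obtain a b where "v = (a, b)" "b \<in> S - {M, j}" "a < b" using kk by auto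
          then show thesis using bd[of b] by (intro that[of a b]) auto
        qed
        then show "var_rank v < var_rank (m, M)" using mM by (auto intro!: var_rank_less)
      qed
    qed
    from lm_add_smaller[OF t(1) this] t(2) show ?thesis unfolding eq by simp
  qed simp
qed

section \<open>Windows\<close>

text \<open>A ladder block with corner (c - h, c + h) and entry h has its generators indexed by this
  set minus one point.\<close>

definition win :: "nat \<Rightarrow> nat \<Rightarrow> nat set" where
  "win c h = {c - h..c + h}"

text \<open>A window of even size with center d + 1/2. Removing the left or right end of
  \<open>win c h\<close> produces the one with d = c or d = c - 1.\<close>

definition pairwin :: "nat \<Rightarrow> nat \<Rightarrow> nat set" where
  "pairwin d u = {d + 1 - u..d + u}"

lemma finite_win [simp]: "finite (win c h)" "finite (pairwin d u)"
  by (simp_all add: win_def pairwin_def)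

lemma card_win: "h \<le> c \<Longrightarrow> card (win c h) = 2 * h + 1"
  by (simp add: win_def)

lemma card_win_remove: "h \<le> c \<Longrightarrow> i \<in> win c h \<Longrightarrow> card (win c h - {i}) = 2 * h"
  by (simp add: card_win)

lemma card_pairwin: "u \<le> d + 1 \<Longrightarrow> card (pairwin d u) = 2 * u"
  by (simp add: pairwin_def)

lemma win_minus_left: "h \<le> c \<Longrightarrow> win c h - {c - h} = pairwin c h"
  by (auto simp: win_def pairwin_def)

lemma win_minus_right: "h < c \<Longrightarrow> win c h - {c + h} = pairwin (c - 1) h"
  by (auto simp: win_def pairwin_def)

text \<open>As i is not an end, the outermost pair survives; shrinking the window thus divides all
  these leading monomials by one and the same variable.\<close>

lemma anti_mon_win:
  assumes "h < c" "1 \<le> h" "i \<in> win c (h - 1)"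
  shows "anti_mon (win c h - {i}) = msingle (c - h, c + h) 1 + anti_mon (win c (h - 1) - {i})"
proof -
  have "x \<in> win c h - {i} - {c - h, c + h} \<longleftrightarrow> x \<in> win c (h - 1) - {i}" for x
    using assms unfolding win_def Diff_iff atLeastAtMost_iff insert_iff by auto
  then have "win c h - {i} - {c - h, c + h} = win c (h - 1) - {i}" by blast
  moreover have "anti_mon (win c h - {i}) = msingle (c - h, c + h) 1 + anti_mon (win c h - {i} - {c - h, c + h})"
    by (rule anti_mon_eq) (use assms in \<open>auto simp: win_def\<close>)
  ultimately show ?thesis by simp
qed

lemma anti_mon_pairwin:
  assumes "u < d" 
  shows "anti_mon (pairwin d (Suc u)) = msingle (d - u, d + Suc u) 1 + anti_mon (pairwin d u)"
proof -
  have "pairwin d (Suc u) - {d - u, d + Suc u} = pairwin d u"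
    using assms by (auto simp: pairwin_def)
  moreover have "anti_mon (pairwin d (Suc u)) = msingle (d - u, d + Suc u) 1 + anti_mon (pairwin d (Suc u) - {d - u, d + Suc u})"
    by (rule anti_mon_eq) (use assms in \<open>auto simp: pairwin_def\<close>)
  ultimately show ?thesis by simp
qed

lemma keys_anti_mon_pairwin: "u \<le> d \<Longrightarrow> mkeys (anti_mon (pairwin d u)) \<subseteq> {(a, b). a + b = 2 * d + 1}"
proof (induction u)
  case 0
  then show ?case by (simp add: pairwin_def)
next
  case (Suc u)
  then have "d - u + (d + Suc u) = 2 * d + 1" by simp
  then show ?case using Suc by (auto simp: anti_mon_pairwin keys_plus_nat)
qed

lemma keys_anti_mon_win_center:
  "h < c \<Longrightarrow> mkeys (anti_mon (win c h - {c})) \<subseteq> {(a, b). a + b = 2 * c}"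
proof (induction h)
  case 0
  then show ?case by (simp add: win_def)
next
  case (Suc h)
  have "c - Suc h + (c + Suc h) = 2 * c" using Suc.prems by simp
  moreover have "anti_mon (win c (Suc h) - {c}) = msingle (c - Suc h, c + Suc h) 1 + anti_mon (win c h - {c})"
    using anti_mon_win[of "Suc h" c c] Suc.prems by (simp add: win_def)
  ultimately show ?case using Suc by (auto simp: keys_plus_nat)
qed

text \<open>Pairs farther from c than i are symmetric about c, of index sum 2c. Once i is an end of
  the remaining window, the rest is a \<open>pairwin\<close> with d = c or d = c - 1, of index sum
  2c + 1 or 2c - 1.\<close>

lemma keys_anti_mon_win:
  "h < c \<Longrightarrow> i \<in> win c h \<Longrightarrow> mkeys (anti_mon (win c h - {i})) \<subseteq> {(a, b). 2 * c - 1 \<le> a + b \<and> a + b \<le> 2 * c + 1}"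
proof (induction h)
  case 0
  then show ?case by (simp add: win_def)
next
  case (Suc h)
  consider "i = c - Suc h" | "i = c + Suc h" | "i \<in> win c h" using Suc.prems by (force simp: win_def)
  then show ?case
  proof cases
    case 1
    then have "win c (Suc h) - {i} = pairwin c (Suc h)" using win_minus_left[of "Suc h" c] Suc.prems by simp
    then have "mkeys (anti_mon (win c (Suc h) - {i})) \<subseteq> {(a, b). a + b = 2 * (c) + 1}"
      using keys_anti_mon_pairwin[of "Suc h" c] Suc.prems(1) by simp
    also have "\<dots> \<subseteq> {(a, b). 2 * c - 1 \<le> a + b \<and> a + b \<le> 2 * c + 1}" using Suc.prems(1) by auto
    finally show ?thesis .
  next
    case 2
    then have "win c (Suc h) - {i} = pairwin (c - 1) (Suc h)" using win_minus_right[of "Suc h" c] Suc.prems by simp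
    then have "mkeys (anti_mon (win c (Suc h) - {i})) \<subseteq> {(a, b). a + b = 2 * (c - 1) + 1}"
      using keys_anti_mon_pairwin[of "Suc h" "c - 1"] Suc.prems(1) by simp
    also have "\<dots> \<subseteq> {(a, b). 2 * c - 1 \<le> a + b \<and> a + b \<le> 2 * c + 1}" using Suc.prems(1) by auto
    finally show ?thesis .
  next
    case 3
    have "c - Suc h + (c + Suc h) = 2 * c" using Suc.prems by simp
    moreover have "anti_mon (win c (Suc h) - {i}) = msingle (c - Suc h, c + Suc h) 1 + anti_mon (win c h - {i})"
      using anti_mon_win[of "Suc h" c i] Suc.prems 3 by simp
    ultimately show ?thesis using Suc.IH[OF _ 3] Suc.prems(1) by (simp add: keys_plus_nat)
  qed
qed

section \<open>Ideals of pfaffians\<close>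

lemma skew_ring_simps [simp]:
  "zero (skew_ring n) = 0" "one (skew_ring n) = 1"
  "add (skew_ring n) p q = p + q" "monoid.mult (skew_ring n) p q = p * q"
  by (simp_all add: skew_ring_def)

lemma carrier_skew_ring:
  "p \<in> carrier (skew_ring n) \<longleftrightarrow> (\<forall>m\<in>mkeys p. mkeys m \<subseteq> skew_vars n)"
  by (simp add: skew_ring_def)

lemma skew_carrier_zero: "0 \<in> carrier (skew_ring n)"
  by (simp add: carrier_skew_ring)

lemma skew_carrier_one: "1 \<in> carrier (skew_ring n)"
  by (simp add: carrier_skew_ring)

lemma skew_carrier_add:
  "p \<in> carrier (skew_ring n) \<Longrightarrow> q \<in> carrier (skew_ring n) \<Longrightarrow> p + q \<in> carrier (skew_ring n)"
  using keys_add[of p q] unfolding carrier_skew_ring by (meson UnE subsetD)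

lemma skew_carrier_uminus: "- p \<in> carrier (skew_ring n) \<longleftrightarrow> p \<in> carrier (skew_ring n)"
  by (simp add: carrier_skew_ring)

lemma skew_carrier_minus:
  "p \<in> carrier (skew_ring n) \<Longrightarrow> q \<in> carrier (skew_ring n) \<Longrightarrow> p - q \<in> carrier (skew_ring n)"
  using skew_carrier_add[of p n "- q"] skew_carrier_uminus[of q n] by simp

lemma skew_carrier_times:
  assumes "p \<in> carrier (skew_ring n)" "q \<in> carrier (skew_ring n)"
  shows "p * q \<in> carrier (skew_ring n)"
  unfolding carrier_skew_ring
proof
  fix m assume "m \<in> mkeys (p * q)"
  then obtain a b where ab: "a \<in> mkeys p" "b \<in> mkeys q" "m = a + b" by (rule keys_times_subset)
  then show "mkeys m \<subseteq> skew_vars n" using assms unfolding carrier_skew_ring by (simp add: keys_plus_nat)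
qed

lemma skew_carrier_single: "mkeys m \<subseteq> skew_vars n \<Longrightarrow> msingle m c \<in> carrier (skew_ring n)"
  by (simp add: carrier_skew_ring)

lemma skew_carrier_const: "skew_const c \<in> carrier (skew_ring n)"
  unfolding skew_const_def by (rule skew_carrier_single) simp

lemma skew_carrier_sign: "(- 1) ^ k \<in> carrier (skew_ring n)"
  using minus_one_power_cases[of k, where ?'a = "'a skew_poly"] skew_carrier_one skew_carrier_uminus[of 1]
  by metis

lemma skew_ring_cring: "cring (skew_ring n :: 'k::field skew_poly ring)"
proof (rule cringI)
  show "abelian_group (skew_ring n :: 'k skew_poly ring)"
  proof (rule abelian_groupI)
    fix x assume "x \<in> carrier (skew_ring n :: 'k skew_poly ring)"
    then show "\<exists>y\<in>carrier (skew_ring n). y \<oplus>\<^bsub>skew_ring n\<^esub> x = \<zero>\<^bsub>skew_ring n\<^esub>"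
      by (intro bexI[of _ "- x"]) (auto simp: skew_carrier_uminus)
  qed (auto simp: skew_carrier_zero algebra_simps intro: skew_carrier_add)
  show "comm_monoid (skew_ring n :: 'k skew_poly ring)"
    by (rule comm_monoidI) (auto simp: skew_carrier_one algebra_simps intro: skew_carrier_times)
qed (auto simp: algebra_simps)

lemma skew_ring_ring: "ring (skew_ring n :: 'k::field skew_poly ring)"
  using skew_ring_cring by (rule cring.axioms)

lemma pf_carrier:
  assumes "finite S" "even (card S)" "S \<subseteq> {1..n}"
  shows "pf S \<in> carrier (skew_ring n)"
  unfolding carrier_skew_ring
proof
  fix m assume "m \<in> mkeys (pf S :: 'a skew_poly)"
  then have "mkeys m \<subseteq> {(a, b). a \<in> S \<and> b \<in> S \<and> a < b}" using keys_pf[OF assms(1,2)] by blast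
  also have "\<dots> \<subseteq> skew_vars n" using assms(3) by (auto simp: skew_vars_def)
  finally show "mkeys m \<subseteq> skew_vars n" .
qed

lemma xvar_carrier: "i \<in> {1..n} \<Longrightarrow> j \<in> {1..n} \<Longrightarrow> i \<noteq> j \<Longrightarrow> xvar i j \<in> carrier (skew_ring n)"
  unfolding xvar_def skew_var_def by (rule skew_carrier_single) (auto simp: skew_vars_def min_def max_def)

abbreviation skew_Idl :: "nat \<Rightarrow> 'k::field skew_poly set \<Rightarrow> 'k skew_poly set" where
  "skew_Idl n G \<equiv> Idl\<^bsub>skew_ring n\<^esub> G"

context
  fixes n :: nat and G :: "'k::field skew_poly set"
  assumes G: "G \<subseteq> carrier (skew_ring n)"
begin

lemma skew_Idl_ideal: "ideal (skew_Idl n G) (skew_ring n)"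
  by (rule ring.genideal_ideal[OF skew_ring_ring G])

lemma skew_Idl_gen: "g \<in> G \<Longrightarrow> g \<in> skew_Idl n G"
  using ring.genideal_self[OF skew_ring_ring G] by blast

lemma skew_Idl_carrier: "p \<in> skew_Idl n G \<Longrightarrow> p \<in> carrier (skew_ring n)"
  using ideal.Icarr[OF skew_Idl_ideal] .

lemma skew_Idl_times: "r \<in> carrier (skew_ring n) \<Longrightarrow> p \<in> skew_Idl n G \<Longrightarrow> r * p \<in> skew_Idl n G"
  using ideal.I_l_closed[OF skew_Idl_ideal, of p r] by simp

lemma skew_Idl_add: "p \<in> skew_Idl n G \<Longrightarrow> q \<in> skew_Idl n G \<Longrightarrow> p + q \<in> skew_Idl n G"
  using additive_subgroup.a_closed[OF ideal.axioms(1)[OF skew_Idl_ideal]] by fastforce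

lemma skew_Idl_zero: "0 \<in> skew_Idl n G"
  using additive_subgroup.zero_closed[OF ideal.axioms(1)[OF skew_Idl_ideal]] by simp

lemma skew_Idl_uminus: "p \<in> skew_Idl n G \<Longrightarrow> - p \<in> skew_Idl n G"
  using skew_Idl_times[of "- 1" p] by (simp add: skew_carrier_uminus skew_carrier_one)

lemma skew_Idl_minus: "p \<in> skew_Idl n G \<Longrightarrow> q \<in> skew_Idl n G \<Longrightarrow> p - q \<in> skew_Idl n G"
  using skew_Idl_add[of p "- q"] skew_Idl_uminus[of q] by simp

lemma skew_Idl_sum: "(\<And>i. i \<in> A \<Longrightarrow> f i \<in> skew_Idl n G) \<Longrightarrow> sum f A \<in> skew_Idl n G"
  by (induction A rule: infinite_finite_induct) (auto simp: skew_Idl_zero intro: skew_Idl_add)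

text \<open>The ring elements with property P form an ideal that contains G; closure under negation
  is \<open>times\<close> with r = - 1.\<close>

lemma skew_Idl_induct [consumes 1, case_names zero gen add times]:
  assumes p: "p \<in> skew_Idl n G"
    and zero: "P 0" and gen: "\<And>g. g \<in> G \<Longrightarrow> P g"
    and add: "\<And>p q. P p \<Longrightarrow> P q \<Longrightarrow> P (p + q)"
    and times: "\<And>r p. r \<in> carrier (skew_ring n) \<Longrightarrow> P p \<Longrightarrow> P (r * p)"
  shows "P p"
proof -
  let ?X = "{p \<in> carrier (skew_ring n). P p}"
  have neg: "P (- p)" if "P p" for p
    using times[of "- 1" p] that by (simp add: skew_carrier_uminus skew_carrier_one)
  interpret R: cring "skew_ring n :: 'k skew_poly ring" by (rule skew_ring_cring)
  have ainv: "\<ominus>\<^bsub>skew_ring n\<^esub> x = - x" if "x \<in> carrier (skew_ring n)" for x :: "'k skew_poly"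
    using that by (intro R.minus_equality) (auto simp: skew_carrier_uminus)
  have "ideal ?X (skew_ring n)"
  proof (rule idealI[OF skew_ring_ring])
    show "subgroup ?X (add_monoid (skew_ring n))"
    proof (rule R.add.subgroupI)
      show "?X \<noteq> {}" using zero skew_carrier_zero by auto
    next
      fix a assume a: "a \<in> ?X"
      then have "\<ominus>\<^bsub>skew_ring n\<^esub> a = - a" using ainv by simp
      then show "\<ominus>\<^bsub>skew_ring n\<^esub> a \<in> ?X"
        using a neg by (simp add: skew_carrier_uminus)
    qed (auto intro: add skew_carrier_add)
    fix a x assume a: "a \<in> ?X" and x: "x \<in> carrier (skew_ring n :: 'k skew_poly ring)"
    then have "x * a \<in> ?X" by (simp add: times skew_carrier_times)
    then show "x \<otimes>\<^bsub>skew_ring n\<^esub> a \<in> ?X" "a \<otimes>\<^bsub>skew_ring n\<^esub> x \<in> ?X" by (simp_all add: mult.commute)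
  qed
  then have "skew_Idl n G \<subseteq> ?X"
    by (rule ring.genideal_minimal[OF skew_ring_ring]) (use gen G in auto)
  then show ?thesis using p by blast
qed

end

section \<open>Initial ideals and the transfer of the Groebner property\<close>

definition monomial_span :: "nat set set \<Rightarrow> skew_mon set" where
  "monomial_span F = {anti_mon S + m | S m. S \<in> F}"

definition pf_family :: "nat \<Rightarrow> nat set set \<Rightarrow> bool" where
  "pf_family n F \<longleftrightarrow> (\<forall>S\<in>F. finite S \<and> even (card S) \<and> S \<subseteq> {1..n})"

text \<open>One inclusion of initial ideals; the converse is \<open>monomial_span_lm\<close>,
  restricted to \<open>skew_vars n\<close> because \<open>monomial_span\<close> allows multiples by
  all variables. The type argument fixes the field, which n and F do not determine.\<close>

definition pf_groebner :: "'k::field itself \<Rightarrow> nat \<Rightarrow> nat set set \<Rightarrow> bool" where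
  "pf_groebner TYPE('k) n F \<longleftrightarrow>
    (\<forall>p::'k skew_poly. p \<in> skew_Idl n (pf ` F) \<longrightarrow> p \<noteq> 0 \<longrightarrow> lm p \<in> monomial_span F)"

lemma pf_family_carrier: "pf_family n F \<Longrightarrow> pf ` F \<subseteq> carrier (skew_ring n)"
  unfolding pf_family_def by (intro image_subsetI pf_carrier) (simp_all del: One_nat_def)

lemma monomial_span_add: "m \<in> monomial_span F \<Longrightarrow> x + m \<in> monomial_span F"
  unfolding monomial_span_def by (clarsimp, metis add.left_commute)

lemma monomial_span_mono: "F \<subseteq> F' \<Longrightarrow> monomial_span F \<subseteq> monomial_span F'"
  unfolding monomial_span_def by blast

lemma lookup_minus_nat: "mlookup (f - g) k = mlookup f k - mlookup (g :: 'a \<Rightarrow>\<^sub>0 nat) k"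
  by transfer simp

text \<open>The coprime factor x cannot help divisibility by a generator, so it is a nonzerodivisor
  modulo the monomial ideal. This supplies \<open>f_reg\<close> and \<open>g_reg\<close> of
  \<open>lm_link\<close>.\<close>

lemma monomial_span_regular:
  assumes "x + m \<in> monomial_span F" "\<And>S. S \<in> F \<Longrightarrow> mkeys x \<inter> mkeys (anti_mon S) = {}"
  shows "m \<in> monomial_span F"
proof -
  obtain S m' where S: "S \<in> F" "x + m = anti_mon S + m'" using assms(1) by (auto simp: monomial_span_def)
  have "mlookup (anti_mon S) v \<le> mlookup m v" for v
  proof (cases "v \<in> mkeys (anti_mon S)")
    case True
    then have "mlookup x v = 0" using assms(2)[OF S(1)] by (auto simp: in_keys_iff)
    then show ?thesis using arg_cong[OF S(2), of "\<lambda>p. mlookup p v"] by (simp add: lookup_add)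
  qed (simp add: in_keys_iff)
  then have "m = anti_mon S + (m - anti_mon S)"
    by (intro poly_mapping_eqI) (simp add: lookup_add lookup_minus_nat)
  then show ?thesis using S(1) by (auto simp: monomial_span_def)
qed

lemma lm_carrier: "p \<in> carrier (skew_ring n) \<Longrightarrow> p \<noteq> 0 \<Longrightarrow> mkeys (lm p) \<subseteq> skew_vars n"
  using lm_in_keys carrier_skew_ring by blast

text \<open>A monomial multiple of a generator does it. Its homogeneity keeps the reductions of
  \<open>standard_form\<close> in a single degree.\<close>

lemma monomial_span_lm:
  assumes F: "pf_family n F" and m: "m \<in> monomial_span F" "mkeys m \<subseteq> skew_vars n"
  shows "\<exists>p\<in>skew_Idl n (pf ` F). p \<noteq> (0::'k::field skew_poly) \<and> lm p = m \<and> (\<forall>m'\<in>mkeys p. total_degree m' = total_degree m)"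
proof -
  obtain S m' where S: "S \<in> F" "m = anti_mon S + m'" using m(1) by (auto simp: monomial_span_def)
  let ?p = "msingle m' 1 * pf S :: 'k skew_poly"
  have s0: "(msingle m' 1 :: 'k skew_poly) \<noteq> 0" by (metis keys_single keys_zero one_neq_zero insert_not_empty)
  have fS: "finite S" "even (card S)" using F S(1) by (auto simp: pf_family_def)
  have "mkeys m' \<subseteq> skew_vars n" using m(2) S(2) by (simp add: keys_plus_nat)
  then have "?p \<in> skew_Idl n (pf ` F)"
    by (intro skew_Idl_times[OF pf_family_carrier[OF F]] skew_Idl_gen[OF pf_family_carrier[OF F]]
        skew_carrier_single imageI S(1))
  moreover have "?p \<noteq> 0" "lm ?p = m"
    using lm_pf[OF fS, where ?'k = 'k] s0 by (simp_all add: times_neq_zero lm_times lm_single S(2) add.commute)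
  moreover have "total_degree k = total_degree m" if "k \<in> mkeys ?p" for k
  proof -
    have deg: "total_degree k' = card S div 2" if "k' \<in> mkeys (pf S :: 'k skew_poly)" for k'
      using keys_pf[OF fS that] by blast
    have "anti_mon S \<in> mkeys (pf S :: 'k skew_poly)" using lm_pf[OF fS, where ?'k = 'k] lm_in_keys by metis
    moreover obtain k' where "k' \<in> mkeys (pf S :: 'k skew_poly)" "k = m' + k'"
      using keys_times_subset[OF \<open>k \<in> mkeys ?p\<close>] by auto
    ultimately show ?thesis using deg by (simp add: S(2) total_degree_plus)
  qed
  ultimately show ?thesis by blast
qed

text \<open>\<open>lm_link\<close> for ideals of pfaffians. J stays abstract because it is the ideal
  of a smaller ladder in the main induction, but the whole ring when a single pfaffian is
  added.\<close>

lemma pf_groebner_link: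
  fixes J :: "'k::field skew_poly set"
  assumes F: "pf_family n F" and N: "pf_family n N" and GN: "pf_groebner TYPE('k) n N"
    and J: "\<And>p. p \<in> J \<Longrightarrow> p \<in> carrier (skew_ring n)" "\<And>q \<nu>. q \<in> J \<Longrightarrow> \<nu> \<in> skew_Idl n (pf ` N) \<Longrightarrow> q - \<nu> \<in> J"
      "0 \<in> J" "\<And>q q'. q \<in> J \<Longrightarrow> q' \<in> J \<Longrightarrow> q + q' \<in> J"
      "\<And>r q. r \<in> carrier (skew_ring n) \<Longrightarrow> q \<in> J \<Longrightarrow> r * q \<in> J"
    and fg: "f \<in> carrier (skew_ring n)" "g \<in> carrier (skew_ring n)" "f \<noteq> 0" "g \<noteq> 0" "lm g = x + lm f"
    and f_reg: "\<And>S. S \<in> N \<Longrightarrow> mkeys (lm f) \<inter> mkeys (anti_mon S) = {}"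
    and g_reg: "\<And>S. S \<in> N \<Longrightarrow> mkeys (lm g) \<inter> mkeys (anti_mon S) = {}"
    and step: "\<And>S. S \<in> F \<Longrightarrow> \<exists>q\<in>J. \<exists>\<nu>\<in>skew_Idl n (pf ` N). f * pf S = g * q + \<nu>"
    and NF: "monomial_span N \<subseteq> monomial_span F"
    and JF: "\<And>q. q \<in> J \<Longrightarrow> q \<noteq> 0 \<Longrightarrow> x + lm q \<in> monomial_span F"
  shows "pf_groebner TYPE('k) n F"
  unfolding pf_groebner_def
proof (intro allI impI)
  fix p :: "'k skew_poly" assume p: "p \<in> skew_Idl n (pf ` F)" "p \<noteq> 0"
  let ?N = "skew_Idl n (pf ` N) :: 'k skew_poly set"
  note cN = pf_family_carrier[OF N, where ?'a = 'k]
  note cF = pf_family_carrier[OF F, where ?'a = 'k]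
  \<comment> \<open>The p with f * p in g J + N form an ideal, so \<open>step\<close> on the
    generators is enough.\<close>
  have "\<exists>q\<in>J. \<exists>\<nu>\<in>?N. f * p = g * q + \<nu>"
    using p(1)
  proof (induction rule: skew_Idl_induct[OF cF, consumes 1, case_names zero gen add times])
    case zero
    show ?case using J(3) skew_Idl_zero[OF cN] by (intro bexI[of _ 0]) auto
  next
    case (gen g') then show ?case using step by auto
  next
    case (add p p')
    then obtain q \<nu> q' \<nu>' where "q \<in> J" "\<nu> \<in> ?N" "f * p = g * q + \<nu>" "q' \<in> J" "\<nu>' \<in> ?N" "f * p' = g * q' + \<nu>'" by blast
    then show ?case by (intro bexI[of _ "q + q'"] bexI[of _ "\<nu> + \<nu>'"]) (auto simp: algebra_simps intro: J skew_Idl_add[OF cN])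
  next
    case (times r p)
    then obtain q \<nu> where "q \<in> J" "\<nu> \<in> ?N" "f * p = g * q + \<nu>" by blast
    then have "f * (r * p) = g * (r * q) + r * \<nu>" by (metis distrib_left mult.left_commute)
    then show ?case using J(5) skew_Idl_times[OF cN] \<open>q \<in> J\<close> \<open>\<nu> \<in> ?N\<close> times(1)
      by (intro bexI[of _ "r * q"] bexI[of _ "r * \<nu>"]) auto
  qed
  then obtain q \<nu> where q: "q \<in> J" "\<nu> \<in> ?N" "f * p = g * q + \<nu>" by blast
  have "lm p \<in> monomial_span N \<or> (\<exists>q\<in>J. q \<noteq> 0 \<and> lm p = x + lm q)"
  \<comment> \<open>V singles out the monomials of the ring with n indices inside the larger
    \<open>monomial_span N\<close>.\<close>
  proof (rule lm_link[where N = ?N and V = "{m. mkeys m \<subseteq> skew_vars n}" and f = f and g = g and q = q and \<nu> = \<nu>])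
    show "m \<in> lm ` (?N - {0}) \<longleftrightarrow> m \<in> monomial_span N \<and> m \<in> {m. mkeys m \<subseteq> skew_vars n}" for m
    proof
      assume "m \<in> lm ` (?N - {0})"
      then obtain p where "p \<in> ?N" "p \<noteq> 0" "m = lm p" by auto
      then show "m \<in> monomial_span N \<and> m \<in> {m. mkeys m \<subseteq> skew_vars n}"
        using GN lm_carrier[OF skew_Idl_carrier[OF cN]] unfolding pf_groebner_def by simp
    next
      assume "m \<in> monomial_span N \<and> m \<in> {m. mkeys m \<subseteq> skew_vars n}"
      then obtain p where "p \<in> ?N" "p \<noteq> 0" "lm p = m" using monomial_span_lm[OF N, of m, where ?'k = 'k] by auto
      then show "m \<in> lm ` (?N - {0})" by blast
    qed
    show "lm p \<in> {m. mkeys m \<subseteq> skew_vars n}" using lm_carrier[OF skew_Idl_carrier[OF cF p(1)] p(2)] by simp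
    show "\<And>q. q \<in> J \<Longrightarrow> q \<noteq> 0 \<Longrightarrow> lm q \<in> {m. mkeys m \<subseteq> skew_vars n}" by (simp add: lm_carrier[OF J(1)])
  qed (use q J fg p in \<open>auto simp: keys_plus_nat skew_Idl_zero[OF cN] intro: skew_Idl_add[OF cN]
        skew_Idl_times[OF cN] skew_carrier_const monomial_span_regular[OF _ f_reg] monomial_span_regular[OF _ g_reg]\<close>)
  then show "lm p \<in> monomial_span F" using NF JF by auto
qed

section \<open>Groebner bases of ladder pfaffian ideals\<close>

text \<open>The ladders of the theorem have D = {}. Pfaffians over D arise in the induction, as
  remnants of a deleted window on a side where it has no neighbour.\<close>

definition ladder_sets :: "nat set \<Rightarrow> (nat \<Rightarrow> nat) \<Rightarrow> nat set \<Rightarrow> (nat \<Rightarrow> nat) \<Rightarrow> nat set set" where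
  "ladder_sets C h D u = {win c (h c) - {i} | c i. c \<in> C \<and> i \<in> win c (h c)} \<union> (\<lambda>d. pairwin d (u d)) ` D"

text \<open>
  The heights of adjacent windows differ by at most one: if the window of height \<open>h\<close> at \<open>c\<close> is removed,
  then the pfaffian of the window without one of its ends still lies in the ideal of the neighbouring
  window.
\<close>

definition admissible :: "nat \<Rightarrow> nat set \<Rightarrow> (nat \<Rightarrow> nat) \<Rightarrow> nat set \<Rightarrow> (nat \<Rightarrow> nat) \<Rightarrow> bool" where
  "admissible n C h D u \<longleftrightarrow> finite C \<and> finite D \<and>
     (\<forall>c\<in>C. h c < c \<and> c + h c \<le> n \<and> c \<notin> D \<and> c - 1 \<notin> D) \<and>
     (\<forall>c\<in>C. c + 1 \<in> C \<longrightarrow> h c \<le> h (c + 1) + 1 \<and> h (c + 1) \<le> h c + 1) \<and>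
     (\<forall>d\<in>D. u d \<le> d \<and> d + u d \<le> n)"

lemma pf_family_ladder_sets:
  assumes "admissible n C h D u" shows "pf_family n (ladder_sets C h D u)"
  unfolding pf_family_def ladder_sets_def
proof (intro ballI, elim UnE)
  fix S assume "S \<in> {win c (h c) - {i} | c i. c \<in> C \<and> i \<in> win c (h c)}"
  then obtain c i where c: "c \<in> C" "i \<in> win c (h c)" and S: "S = win c (h c) - {i}" by blast
  have h: "h c < c" "c + h c \<le> n" using assms c by (auto simp: admissible_def)
  then have "win c (h c) \<subseteq> {1..n}" by (auto simp: win_def)
  then show "finite S \<and> even (card S) \<and> S \<subseteq> {1..n}"
    using c h card_win_remove[of "h c" c i] unfolding S by auto
next
  fix S assume "S \<in> (\<lambda>d. pairwin d (u d)) ` D"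
  then obtain d where d: "d \<in> D" and S: "S = pairwin d (u d)" by blast
  then have "u d \<le> d" "d + u d \<le> n" using assms by (auto simp: admissible_def)
  then show "finite S \<and> even (card S) \<and> S \<subseteq> {1..n}"
    unfolding S by (auto simp: card_pairwin) (auto simp: pairwin_def)
qed

lemma keys_subset_disjoint:
  assumes "A \<subseteq> {(a, b). P (a + b)}" "B \<subseteq> {(a, b). Q (a + b)}" "\<And>s :: nat. P s \<Longrightarrow> Q s \<Longrightarrow> False"
  shows "A \<inter> B = {}"
  using assms by fast

text \<open>The leading monomials lie on distinct antidiagonals a + b = 2d + 1 and are therefore
  coprime. Adding one pfaffian g is a link in which J is the whole ring, f = 1 and x =
  \<open>lm g\<close>.\<close>

lemma pf_groebner_pairwins:
  assumes "finite D" "\<forall>d\<in>D. u d \<le> d \<and> d + u d \<le> n"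
  shows "pf_groebner TYPE('k::field) n (ladder_sets {} h D u)"
  using assms
proof (induction D rule: finite_induct)
  case empty
  have "ladder_sets {} h {} u = {}" by (auto simp: ladder_sets_def)
  moreover have "p = 0" if "p \<in> skew_Idl n {}" for p :: "'k skew_poly"
    using that by (induction rule: skew_Idl_induct[OF empty_subsetI, consumes 1]) auto
  ultimately show ?case by (simp add: pf_groebner_def)
next
  case (insert d D)
  let ?N = "ladder_sets {} h D u" and ?F = "ladder_sets {} h (insert d D) u"
  let ?g = "pf (pairwin d (u d)) :: 'k skew_poly"
  have F: "pf_family n ?F" and N: "pf_family n ?N"
    using insert by (auto intro!: pf_family_ladder_sets simp: admissible_def)
  have N_eq: "?N = (\<lambda>d. pairwin d (u d)) ` D" and F_eq: "?F = insert (pairwin d (u d)) ?N"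
    by (auto simp: ladder_sets_def)
  have ev: "even (card (pairwin d (u d)))" using insert.prems by (simp add: card_pairwin)
  note lg = lm_pf[OF finite_win(2) ev, where ?'k = 'k]
  have gc: "?g \<in> carrier (skew_ring n)" using pf_family_carrier[OF F] unfolding F_eq by blast
  have cN: "pf ` ?N \<subseteq> carrier (skew_ring n :: 'k skew_poly ring)" using pf_family_carrier[OF N] .
  have reg: "mkeys (anti_mon (pairwin d (u d))) \<inter> mkeys (anti_mon S) = {}" if S: "S \<in> ?N" for S
  proof -
    obtain d' where d': "d' \<in> D" "S = pairwin d' (u d')" using S unfolding N_eq by blast
    then have "d' \<noteq> d" using insert.hyps by auto
    show ?thesis
      by (rule keys_subset_disjoint[where P = "\<lambda>s. s = 2 * d + 1" and Q = "\<lambda>s. s = 2 * d' + 1"])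
         (use keys_anti_mon_pairwin insert.prems d' \<open>d' \<noteq> d\<close> in auto)
  qed
  show ?case
  proof (rule pf_groebner_link[OF F N, where J = "carrier (skew_ring n)" and f = 1 and g = ?g])
    show "pf_groebner TYPE('k) n ?N" using insert by simp
    show "?g \<noteq> 0" "lm ?g = anti_mon (pairwin d (u d)) + lm (1 :: 'k skew_poly)" using lg by auto
    show "mkeys (lm ?g) \<inter> mkeys (anti_mon S) = {}" if "S \<in> ?N" for S using lg reg[OF that] by simp
    show "q - \<nu> \<in> carrier (skew_ring n)" if "q \<in> carrier (skew_ring n)" "\<nu> \<in> skew_Idl n (pf ` ?N)" for q \<nu> :: "'k skew_poly"
      using that skew_Idl_carrier[OF cN] by (auto intro: skew_carrier_minus)
    show "\<exists>q\<in>carrier (skew_ring n). \<exists>\<nu>\<in>skew_Idl n (pf ` ?N). 1 * pf S = ?g * q + \<nu>" if "S \<in> ?F" for S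
    proof (cases "S \<in> ?N")
      case True
      then show ?thesis by (intro bexI[of _ 0] bexI[of _ "pf S"]) (auto intro: skew_carrier_zero skew_Idl_gen[OF cN])
    next
      case False
      then have "S = pairwin d (u d)" using that unfolding F_eq by blast
      then show ?thesis by (intro bexI[of _ 1] bexI[of _ 0]) (auto intro: skew_carrier_one skew_Idl_zero[OF cN])
    qed
    show "monomial_span ?N \<subseteq> monomial_span ?F" unfolding F_eq by (rule monomial_span_mono) blast
    show "anti_mon (pairwin d (u d)) + lm q \<in> monomial_span ?F" for q :: "'k skew_poly"
      unfolding monomial_span_def F_eq by blast
  qed (auto simp: skew_carrier_zero skew_carrier_one intro: gc skew_carrier_add skew_carrier_times)
qed

lemma pf_in_Idl_expand:
  assumes F: "pf_family n F" and S: "finite S" "even (card S)" "S \<subseteq> {1..n}" "i \<in> S"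
    and sub: "\<And>j. j \<in> S - {i} \<Longrightarrow> S - {i, j} \<in> F"
  shows "pf S \<in> skew_Idl n (pf ` F)"
  unfolding pf_expand[OF S(1,2,4)]
proof (rule skew_Idl_sum[OF pf_family_carrier[OF F]])
  fix j assume j: "j \<in> S - {i}"
  have "chord_sign S i j * xvar i j \<in> carrier (skew_ring n)"
    using j S unfolding chord_sign_def by (intro skew_carrier_times skew_carrier_sign xvar_carrier) auto
  then show "chord_sign S i j * xvar i j * pf (S - {i, j}) \<in> skew_Idl n (pf ` F)"
    using sub[OF j] by (intro skew_Idl_times[OF pf_family_carrier[OF F]] skew_Idl_gen[OF pf_family_carrier[OF F]] imageI)
qed

text \<open>Expansion along the right end c + h leaves only minors of \<open>win c (h - 1)\<close>.
  This is used for N \<subseteq> J and for end pfaffians next to a neighbour of smaller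
  height.\<close>

lemma pf_pairwin_in_Idl:
  assumes F: "pf_family n F" and h: "1 \<le> h" "h \<le> c" "c + h \<le> n"
    and sub: "\<And>i. i \<in> win c (h - 1) \<Longrightarrow> win c (h - 1) - {i} \<in> F"
  shows "pf (pairwin c h) \<in> skew_Idl n (pf ` F)"
proof (rule pf_in_Idl_expand[OF F, where i = "c + h"])
  fix j assume j: "j \<in> pairwin c h - {c + h}"
  have "x \<in> pairwin c h - {c + h, j} \<longleftrightarrow> x \<in> win c (h - 1) - {j}" for x
    using h unfolding pairwin_def win_def Diff_iff atLeastAtMost_iff insert_iff by auto
  then have "pairwin c h - {c + h, j} = win c (h - 1) - {j}" by blast
  moreover have "j \<in> win c (h - 1)" using j h by (auto simp: pairwin_def win_def)
  ultimately show "pairwin c h - {c + h, j} \<in> F" using sub by simp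
qed (use h card_pairwin[of h c] in \<open>auto simp: pairwin_def\<close>)

lemma pf_pairwin_in_Idl':
  assumes F: "pf_family n F" and h: "1 \<le> h" "h < c" "c + h - 1 \<le> n"
    and sub: "\<And>i. i \<in> win c (h - 1) \<Longrightarrow> win c (h - 1) - {i} \<in> F"
  shows "pf (pairwin (c - 1) h) \<in> skew_Idl n (pf ` F)"
proof (rule pf_in_Idl_expand[OF F, where i = "c - h"])
  fix j assume j: "j \<in> pairwin (c - 1) h - {c - h}"
  have "x \<in> pairwin (c - 1) h - {c - h, j} \<longleftrightarrow> x \<in> win c (h - 1) - {j}" for x
    using h unfolding pairwin_def win_def Diff_iff atLeastAtMost_iff insert_iff by auto
  then have "pairwin (c - 1) h - {c - h, j} = win c (h - 1) - {j}" by blast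
  moreover have "j \<in> win c (h - 1)" using j h by (auto simp: pairwin_def win_def)
  ultimately show "pairwin (c - 1) h - {c - h, j} \<in> F" using sub by simp
qed (use h card_pairwin[of h "c - 1"] in \<open>auto simp: pairwin_def\<close>)

lemma pos_sign_cases: "pos_sign S i = (1 :: 'k::field skew_poly) \<or> pos_sign S i = (- 1 :: 'k skew_poly)"
  unfolding pos_sign_def by (rule minus_one_power_cases)

text \<open>
  The quotients \<open>pf (W - {i}) / pf (W' - {i})\<close> do not depend on \<open>i\<close>, up to sign, on the variety where
  \<open>pf (W - {a})\<close> and \<open>pf (W - {b})\<close> vanish; here \<open>W' = W - {a, b}\<close>.
\<close>

lemma pf_win_exchange:
  assumes h: "1 \<le> h" "h < c" "c + h \<le> n" and i: "i \<in> win c (h - 1)"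
  shows "\<exists>s\<in>{1, - 1}. \<exists>\<alpha>\<in>carrier (skew_ring n). \<exists>\<beta>\<in>carrier (skew_ring n).
    pf (win c (h - 1) - {c}) * pf (win c h - {i}) =
      pf (win c h - {c}) * (s * pf (win c (h - 1) - {i})) +
      (\<alpha> * pf (pairwin c h) + \<beta> * pf (pairwin (c - 1) h) :: 'k::field skew_poly)"
proof (cases "i = c")
  case True
  then show ?thesis
    by (intro bexI[of _ 1] bexI[of _ 0]) (auto simp: skew_carrier_zero mult.commute)
next
  case False
  define W where "W = win c h"
  \<comment> \<open>With this T, W - T = {a, b, c, i}: the Pluecker terms of a and b contain the two
    end pfaffians, and those of c and i form the exchange.\<close>
  define T where "T = win c (h - 1) - {c, i}"
  define a where "a = c - h"
  define b where "b = c + h"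
  have c: "c \<in> win c (h - 1)" by (simp add: win_def)
  have ends: "a \<notin> win c (h - 1)" "b \<notin> win c (h - 1)" "a \<noteq> b" using h by (auto simp: win_def a_def b_def)
  \<comment> \<open>The smaller window contains both c and i, so h \<ge> 2 and the size 2h - 3 of T
    is not truncated.\<close>
  have "2 \<le> card (win c (h - 1))" using card_mono[of "win c (h - 1)" "{c, i}"] i c False by simp
  then have h2: "2 \<le> h" using h by (simp add: card_win)
  have "card T = card (win c (h - 1)) - 2"
    unfolding T_def using i c False by (simp add: card_Diff_subset)
  then have cT: "card T = 2 * h - 3" using h h2 by (simp add: card_win)
  have cW: "card W = 2 * h + 1" using h by (simp add: W_def card_win)
  have "x \<in> W \<longleftrightarrow> x \<in> insert a (insert b (win c (h - 1)))" for x
    using h unfolding W_def win_def a_def b_def insert_iff atLeastAtMost_iff by auto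
  then have W: "W = insert a (insert b (win c (h - 1)))" by blast
  have TW: "T \<subseteq> W" "W - T = {a, b, c, i}" using ends i c unfolding W T_def by auto
  have ins: "insert c T = win c (h - 1) - {i}" "insert i T = win c (h - 1) - {c}"
    using i c False unfolding T_def by auto
  have ab: "W - {a} = pairwin c h" "W - {b} = pairwin (c - 1) h"
    using win_minus_left[of h c] win_minus_right[of h c] h unfolding W_def a_def b_def by auto
  define \<epsilon> where "\<epsilon> j = (pos_sign W j * pos_sign T j :: 'k skew_poly)" for j
  have \<epsilon>: "\<epsilon> j = 1 \<or> \<epsilon> j = - 1" for j
    using pos_sign_cases[of W j, where ?'k = 'k] pos_sign_cases[of T j, where ?'k = 'k] unfolding \<epsilon>_def by fastforce
  have \<epsilon>_sq: "\<epsilon> j * (\<epsilon> j * x) = x" for j x using \<epsilon>[of j] by auto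
  have dist: "a \<notin> {b, c, i}" "b \<notin> {c, i}" "c \<notin> {i}" using ends i c False by auto
  have "odd (card W)" "odd (card T)" using cT cW h2 by presburger+
  then have "(\<Sum>j\<in>{a, b, c, i}. \<epsilon> j * pf (W - {j}) * pf (insert j T)) = (0 :: 'k skew_poly)"
    using pf_pluecker[of W T, where ?'k = 'k] TW unfolding \<epsilon>_def by (simp add: W_def)
  then have "\<epsilon> a * pf (W - {a}) * pf (insert a T) + (\<epsilon> b * pf (W - {b}) * pf (insert b T) +
      (\<epsilon> c * pf (W - {c}) * pf (insert c T) + \<epsilon> i * pf (W - {i}) * pf (insert i T))) = 0"
    using dist by simp
  then have "\<epsilon> i * pf (W - {i}) * pf (insert i T) =
      - (\<epsilon> a * pf (W - {a}) * pf (insert a T) + \<epsilon> b * pf (W - {b}) * pf (insert b T) + \<epsilon> c * pf (W - {c}) * pf (insert c T))"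
    by (simp add: eq_neg_iff_add_eq_0 algebra_simps)
  then have "\<epsilon> i * (\<epsilon> i * pf (W - {i}) * pf (insert i T)) =
      \<epsilon> i * - (\<epsilon> a * pf (W - {a}) * pf (insert a T) + \<epsilon> b * pf (W - {b}) * pf (insert b T) + \<epsilon> c * pf (W - {c}) * pf (insert c T))"
    by (rule arg_cong)
  then have eq: "pf (insert i T) * pf (W - {i}) = pf (W - {c}) * (- (\<epsilon> i * \<epsilon> c) * pf (insert c T)) +
      (- (\<epsilon> i * \<epsilon> a * pf (insert a T)) * pf (W - {a}) + - (\<epsilon> i * \<epsilon> b * pf (insert b T)) * pf (W - {b}))"
    by (simp add: mult.assoc \<epsilon>_sq) (simp add: algebra_simps)
  have sgn: "- (\<epsilon> i * \<epsilon> c) \<in> {1, - 1}" using \<epsilon>[of i] \<epsilon>[of c] by auto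
  have \<epsilon>C: "\<epsilon> j \<in> carrier (skew_ring n)" for j
    unfolding \<epsilon>_def pos_sign_def by (intro skew_carrier_times skew_carrier_sign)
  have TC: "- (\<epsilon> i * \<epsilon> j * pf (insert j T)) \<in> carrier (skew_ring n)" if "j \<in> {a, b}" for j
  proof -
    have "j \<notin> T" "finite T" using that ends unfolding T_def by auto
    then have "even (card (insert j T))" using \<open>odd (card T)\<close> by simp
    moreover have "insert j T \<subseteq> {1..n}" using that h unfolding T_def a_def b_def by (auto simp: win_def)
    ultimately show ?thesis using \<open>finite T\<close>
      by (simp add: skew_carrier_uminus skew_carrier_times \<epsilon>C pf_carrier del: One_nat_def)
  qed
  show ?thesis
    using eq sgn TC[of a] TC[of b] unfolding ins ab unfolding W_def[symmetric] by blast
qed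

text \<open>The measure drops for N, which loses a window, and for J, where one height decreases.
  Maximality of the height H keeps J admissible: no neighbour exceeds (H - 1) + 1.\<close>

theorem pf_groebner_ladder:
  assumes "admissible n C h D u"
  shows "pf_groebner TYPE('k::field) n (ladder_sets C h D u)"
  using assms
proof (induction "\<Sum>c\<in>C. Suc (h c)" arbitrary: C h D u rule: less_induct)
  case less
  let ?F = "ladder_sets C h D u"
  have F: "pf_family n ?F" by (rule pf_family_ladder_sets[OF less.prems])
  have fin: "finite C" "finite D"
    and bd: "\<And>c. c \<in> C \<Longrightarrow> h c < c \<and> c + h c \<le> n \<and> c \<notin> D \<and> c - 1 \<notin> D"
    and adj: "\<And>c. c \<in> C \<Longrightarrow> c + 1 \<in> C \<Longrightarrow> h c \<le> h (c + 1) + 1 \<and> h (c + 1) \<le> h c + 1"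
    and bdD: "\<And>d. d \<in> D \<Longrightarrow> u d \<le> d \<and> d + u d \<le> n"
    using less.prems unfolding admissible_def by auto
  show ?case
  proof (cases "C = {}")
    case True
    then show ?thesis using fin bdD by (simp add: pf_groebner_pairwins)
  next
    case False
    have "Max (h ` C) \<in> h ` C" using fin False by simp
    then obtain c where c: "c \<in> C" "h c = Max (h ` C)" by auto
    have hmax: "h c' \<le> h c" if "c' \<in> C" for c' using fin that unfolding c(2) by simp
    note bc = bd[OF c(1)]
    show ?thesis
    proof (cases "h c = 0")
      case True
      \<comment> \<open>A window of height 0 contributes the empty pfaffian 1, so every monomial is
        in the span.\<close>
      then have "win c (h c) - {c} = {}" "c \<in> win c (h c)" by (auto simp: win_def)
      then have "{} \<in> ?F" using c(1) unfolding ladder_sets_def by blast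
      then have "m \<in> monomial_span ?F" for m
        unfolding monomial_span_def by (auto intro!: exI[of _ "{}"])
      then show ?thesis by (simp add: pf_groebner_def)
    next
      case False
      define H where "H = h c"
      have H: "1 \<le> H" "H < c" "c + H \<le> n" using False bc by (auto simp: H_def)
      let ?CN = "C - {c}"
      \<comment> \<open>The positions c and c - 1 stand for the centers c + 1/2 and c - 1/2. An end
        pfaffian of the deleted window is added where no neighbouring window supplies it.\<close>
      define DN where "DN = D \<union> {d \<in> {c - 1, c}. (d = c \<longrightarrow> c + 1 \<notin> C) \<and> (d = c - 1 \<longrightarrow> c - 1 \<notin> C)}"
      define uN where "uN = u(c := H, c - 1 := H)"
      define hJ where "hJ = h(c := H - 1)"
      let ?N = "ladder_sets ?CN h DN uN" and ?J = "ladder_sets C hJ D u"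
      have admN: "admissible n ?CN h DN uN"
        unfolding admissible_def
      proof (intro conjI ballI impI)
        show "finite ?CN" "finite DN" using fin by (auto simp: DN_def)
      next
        fix c' assume c': "c' \<in> ?CN"
        note b' = bd[of c']
        show "h c' < c'" "c' + h c' \<le> n" using b' c' by auto
        show "c' \<notin> DN" using b' c' unfolding DN_def by auto
        show "c' - 1 \<notin> DN" using b' c' H unfolding DN_def by auto
        assume "c' + 1 \<in> ?CN"
        then show "h c' \<le> h (c' + 1) + 1" "h (c' + 1) \<le> h c' + 1" using adj[of c'] c' by auto
      next
        fix d assume "d \<in> DN"
        then show "uN d \<le> d" "d + uN d \<le> n" using bdD H bc unfolding DN_def uN_def by auto
      qed
      have admJ: "admissible n C hJ D u"
        unfolding admissible_def
      proof (intro conjI ballI impI)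
        fix c' assume c': "c' \<in> C"
        show "hJ c' < c'" "c' + hJ c' \<le> n" "c' \<notin> D" "c' - 1 \<notin> D"
          using bd[OF c'] H by (auto simp: hJ_def)
        assume c1: "c' + 1 \<in> C"
        show "hJ c' \<le> hJ (c' + 1) + 1" "hJ (c' + 1) \<le> hJ c' + 1"
          using adj[OF c' c1] hmax[OF c'] hmax[OF c1] H unfolding hJ_def H_def by auto
      qed (use fin bdD in auto)
      have N: "pf_family n ?N" and J: "pf_family n ?J"
        by (rule pf_family_ladder_sets[OF admN], rule pf_family_ladder_sets[OF admJ])
      note cN = pf_family_carrier[OF N, where ?'a = 'k]
      note cJ = pf_family_carrier[OF J, where ?'a = 'k]
      have sumC: "(\<Sum>c\<in>C. Suc (k c)) = Suc (k c) + (\<Sum>c\<in>?CN. Suc (k c))" for k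
        using fin c by (simp add: sum.remove)
      have "(\<Sum>c\<in>?CN. Suc (h c)) < (\<Sum>c\<in>C. Suc (h c))" unfolding sumC[of h] by simp
      then have GN: "pf_groebner TYPE('k) n ?N" using less.hyps admN by blast
      have "(\<Sum>c\<in>?CN. Suc (hJ c)) = (\<Sum>c\<in>?CN. Suc (h c))" by (intro sum.cong) (auto simp: hJ_def)
      then have "(\<Sum>c\<in>C. Suc (hJ c)) < (\<Sum>c\<in>C. Suc (h c))"
        unfolding sumC[of h] sumC[of hJ] using H by (simp add: hJ_def H_def)
      then have GJ: "pf_groebner TYPE('k) n ?J" using less.hyps admJ by blast
      have memJ: "win c (H - 1) - {i} \<in> ?J" if "i \<in> win c (H - 1)" for i
        using that c(1) by (auto simp: ladder_sets_def hJ_def)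
      have memF: "win c H - {i} \<in> ?F" if "i \<in> win c H" for i
        using that c(1) by (auto simp: ladder_sets_def H_def)
      have ends: "pairwin c H = win c H - {c - H}" "pairwin (c - 1) H = win c H - {c + H}"
        using win_minus_left[of H c] win_minus_right[of H c] H by auto
      have endsF: "pairwin c H \<in> ?F" "pairwin (c - 1) H \<in> ?F"
        unfolding ends by (rule memF, simp add: win_def)+
      have memN: "S \<in> ladder_sets ?CN h D u \<or> (S = pairwin c H \<or> S = pairwin (c - 1) H)" if SN: "S \<in> ?N" for S
      proof -
        consider "S \<in> ladder_sets ?CN h {} uN" | d where "d \<in> DN" "S = pairwin d (uN d)"
          using SN unfolding ladder_sets_def by blast
        then show ?thesis
        proof cases
          case 1 then show ?thesis by (auto simp: ladder_sets_def)
        next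
          case (2 d)
          then consider "d = c" | "d = c - 1" | "d \<in> D" "d \<noteq> c" "d \<noteq> c - 1" unfolding DN_def by blast
          then show ?thesis using 2(2) H unfolding uN_def by cases (auto simp: ladder_sets_def)
        qed
      qed
      have NF: "ladder_sets ?CN h D u \<subseteq> ?F" "ladder_sets ?CN h D u \<subseteq> ?J"
        by (auto simp: ladder_sets_def hJ_def)
      have pairJ1: "pf (pairwin c H) \<in> skew_Idl n (pf ` ?J :: 'k skew_poly set)"
        by (rule pf_pairwin_in_Idl[OF J _ _ _ memJ]) (use H in auto)
      have pairJ2: "pf (pairwin (c - 1) H) \<in> skew_Idl n (pf ` ?J :: 'k skew_poly set)"
        by (rule pf_pairwin_in_Idl'[OF J _ _ _ memJ]) (use H in auto)
      have NJ: "p \<in> skew_Idl n (pf ` ?J)" if "p \<in> skew_Idl n (pf ` ?N)" for p :: "'k skew_poly"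
        using that
      proof (induction rule: skew_Idl_induct[OF cN, consumes 1, case_names zero gen add times])
        case (gen g)
        then obtain S where "S \<in> ?N" "g = pf S" by blast
        then show ?case using memN[of S] NF(2) pairJ1 pairJ2 skew_Idl_gen[OF cJ] by blast
      qed (use skew_Idl_zero[OF cJ] skew_Idl_add[OF cJ] skew_Idl_times[OF cJ] in auto)
      \<comment> \<open>Either the end pfaffian was added through \<open>DN\<close>, or it is a
        generator of the neighbour c + 1 of height H (without its right end), or it expands into
        generators of the neighbour of height H - 1. Admissibility and maximality exclude other
        heights.\<close>
      have pairN1: "pf (pairwin c H) \<in> skew_Idl n (pf ` ?N :: 'k skew_poly set)"
      proof (cases "c + 1 \<in> C")
        case False
        then have "c \<in> DN" "uN c = H" using H by (auto simp: DN_def uN_def)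
        then have "pairwin c H \<in> ?N" unfolding ladder_sets_def by (intro UnI2 image_eqI[of _ _ c]) simp_all
        then show ?thesis using skew_Idl_gen[OF cN] by blast
      next
        case True
        then have mem: "win (c + 1) (h (c + 1)) - {i} \<in> ?N" if i: "i \<in> win (c + 1) (h (c + 1))" for i
        proof -
          have "c + 1 \<in> ?CN" using True by simp
          then show ?thesis using i unfolding ladder_sets_def by blast
        qed
        have "h (c + 1) = H \<or> h (c + 1) = H - 1" using adj[OF c(1) True] hmax[OF True] unfolding H_def by auto
        then show ?thesis
        proof
          assume hH: "h (c + 1) = H"
          have "pairwin c H = win (c + 1) H - {c + 1 + H}" using win_minus_right[of H "c + 1"] H by simp
          then have "pairwin c H \<in> ?N" using mem[of "c + 1 + H"] hH by (simp add: win_def)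
          then show ?thesis using skew_Idl_gen[OF cN] by blast
        next
          assume hH: "h (c + 1) = H - 1"
          have "pf (pairwin (c + 1 - 1) H) \<in> skew_Idl n (pf ` ?N :: 'k skew_poly set)"
            by (rule pf_pairwin_in_Idl'[OF N]) (use mem hH H in simp_all)
          then show ?thesis by simp
        qed
      qed
      have pairN2: "pf (pairwin (c - 1) H) \<in> skew_Idl n (pf ` ?N :: 'k skew_poly set)"
      proof (cases "c - 1 \<in> C")
        case False
        then have "c - 1 \<in> DN" "uN (c - 1) = H" using H by (auto simp: DN_def uN_def)
        then have "pairwin (c - 1) H \<in> ?N" unfolding ladder_sets_def by (intro UnI2 image_eqI[of _ _ "c - 1"]) simp_all
        then show ?thesis using skew_Idl_gen[OF cN] by blast
      next
        case True
        then have mem: "win (c - 1) (h (c - 1)) - {i} \<in> ?N" if i: "i \<in> win (c - 1) (h (c - 1))" for i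
        proof -
          have "c - 1 \<in> ?CN" using True H by simp
          then show ?thesis using i unfolding ladder_sets_def by blast
        qed
        have "c - 1 + 1 = c" using H by simp
        then have "h (c - 1) = H \<or> h (c - 1) = H - 1" using adj[OF True] c(1) hmax[OF True] unfolding H_def by auto
        then show ?thesis
        proof
          assume hH: "h (c - 1) = H"
          then have "H < c - 1" using bd[OF True] by simp
          then have "pairwin (c - 1) H = win (c - 1) H - {c - 1 - H}" using win_minus_left[of H "c - 1"] by simp
          then have "pairwin (c - 1) H \<in> ?N" using mem[of "c - 1 - H"] hH by (simp add: win_def)
          then show ?thesis using skew_Idl_gen[OF cN] by blast
        next
          assume hH: "h (c - 1) = H - 1"
          show ?thesis by (rule pf_pairwin_in_Idl[OF N]) (use mem hH H in simp_all)
        qed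
      qed
      let ?f = "pf (win c (H - 1) - {c}) :: 'k skew_poly" and ?g = "pf (win c H - {c}) :: 'k skew_poly"
      have cw: "c \<in> win c H" "c \<in> win c (H - 1)" by (auto simp: win_def)
      have even: "even (card (win c (H - 1) - {c}))" "even (card (win c H - {c}))"
        using H cw card_win_remove[of H c c] card_win_remove[of "H - 1" c c] by auto
      have fin_w: "finite (win c (H - 1) - {c})" "finite (win c H - {c})" by auto
      note lf = lm_pf[OF fin_w(1) even(1), where ?'k = 'k] and lg = lm_pf[OF fin_w(2) even(2), where ?'k = 'k]
      \<comment> \<open>The leading monomials of f and g live on a + b = 2c. Windows with center c'
        \<noteq> c have index sums within 1 of 2c', and those of a \<open>pairwin\<close> are
        odd.\<close>
      have reg: "A \<inter> mkeys (anti_mon S) = {}" if A: "A \<subseteq> {(a, b). a + b = 2 * c}" and S: "S \<in> ?N" for A S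
      proof -
        consider c' i where "c' \<in> ?CN" "i \<in> win c' (h c')" "S = win c' (h c') - {i}" | d where "d \<in> DN" "S = pairwin d (uN d)"
          using S unfolding ladder_sets_def by blast
        then show ?thesis
        proof cases
          case (1 c' i)
          have "mkeys (anti_mon S) \<subseteq> {(a, b). 2 * c' - 1 \<le> a + b \<and> a + b \<le> 2 * c' + 1}"
            unfolding 1 by (rule keys_anti_mon_win) (use 1 bd in auto)
          then show ?thesis
          proof (rule keys_subset_disjoint[OF A])
            fix s assume "s = 2 * c" "2 * c' - 1 \<le> s \<and> s \<le> 2 * c' + 1"
            then have "c' = c" by linarith
            then show False using 1 by blast
          qed
        next
          case (2 d)
          have "mkeys (anti_mon S) \<subseteq> {(a, b). a + b = 2 * d + 1}"
            unfolding 2 by (rule keys_anti_mon_pairwin) (use admN 2 in \<open>auto simp: admissible_def\<close>)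
          then show ?thesis by (rule keys_subset_disjoint[OF A]) presburger
        qed
      qed
      show ?thesis
      \<comment> \<open>x is the variable of the two end points, the quotient of the leading
        monomials of g and f.\<close>
      proof (rule pf_groebner_link[OF F N GN, where J = "skew_Idl n (pf ` ?J)" and f = ?f and g = ?g and x = "msingle (c - H, c + H) 1"])
        show "\<And>p. p \<in> skew_Idl n (pf ` ?J) \<Longrightarrow> p \<in> carrier (skew_ring n :: 'k skew_poly ring)"
          by (rule skew_Idl_carrier[OF cJ])
        show "\<And>q \<nu>. q \<in> skew_Idl n (pf ` ?J) \<Longrightarrow> \<nu> \<in> skew_Idl n (pf ` ?N) \<Longrightarrow> q - \<nu> \<in> skew_Idl n (pf ` ?J :: 'k skew_poly set)"
          by (rule skew_Idl_minus[OF cJ _ NJ])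
        show "0 \<in> skew_Idl n (pf ` ?J :: 'k skew_poly set)" by (rule skew_Idl_zero[OF cJ])
        show "\<And>q q'. q \<in> skew_Idl n (pf ` ?J) \<Longrightarrow> q' \<in> skew_Idl n (pf ` ?J) \<Longrightarrow> q + q' \<in> skew_Idl n (pf ` ?J :: 'k skew_poly set)"
          by (rule skew_Idl_add[OF cJ])
        show "\<And>r q. r \<in> carrier (skew_ring n) \<Longrightarrow> q \<in> skew_Idl n (pf ` ?J) \<Longrightarrow> r * q \<in> skew_Idl n (pf ` ?J :: 'k skew_poly set)"
          by (rule skew_Idl_times[OF cJ])
        have "win c (H - 1) - {c} \<subseteq> {1..n}" "win c H - {c} \<subseteq> {1..n}" using H by (auto simp: win_def)
        then show "?f \<in> carrier (skew_ring n)" "?g \<in> carrier (skew_ring n)"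
          using pf_carrier fin_w even by blast+
        show "?f \<noteq> 0" "?g \<noteq> 0" using lf lg by auto
        show "lm ?g = msingle (c - H, c + H) 1 + lm ?f"
          using lf lg anti_mon_win[of H c c] H cw by simp
        show "mkeys (lm ?f) \<inter> mkeys (anti_mon S) = {}" if "S \<in> ?N" for S
          using lf reg[OF _ that] keys_anti_mon_win_center[of "H - 1" c] H by simp
        show "mkeys (lm ?g) \<inter> mkeys (anti_mon S) = {}" if "S \<in> ?N" for S
          using lg reg[OF _ that] keys_anti_mon_win_center[of H c] H by simp
        show "monomial_span ?N \<subseteq> monomial_span ?F"
          by (rule monomial_span_mono) (use memN NF(1) endsF in blast)
        show "\<exists>q\<in>skew_Idl n (pf ` ?J). \<exists>\<nu>\<in>skew_Idl n (pf ` ?N). ?f * pf S = ?g * q + \<nu>" if S: "S \<in> ?F" for S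
        proof -
          \<comment> \<open>Generators lying in the ideal of N are covered by q = 0.\<close>
          have in_N: ?thesis if "pf S \<in> skew_Idl n (pf ` ?N :: 'k skew_poly set)"
            using skew_Idl_times[OF cN \<open>?f \<in> carrier (skew_ring n)\<close> that] skew_Idl_zero[OF cJ]
            by (intro bexI[of _ 0] bexI[of _ "?f * pf S"]) auto
          consider i where "i \<in> win c H" "S = win c H - {i}" | "S \<in> ladder_sets ?CN h D u"
            using S unfolding ladder_sets_def H_def by blast
          then show ?thesis
          proof cases
            case 2
            \<comment> \<open>\<open>uN\<close> overwrites u at c and c - 1 only, and admissibility
              keeps both out of D.\<close>
            then have "S \<in> ?N \<or> S \<in> (\<lambda>d. pairwin d (u d)) ` (D \<inter> {c, c - 1})"
              unfolding ladder_sets_def DN_def uN_def by (auto simp: image_iff)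
            then have "S \<in> ?N" using bc by auto
            then show ?thesis using in_N skew_Idl_gen[OF cN] by blast
          next
            case (1 i)
            then consider "i = c - H" | "i = c + H" | "i \<in> win c (H - 1)" using H by (force simp: win_def)
            then show ?thesis
            proof cases
              case 3
              obtain s \<alpha> \<beta> where s: "s \<in> {1, - 1}" and ab: "\<alpha> \<in> carrier (skew_ring n)" "\<beta> \<in> carrier (skew_ring n)"
                and eq: "?f * pf (win c H - {i}) = ?g * (s * pf (win c (H - 1) - {i})) + (\<alpha> * pf (pairwin c H) + \<beta> * pf (pairwin (c - 1) H))"
                using pf_win_exchange[OF H 3, where ?'k = 'k] by blast
              have "s \<in> carrier (skew_ring n)" using s by (auto simp: skew_carrier_uminus skew_carrier_one)
              then have "s * pf (win c (H - 1) - {i}) \<in> skew_Idl n (pf ` ?J)"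
                by (intro skew_Idl_times[OF cJ] skew_Idl_gen[OF cJ] imageI memJ 3)
              moreover have "\<alpha> * pf (pairwin c H) + \<beta> * pf (pairwin (c - 1) H) \<in> skew_Idl n (pf ` ?N)"
                by (intro skew_Idl_add[OF cN] skew_Idl_times[OF cN] ab pairN1 pairN2)
              ultimately show ?thesis using eq 1(2) by blast
            qed (use in_N 1 ends pairN1 pairN2 in auto)
          qed
        qed
        \<comment> \<open>For generators of J at c, multiplication by x turns the leading monomial
          of \<open>win c (H - 1) - {i}\<close> into that of \<open>win c H - {i}\<close>; the other
          generators of J belong to I as well.\<close>
        show "msingle (c - H, c + H) 1 + lm q \<in> monomial_span ?F" if q: "q \<in> skew_Idl n (pf ` ?J)" "q \<noteq> (0 :: 'k skew_poly)" for q
        proof -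
          have "lm q \<in> monomial_span ?J" using GJ q unfolding pf_groebner_def by blast
          then obtain S m where S: "S \<in> ?J" "lm q = anti_mon S + m" unfolding monomial_span_def by blast
          consider i where "i \<in> win c (H - 1)" "S = win c (H - 1) - {i}" | "S \<in> ladder_sets ?CN h D u"
            using S(1) unfolding ladder_sets_def hJ_def by (auto split: if_splits)
          then show ?thesis
          proof cases
            case (1 i)
            then have "anti_mon (win c H - {i}) = msingle (c - H, c + H) 1 + anti_mon S" using anti_mon_win[of H c i] H by simp
            then have "msingle (c - H, c + H) 1 + lm q = anti_mon (win c H - {i}) + m" unfolding S(2) by (simp add: add.assoc)
            moreover have "win c H - {i} \<in> ?F" using 1(1) H by (intro memF) (auto simp: win_def)
            ultimately show ?thesis unfolding monomial_span_def by blast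
          next
            case 2
            then have "lm q \<in> monomial_span ?F" using NF(1) S(2) unfolding monomial_span_def by blast
            then show ?thesis by (rule monomial_span_add)
          qed
        qed
      qed
    qed
  qed
qed

section \<open>Hilbert functions and standard monomials\<close>

definition std_monomials :: "nat \<Rightarrow> nat set set \<Rightarrow> nat \<Rightarrow> skew_mon set" where
  "std_monomials n F d = {m. mkeys m \<subseteq> skew_vars n \<and> total_degree m = d \<and> m \<notin> monomial_span F}"

lemma homogeneous_partD:
  assumes "p \<in> homogeneous_part n d" "m \<in> mkeys p"
  shows "mkeys m \<subseteq> skew_vars n" "total_degree m = d"
  using assms by (auto simp: homogeneous_part_def carrier_skew_ring)

lemma homogeneous_partI:
  assumes "\<And>m. m \<in> mkeys p \<Longrightarrow> mkeys m \<subseteq> skew_vars n \<and> total_degree m = d"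
  shows "p \<in> homogeneous_part n d"
  using assms by (simp add: homogeneous_part_def carrier_skew_ring)

text \<open>Division with remainder in degree d: the head is cancelled by an element of the ideal of
  the same degree or, if it is standard, moved to the remainder. It shows that standard monomials
  span.\<close>

lemma standard_form:
  fixes p :: "'k::field skew_poly"
  assumes F: "pf_family n F" and p: "p \<in> homogeneous_part n d"
  shows "\<exists>r\<in>skew_Idl n (pf ` F). mkeys (p - r) \<subseteq> std_monomials n F d"
  using p
proof (induction "mon_mset (lm p)" arbitrary: p rule: less_induct)
  case less
  note cF = pf_family_carrier[OF F, where ?'a = 'k]
  show ?case
  proof (cases "p = 0")
    case True
    then show ?thesis using skew_Idl_zero[OF cF] by (intro bexI[of _ 0]) auto
  next
    case False
    let ?c = "mlookup p (lm p)"
    have lp: "mkeys (lm p) \<subseteq> skew_vars n" "total_degree (lm p) = d"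
      using homogeneous_partD[OF less.prems lm_in_keys[OF False]] by auto
    show ?thesis
    proof (cases "lm p \<in> monomial_span F")
      case True
      obtain g where g: "g \<in> skew_Idl n (pf ` F)" "g \<noteq> (0::'k skew_poly)" "lm g = lm p"
        "\<forall>m'\<in>mkeys g. total_degree m' = total_degree (lm p)"
        using monomial_span_lm[OF F True lp(1), where ?'k = 'k] by blast
      define a where "a = ?c / mlookup g (lm g)"
      have ag: "skew_const a * g \<in> skew_Idl n (pf ` F)"
        by (rule skew_Idl_times[OF cF skew_carrier_const g(1)])
      have kg: "mkeys m \<subseteq> skew_vars n" if "m \<in> mkeys g" for m
        using skew_Idl_carrier[OF cF g(1)] that by (simp add: carrier_skew_ring)
      let ?q = "p - skew_const a * g"
      have q: "?q \<in> homogeneous_part n d"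
      proof (rule homogeneous_partI)
        fix m assume "m \<in> mkeys ?q"
        then have "m \<in> mkeys p \<or> m \<in> mkeys g" by (auto simp: in_keys_iff lookup_minus)
        then show "mkeys m \<subseteq> skew_vars n \<and> total_degree m = d"
          using homogeneous_partD[OF less.prems] kg g(4) lp(2) by auto
      qed
      have "\<exists>r\<in>skew_Idl n (pf ` F). mkeys (?q - r) \<subseteq> std_monomials n F d"
      proof (cases "?q = 0")
        case True
        then show ?thesis using skew_Idl_zero[OF cF] by (intro bexI[of _ 0]) auto
      next
        case q0: False
        show ?thesis
          by (rule less.hyps[OF lm_cancel[OF False g(2) g(3)[symmetric] a_def refl q0] q])
      qed
      then obtain r where r: "r \<in> skew_Idl n (pf ` F)" "mkeys (?q - r) \<subseteq> std_monomials n F d" by blast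
      then show ?thesis using skew_Idl_add[OF cF ag r(1)]
        by (intro bexI[of _ "skew_const a * g + r"]) (auto simp: diff_diff_add)
    next
      case nT: False
      let ?s = "msingle (lm p) ?c" let ?q = "p - ?s"
      have lpq: "lm p \<notin> mkeys ?q" by (simp add: in_keys_iff lookup_minus)
      have kq: "m \<in> mkeys p" if "m \<in> mkeys ?q" for m
        using that lm_in_keys[OF False] by (cases "m = lm p") (auto simp: in_keys_iff lookup_minus lookup_single)
      have q: "?q \<in> homogeneous_part n d"
        using homogeneous_partD[OF less.prems] kq by (intro homogeneous_partI) blast
      have std: "lm p \<in> std_monomials n F d" using lp nT by (simp add: std_monomials_def)
      have "\<exists>r\<in>skew_Idl n (pf ` F). mkeys (?q - r) \<subseteq> std_monomials n F d"
      proof (cases "?q = 0")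
        case True
        then show ?thesis using skew_Idl_zero[OF cF] by (intro bexI[of _ 0]) auto
      next
        case q0: False
        have "lm ?q \<in> mkeys ?q" by (rule lm_in_keys[OF q0])
        then have "mon_mset (lm ?q) < mon_mset (lm p)" using lpq kq lm_less by metis
        from less.hyps[OF this q] show ?thesis .
      qed
      then obtain r where r: "r \<in> skew_Idl n (pf ` F)" "mkeys (?q - r) \<subseteq> std_monomials n F d" by blast
      have "mkeys (p - r) \<subseteq> insert (lm p) (mkeys (?q - r))"
        by (auto simp: in_keys_iff lookup_minus lookup_single when_def split: if_splits)
      then show ?thesis using r std by blast
    qed
  qed
qed

lemma finite_skew_vars [simp]: "finite (skew_vars n)"
  by (rule finite_subset[of _ "{1..n} \<times> {1..n}"]) (auto simp: skew_vars_def)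

lemma finite_monomials_degree:
  assumes "finite V"
  shows "finite {m. mkeys m \<subseteq> V \<and> total_degree m = d}"
proof -
  let ?f = "\<lambda>m :: skew_mon. mon_mset m"
  have "?f ` {m. mkeys m \<subseteq> V \<and> total_degree m = d} \<subseteq> {A. set_mset A \<subseteq> var_rank ` V \<and> size A = d}"
  proof (rule image_subsetI)
    fix m assume "m \<in> {m :: skew_mon. mkeys m \<subseteq> V \<and> total_degree m = d}"
    then have m: "mkeys m \<subseteq> V" "total_degree m = d" by auto
    have "x \<in> var_rank ` V" if "x \<in># mon_mset m" for x
    proof -
      have "count (mon_mset m) x \<noteq> 0" using that by simp
      then have "x \<in> range var_rank" using count_mon_mset_outside[of x m] by argo
      then obtain v where v: "x = var_rank v" by (rule rangeE)
      then have "v \<in> mkeys m" using that by (simp add: in_keys_iff count_mon_mset[symmetric])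
      then show ?thesis using m v by blast
    qed
    then show "mon_mset m \<in> {A. set_mset A \<subseteq> var_rank ` V \<and> size A = d}"
      using m(2) by (auto simp: size_mon_mset)
  qed
  moreover have "finite {A. set_mset A \<subseteq> var_rank ` V \<and> size A = d}"
  proof (rule finite_subset)
    show "{A. set_mset A \<subseteq> var_rank ` V \<and> size A = d} \<subseteq> mset ` {xs. set xs \<subseteq> var_rank ` V \<and> length xs = d}"
    proof
      fix A assume A: "A \<in> {A. set_mset A \<subseteq> var_rank ` V \<and> size A = d}"
      obtain xs where "mset xs = A" using ex_mset by blast
      then show "A \<in> mset ` {xs. set xs \<subseteq> var_rank ` V \<and> length xs = d}"
        using A by (intro image_eqI[of _ _ xs]) auto
    qed
  qed (use assms in \<open>simp add: finite_lists_length_eq\<close>)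
  ultimately have "finite (?f ` {m. mkeys m \<subseteq> V \<and> total_degree m = d})" by (rule finite_subset)
  then show ?thesis by (rule finite_imageD) (simp add: inj_on_def)
qed

lemma finite_std_monomials [simp]: "finite (std_monomials n F d)"
  by (rule finite_subset[OF _ finite_monomials_degree[OF finite_skew_vars, of n d]])
     (auto simp: std_monomials_def)

lemma skew_const_plus: "skew_const (a + b) = skew_const a + skew_const b"
  by (simp add: skew_const_def single_add)

lemma skew_const_mult: "skew_const (a * b) = skew_const a * skew_const b"
  by (simp add: skew_const_def mult_single)

lemma skew_const_0_1 [simp]: "skew_const 0 = 0" "skew_const 1 = 1"
  by (simp_all add: skew_const_def)

lemma skew_const_uminus: "skew_const (- a) = - skew_const a"
  by (simp add: skew_const_def single_uminus)

lemma subfield_skew_const: "subfield (range skew_const) (skew_ring n :: 'k::field skew_poly ring)"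
proof -
  let ?R = "skew_ring n :: 'k skew_poly ring"
  let ?K = "?R\<lparr>carrier := range skew_const\<rparr>"
  have fld: "field ?K"
  proof (rule cring.cring_fieldI2)
    show "cring ?K"
    proof (rule cringI)
      show "abelian_group ?K"
      proof (rule abelian_groupI)
        fix x assume "x \<in> carrier ?K"
        then obtain a where x: "x = skew_const a" by auto
        show "\<exists>y\<in>carrier ?K. y \<oplus>\<^bsub>?K\<^esub> x = \<zero>\<^bsub>?K\<^esub>"
        proof (rule bexI)
          show "skew_const (- a) \<oplus>\<^bsub>?K\<^esub> x = \<zero>\<^bsub>?K\<^esub>" by (simp add: x skew_const_uminus)
        qed simp
      qed (auto simp: algebra_simps simp flip: skew_const_plus intro: rangeI[of skew_const 0, simplified])
      show "comm_monoid ?K"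
        by (rule comm_monoidI)
           (auto simp: algebra_simps simp flip: skew_const_mult intro: rangeI[of skew_const 1, simplified])
    qed (auto simp: algebra_simps)
    show "\<zero>\<^bsub>?K\<^esub> \<noteq> \<one>\<^bsub>?K\<^esub>" by simp
    fix x assume x: "x \<in> carrier ?K" "x \<noteq> \<zero>\<^bsub>?K\<^esub>"
    then obtain a where a: "x = skew_const a" by auto
    then have "a \<noteq> 0" using x(2) by auto
    then show "\<exists>y\<in>carrier ?K. x \<otimes>\<^bsub>?K\<^esub> y = \<one>\<^bsub>?K\<^esub>"
      by (intro bexI[of _ "skew_const (inverse a)"]) (auto simp: a simp flip: skew_const_mult)
  qed
  show ?thesis
    by (rule ring.subfield_iff(1)[OF skew_ring_ring fld]) (auto simp: skew_carrier_const)
qed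

lemma monomial_span_zero_iff: "0 \<in> monomial_span F \<longleftrightarrow> (\<exists>S\<in>F. anti_mon S = 0)"
proof
  assume "0 \<in> monomial_span F"
  then obtain S m where S: "S \<in> F" "anti_mon S + m = 0" by (auto simp: monomial_span_def)
  then have "mon_mset (anti_mon S) + mon_mset m = mon_mset 0" by (metis mon_mset_plus)
  then have "mon_mset (anti_mon S) = mon_mset 0" by simp
  then show "\<exists>S\<in>F. anti_mon S = 0" using S(1) by (auto simp del: mon_mset_zero)
qed (auto simp: monomial_span_def intro!: exI[of _ 0])

text \<open>Macaulay's basis theorem: standard monomials span each graded piece by
  \<open>standard_form\<close>, and a linear relation among them would be an element of I with a
  standard leading monomial.\<close>

theorem hilbert_function_eq_card_std:
  fixes F :: "nat set set"
  assumes F: "pf_family n F" and G: "pf_groebner TYPE('k::field) n F" and ne: "0 \<notin> monomial_span F"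
  shows "hilbert_function n (skew_Idl n (pf ` F) :: 'k skew_poly set) d = card (std_monomials n F d)"
proof -
  let ?R = "skew_ring n :: 'k skew_poly ring"
  define I where "I = (skew_Idl n (pf ` F) :: 'k skew_poly set)"
  note cF = pf_family_carrier[OF F, where ?'a = 'k]
  interpret I: ideal I ?R unfolding I_def by (rule skew_Idl_ideal[OF cF])
  let ?Q = "?R Quot I"
  define \<pi> where "\<pi> p = I +>\<^bsub>?R\<^esub> p" for p
  interpret Q: ring ?Q by (rule I.quotient_is_ring)
  interpret hom: ring_hom_ring ?R ?Q \<pi>
    using I.rcos_ring_hom_ring unfolding \<pi>_def[abs_def] .
  have \<pi>_add: "\<pi> p \<oplus>\<^bsub>?Q\<^esub> \<pi> q = \<pi> (p + q)" and \<pi>_mult: "\<pi> p \<otimes>\<^bsub>?Q\<^esub> \<pi> q = \<pi> (p * q)"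
    if "p \<in> carrier ?R" "q \<in> carrier ?R" for p q
    using that hom.hom_add[of p q] hom.hom_mult[of p q] by simp_all
  have minus: "p \<ominus>\<^bsub>?R\<^esub> q = p - q" if "p \<in> carrier ?R" "q \<in> carrier ?R" for p q
  proof -
    have "\<ominus>\<^bsub>?R\<^esub> q = - q"
      using that by (intro I.minus_equality) (auto simp: skew_carrier_uminus)
    then show ?thesis by (simp add: a_minus_def)
  qed
  have \<pi>_eq: "\<pi> p = \<pi> q \<longleftrightarrow> p - q \<in> I" if "p \<in> carrier ?R" "q \<in> carrier ?R" for p q
    using I.quotient_eq_iff_same_a_r_cos[OF I.is_ideal that] minus[OF that] unfolding \<pi>_def by simp
  have lmI: "lm p \<in> monomial_span F" if "p \<in> I" "p \<noteq> 0" for p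
    using G that unfolding pf_groebner_def I_def by blast
  define K where "K = range (\<lambda>c. \<pi> (skew_const c))"
  \<comment> \<open>I is proper, so the constants embed into the quotient as a subfield, over which
    \<open>dim\<close> can be computed.\<close>
  have "1 \<notin> I" using lmI[of 1] ne by auto
  then have "\<one>\<^bsub>?Q\<^esub> \<noteq> \<zero>\<^bsub>?Q\<^esub>"
    using \<pi>_eq[of 1 0] hom.hom_one hom.hom_zero by (simp add: skew_carrier_one skew_carrier_zero)
  then have "subfield (\<pi> ` range skew_const) ?Q"
    using hom.img_is_subfield(2)[OF subfield_skew_const] by blast
  then have K: "subfield K ?Q" by (simp add: K_def image_image)
  let ?b = "\<lambda>m. \<pi> (msingle m 1)"
  have carr: "p \<in> carrier ?R" if "mkeys p \<subseteq> set ms" "\<And>m. m \<in> set ms \<Longrightarrow> mkeys m \<subseteq> skew_vars n" for p ms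
    using that by (auto simp: carrier_skew_ring)
  \<comment> \<open>\<open>Span\<close> is built by adjoining one line at a time, so the induction
    follows the list.\<close>
  have Span: "Q.Span K (map ?b ms) = \<pi> ` {p. mkeys p \<subseteq> set ms}"
    if "\<And>m. m \<in> set ms \<Longrightarrow> mkeys m \<subseteq> skew_vars n" for ms
    using that
  proof (induction ms)
    case Nil
    then show ?case using hom.hom_zero by simp
  next
    case (Cons m ms)
    have mc: "(msingle m 1 :: 'k skew_poly) \<in> carrier ?R" using Cons.prems by (intro skew_carrier_single) simp
    have comb: "\<pi> (skew_const c) \<otimes>\<^bsub>?Q\<^esub> ?b m \<oplus>\<^bsub>?Q\<^esub> \<pi> p = \<pi> (msingle m c + p)"
      if "mkeys p \<subseteq> set ms" for c p
    proof -
      have "p \<in> carrier ?R" using that Cons.prems by (intro carr) auto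
      moreover have "skew_const c * msingle m 1 = (msingle m c :: 'k skew_poly)"
        by (simp add: skew_const_def mult_single)
      ultimately show ?thesis using mc skew_carrier_const[of c n]
        by (simp add: \<pi>_mult \<pi>_add skew_carrier_times flip: \<open>_ = msingle m c\<close>)
    qed
    have IH: "Q.Span K (map ?b ms) = \<pi> ` {p. mkeys p \<subseteq> set ms}" using Cons by simp
    have X1: "x \<in> Q.Span K (map ?b (m # ms)) \<longleftrightarrow> (\<exists>c p. mkeys p \<subseteq> set ms \<and> x = \<pi> (msingle m c + p))" for x
    proof -
      have "Q.Span K (map ?b (m # ms)) = Q.line_extension K (?b m) (Q.Span K (map ?b ms))" by simp
      then have "x \<in> Q.Span K (map ?b (m # ms)) \<longleftrightarrow>
          (\<exists>k\<in>K. \<exists>v\<in>\<pi> ` {p. mkeys p \<subseteq> set ms}. x = k \<otimes>\<^bsub>?Q\<^esub> ?b m \<oplus>\<^bsub>?Q\<^esub> v)"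
        unfolding IH by (simp only: Q.line_extension_mem_iff)
      also have "\<dots> \<longleftrightarrow> (\<exists>c p. mkeys p \<subseteq> set ms \<and> x = \<pi> (msingle m c + p))"
      proof
        assume "\<exists>k\<in>K. \<exists>v\<in>\<pi> ` {p. mkeys p \<subseteq> set ms}. x = k \<otimes>\<^bsub>?Q\<^esub> ?b m \<oplus>\<^bsub>?Q\<^esub> v"
        then obtain c p where "mkeys p \<subseteq> set ms" "x = \<pi> (skew_const c) \<otimes>\<^bsub>?Q\<^esub> ?b m \<oplus>\<^bsub>?Q\<^esub> \<pi> p"
          unfolding K_def by blast
        then show "\<exists>c p. mkeys p \<subseteq> set ms \<and> x = \<pi> (msingle m c + p)" using comb by metis
      next
        assume "\<exists>c p. mkeys p \<subseteq> set ms \<and> x = \<pi> (msingle m c + p)"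
        then obtain c p where cp: "mkeys p \<subseteq> set ms" "x = \<pi> (msingle m c + p)" by blast
        show "\<exists>k\<in>K. \<exists>v\<in>\<pi> ` {p. mkeys p \<subseteq> set ms}. x = k \<otimes>\<^bsub>?Q\<^esub> ?b m \<oplus>\<^bsub>?Q\<^esub> v"
          unfolding cp(2) comb[OF cp(1), symmetric] K_def using cp(1) by blast
      qed
      finally show ?thesis .
    qed
    have X2: "(\<exists>c p. mkeys p \<subseteq> set ms \<and> x = \<pi> (msingle m c + p)) \<longleftrightarrow> x \<in> \<pi> ` {p. mkeys p \<subseteq> set (m # ms)}" for x
    proof
      assume "\<exists>c p. mkeys p \<subseteq> set ms \<and> x = \<pi> (msingle m c + p)"
      then obtain c p where cp: "mkeys p \<subseteq> set ms" "x = \<pi> (msingle m c + p)" by blast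
      have "mkeys (msingle m c + p) \<subseteq> set (m # ms)"
        using keys_add[of "msingle m c" p] cp(1) by (auto split: if_splits)
      then show "x \<in> \<pi> ` {p. mkeys p \<subseteq> set (m # ms)}" using cp(2) by blast
    next
      assume "x \<in> \<pi> ` {p. mkeys p \<subseteq> set (m # ms)}"
      then obtain p where p: "mkeys p \<subseteq> set (m # ms)" "x = \<pi> p" by blast
      let ?q = "p - msingle m (mlookup p m)"
      have "mkeys ?q \<subseteq> set ms"
        using p(1) by (auto simp: in_keys_iff lookup_minus lookup_single when_def split: if_splits)
      then show "\<exists>c p. mkeys p \<subseteq> set ms \<and> x = \<pi> (msingle m c + p)"
        using p(2) by (intro exI[of _ "mlookup p m"] exI[of _ ?q]) simp
    qed
    show ?case by (rule Set.set_eqI, rule trans[OF X1 X2])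
  qed
  have indep: "Q.independent K (map ?b ms)" if "distinct ms" "set ms \<subseteq> std_monomials n F d" for ms
    using that
  proof (induction ms)
    case Nil
    then show ?case by simp
  next
    case (Cons m ms)
    have keys: "mkeys m' \<subseteq> skew_vars n" if "m' \<in> set (m # ms)" for m'
      using that Cons.prems by (auto simp: std_monomials_def)
    have mc: "(msingle m 1 :: 'k skew_poly) \<in> carrier ?R" using keys by (intro skew_carrier_single) simp
    have "?b m \<notin> Q.Span K (map ?b ms)"
    proof
      assume "?b m \<in> Q.Span K (map ?b ms)"
      then have "?b m \<in> \<pi> ` {p. mkeys p \<subseteq> set ms}" by (subst (asm) Span) (use keys in auto)
      then obtain p where p: "mkeys p \<subseteq> set ms" "?b m = \<pi> p" by blast
      have "p \<in> carrier ?R" using p(1) keys by (intro carr) auto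
      then have q: "msingle m 1 - p \<in> I" using \<pi>_eq[OF mc] p(2) by blast
      have "mlookup (msingle m 1 - p) m = 1"
        using p(1) Cons.prems(1) by (auto simp: lookup_minus in_keys_iff)
      then have nz: "msingle m 1 - p \<noteq> 0" by auto
      have "lm (msingle m 1 - p) \<in> mkeys (msingle m 1 - p)" by (rule lm_in_keys[OF nz])
      also have "\<dots> \<subseteq> set (m # ms)" using keys_minus_subset[of "msingle m 1" p] p(1) by (auto split: if_splits)
      finally have "lm (msingle m 1 - p) \<notin> monomial_span F"
        using Cons.prems(2) by (auto simp: std_monomials_def)
      then show False using lmI[OF q nz] by blast
    qed
    moreover have "?b m \<in> carrier ?Q" using mc by simp
    ultimately show ?case using Cons by (auto intro: Q.li_Cons)
  qed
  obtain ms where ms: "distinct ms" "set ms = std_monomials n F d"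
    using finite_distinct_list[OF finite_std_monomials] by blast
  have keys: "mkeys m \<subseteq> skew_vars n" if "m \<in> set ms" for m
    using that ms by (auto simp: std_monomials_def)
  have hom_carr: "homogeneous_part n d \<subseteq> carrier ?R" by (auto simp: homogeneous_part_def)
  have "\<pi> ` homogeneous_part n d = \<pi> ` {p. mkeys p \<subseteq> set ms}"
  proof (intro equalityI subsetI)
    fix x assume "x \<in> \<pi> ` homogeneous_part n d"
    then obtain p where p: "p \<in> homogeneous_part n d" "x = \<pi> p" by blast
    obtain r where r: "r \<in> I" "mkeys (p - r) \<subseteq> set ms"
      using standard_form[OF F p(1)] unfolding ms(2) I_def by blast
    have "p \<in> carrier ?R" "p - r \<in> carrier ?R" using p hom_carr carr[OF r(2) keys] by auto
    then have "\<pi> p = \<pi> (p - r)" using r(1) by (subst \<pi>_eq) auto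
    then show "x \<in> \<pi> ` {p. mkeys p \<subseteq> set ms}" using r(2) p(2) by blast
  next
    fix x assume "x \<in> \<pi> ` {p. mkeys p \<subseteq> set ms}"
    then obtain p where p: "mkeys p \<subseteq> set ms" "x = \<pi> p" by blast
    have "p \<in> homogeneous_part n d"
      by (rule homogeneous_partI) (use p(1) ms(2) in \<open>auto simp: std_monomials_def\<close>)
    then show "x \<in> \<pi> ` homogeneous_part n d" using p(2) by blast
  qed
  also have "\<dots> = Q.Span K (map ?b ms)" using Span[of ms] keys by simp
  finally have "Q.dimension (length (map ?b ms)) K (\<pi> ` homogeneous_part n d)"
    using Q.dimension_independent[OF indep[of ms]] ms by simp
  then have "Q.dim K (\<pi> ` homogeneous_part n d) = length ms"
    using Q.dimI[OF K] unfolding over_def by simp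
  moreover have "length ms = card (std_monomials n F d)" using ms distinct_card by metis
  ultimately show ?thesis
    unfolding hilbert_function_def I_def[symmetric] K_def \<pi>_def by simp
qed

section \<open>Multiplicities of squarefree initial ideals\<close>

text \<open>The Stanley-Reisner complex of the squarefree monomial ideal generated by \<G>: its
  faces are the supports of the monomials outside this ideal.\<close>

definition faces :: "'a set \<Rightarrow> 'a set set \<Rightarrow> 'a set set" where
  "faces V \<G> = {A. A \<subseteq> V \<and> (\<forall>g\<in>\<G>. \<not> g \<subseteq> A)}"

text \<open>The dimension of the complex plus 1, i.e. the Krull dimension of the quotient. If {}
  \<in> \<G>, there is no face and \<open>Max\<close> is unspecified; hence the hypotheses on {}
  below.\<close>

definition max_face_size :: "'a set \<Rightarrow> 'a set set \<Rightarrow> nat" where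
  "max_face_size V \<G> = Max (card ` faces V \<G>)"

definition max_face_count :: "'a set \<Rightarrow> 'a set set \<Rightarrow> nat" where
  "max_face_count V \<G> = card {A \<in> faces V \<G>. card A = max_face_size V \<G>}"

lemma finite_faces: "finite V \<Longrightarrow> finite (faces V \<G>)"
  by (rule finite_subset[of _ "Pow V"]) (auto simp: faces_def)

lemma faces_finite_face: "finite V \<Longrightarrow> A \<in> faces V \<G> \<Longrightarrow> finite A"
  by (auto simp: faces_def intro: finite_subset)

lemma empty_in_faces: "{} \<notin> \<G> \<Longrightarrow> {} \<in> faces V \<G>"
  by (auto simp: faces_def)

lemma max_face_size_props:
  assumes "finite V" "{} \<notin> \<G>"
  shows "\<exists>A\<in>faces V \<G>. card A = max_face_size V \<G>"
    and "A \<in> faces V \<G> \<Longrightarrow> card A \<le> max_face_size V \<G>"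
proof -
  have fin: "finite (card ` faces V \<G>)" using finite_faces[OF assms(1)] by simp
  have "Max (card ` faces V \<G>) \<in> card ` faces V \<G>"
    using fin empty_in_faces[OF assms(2), of V] by (intro Max_in) auto
  then show "\<exists>A\<in>faces V \<G>. card A = max_face_size V \<G>" unfolding max_face_size_def by force
  show "A \<in> faces V \<G> \<Longrightarrow> card A \<le> max_face_size V \<G>"
    unfolding max_face_size_def using fin by (intro Max_ge) auto
qed

text \<open>The complex is a join: a face is a union of one face from each side, cardinalities add,
  and a union has maximal size exactly when both parts do.\<close>

lemma max_face_count_join:
  assumes fin: "finite U" "finite W" and disj: "U \<inter> W = {}"
    and sub: "\<And>g. g \<in> \<G> \<Longrightarrow> g \<subseteq> U" "\<And>g. g \<in> \<H> \<Longrightarrow> g \<subseteq> W"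
    and ne: "{} \<notin> \<G>" "{} \<notin> \<H>"
  shows "max_face_count (U \<union> W) (\<G> \<union> \<H>) = max_face_count U \<G> * max_face_count W \<H>"
proof -
  let ?V = "U \<union> W" and ?F = "\<G> \<union> \<H>"
  have face_iff: "A \<in> faces ?V ?F \<longleftrightarrow> A \<subseteq> ?V \<and> A \<inter> U \<in> faces U \<G> \<and> A \<inter> W \<in> faces W \<H>" for A
  proof -
    have "(\<forall>g\<in>\<G>. \<not> g \<subseteq> A \<inter> U) \<longleftrightarrow> (\<forall>g\<in>\<G>. \<not> g \<subseteq> A)" using sub(1) by (meson Int_subset_iff)
    moreover have "(\<forall>g\<in>\<H>. \<not> g \<subseteq> A \<inter> W) \<longleftrightarrow> (\<forall>g\<in>\<H>. \<not> g \<subseteq> A)" using sub(2) by (meson Int_subset_iff)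
    ultimately show ?thesis unfolding faces_def by (simp add: ball_Un)
  qed
  have card: "card A = card (A \<inter> U) + card (A \<inter> W)" if "A \<subseteq> ?V" for A
  proof -
    have "A = (A \<inter> U) \<union> (A \<inter> W)" using that by blast
    moreover have "(A \<inter> U) \<inter> (A \<inter> W) = {}" using disj by blast
    ultimately show ?thesis using fin by (metis card_Un_disjoint finite_Int)
  qed
  note U = max_face_size_props[OF fin(1) ne(1)] and W = max_face_size_props[OF fin(2) ne(2)]
  have finV: "finite ?V" and neV: "{} \<notin> ?F" using fin ne by auto
  note V = max_face_size_props[OF finV neV]
  have union: "A \<union> B \<in> faces ?V ?F" "(A \<union> B) \<inter> U = A" "(A \<union> B) \<inter> W = B"
    if "A \<in> faces U \<G>" "B \<in> faces W \<H>" for A B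
  proof -
    have AB: "A \<subseteq> U" "B \<subseteq> W" using that by (auto simp: faces_def)
    show 1: "(A \<union> B) \<inter> U = A" "(A \<union> B) \<inter> W = B" using AB disj by blast+
    show "A \<union> B \<in> faces ?V ?F" unfolding face_iff 1 using AB that by blast
  qed
  have size: "max_face_size ?V ?F = max_face_size U \<G> + max_face_size W \<H>"
  proof (rule antisym)
    obtain A where A: "A \<in> faces ?V ?F" "card A = max_face_size ?V ?F" using V(1) by blast
    then have "A \<subseteq> ?V" "A \<inter> U \<in> faces U \<G>" "A \<inter> W \<in> faces W \<H>" using face_iff by blast+
    then show "max_face_size ?V ?F \<le> max_face_size U \<G> + max_face_size W \<H>"
      using card U(2) W(2) A(2) by (metis add_mono)
    obtain A B where AB: "A \<in> faces U \<G>" "card A = max_face_size U \<G>" "B \<in> faces W \<H>" "card B = max_face_size W \<H>"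
      using U(1) W(1) by blast
    have "A \<union> B \<subseteq> ?V" using union(1)[OF AB(1,3)] by (auto simp: faces_def)
    then have "card (A \<union> B) = max_face_size U \<G> + max_face_size W \<H>"
      using card union(2,3)[OF AB(1,3)] AB by metis
    then show "max_face_size U \<G> + max_face_size W \<H> \<le> max_face_size ?V ?F"
      using V(2)[OF union(1)[OF AB(1,3)]] by simp
  qed
  have "bij_betw (\<lambda>(A, B). A \<union> B)
      ({A \<in> faces U \<G>. card A = max_face_size U \<G>} \<times> {B \<in> faces W \<H>. card B = max_face_size W \<H>})
      {A \<in> faces ?V ?F. card A = max_face_size ?V ?F}"
  proof (rule bij_betw_byWitness[where f' = "\<lambda>A. (A \<inter> U, A \<inter> W)"])
    show "\<forall>a\<in>{A \<in> faces U \<G>. card A = max_face_size U \<G>} \<times> {B \<in> faces W \<H>. card B = max_face_size W \<H>}.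
        (case case a of (A, B) \<Rightarrow> A \<union> B of A \<Rightarrow> (A \<inter> U, A \<inter> W)) = a"
      using union(2,3) by auto
    show "\<forall>A\<in>{A \<in> faces ?V ?F. card A = max_face_size ?V ?F}. (case (A \<inter> U, A \<inter> W) of (A, B) \<Rightarrow> A \<union> B) = A"
      by (auto simp: faces_def)
    show "(\<lambda>(A, B). A \<union> B) ` ({A \<in> faces U \<G>. card A = max_face_size U \<G>} \<times> {B \<in> faces W \<H>. card B = max_face_size W \<H>})
        \<subseteq> {A \<in> faces ?V ?F. card A = max_face_size ?V ?F}"
    proof (clarify, intro conjI)
      fix A B assume AB: "A \<in> faces U \<G>" "card A = max_face_size U \<G>" "B \<in> faces W \<H>" "card B = max_face_size W \<H>"
      show *: "A \<union> B \<in> faces ?V ?F" by (rule union(1)[OF AB(1,3)])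
      then have "A \<union> B \<subseteq> ?V" by (simp add: faces_def)
      then show "card (A \<union> B) = max_face_size ?V ?F"
        using card union(2,3)[OF AB(1,3)] AB size by metis
    qed
    show "(\<lambda>A. (A \<inter> U, A \<inter> W)) ` {A \<in> faces ?V ?F. card A = max_face_size ?V ?F}
        \<subseteq> {A \<in> faces U \<G>. card A = max_face_size U \<G>} \<times> {B \<in> faces W \<H>. card B = max_face_size W \<H>}"
    proof (rule image_subsetI)
      fix A assume "A \<in> {A \<in> faces ?V ?F. card A = max_face_size ?V ?F}"
      then have A: "A \<subseteq> ?V" "A \<inter> U \<in> faces U \<G>" "A \<inter> W \<in> faces W \<H>" "card A = max_face_size ?V ?F"
        using face_iff by blast+
      have "card (A \<inter> U) = max_face_size U \<G> \<and> card (A \<inter> W) = max_face_size W \<H>"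
        using U(2)[OF A(2)] W(2)[OF A(3)] card[OF A(1)] A(4) size by linarith
      then show "(A \<inter> U, A \<inter> W) \<in> {A \<in> faces U \<G>. card A = max_face_size U \<G>} \<times> {B \<in> faces W \<H>. card B = max_face_size W \<H>}"
        using A by simp
    qed
  qed
  from bij_betw_same_card[OF this] show ?thesis
    unfolding max_face_count_def card_cartesian_product by (rule sym)
qed

lemma max_face_count_no_generators: "finite W \<Longrightarrow> max_face_count W {} = 1"
proof -
  assume W: "finite W"
  have F: "faces W {} = Pow W" by (auto simp: faces_def)
  have "max_face_size W {} = card W"
    unfolding max_face_size_def F using W by (intro Max_eqI) (auto intro: card_mono)
  then have "{A \<in> faces W {}. card A = max_face_size W {}} = {W}"
    unfolding F using card_subset_eq[OF W] by auto
  then show ?thesis by (simp add: max_face_count_def)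
qed

text \<open>Vertices that occur in no generator span a simplex, and a join with a simplex keeps the
  count. This allows all three ideals to be compared in the same ring.\<close>

lemma max_face_count_superset:
  assumes "finite V" "U \<subseteq> V" "\<And>g. g \<in> \<G> \<Longrightarrow> g \<subseteq> U" "{} \<notin> \<G>"
  shows "max_face_count V \<G> = max_face_count U \<G>"
  using max_face_count_join[of U "V - U" \<G> "{}"] max_face_count_no_generators[of "V - U"] assms
    finite_subset[OF assms(2,1)] by (simp add: Un_absorb1)

lemma max_face_count_union:
  assumes "finite V" "\<Union>\<G> \<subseteq> V" "\<Union>\<H> \<subseteq> V" "\<Union>\<G> \<inter> \<Union>\<H> = {}" "{} \<notin> \<G>" "{} \<notin> \<H>"
  shows "max_face_count V (\<G> \<union> \<H>) = max_face_count V \<G> * max_face_count V \<H>"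
proof -
  have fin: "finite (\<Union>\<G>)" "finite (\<Union>\<H>)" using assms(1-3) finite_subset by blast+
  have "max_face_count V (\<G> \<union> \<H>) = max_face_count (\<Union>\<G> \<union> \<Union>\<H>) (\<G> \<union> \<H>)"
    by (rule max_face_count_superset) (use assms in auto)
  also have "\<dots> = max_face_count (\<Union>\<G>) \<G> * max_face_count (\<Union>\<H>) \<H>"
    by (rule max_face_count_join) (use assms fin in auto)
  also have "max_face_count (\<Union>\<G>) \<G> = max_face_count V \<G>"
    by (rule max_face_count_superset[symmetric]) (use assms in auto)
  also have "max_face_count (\<Union>\<H>) \<H> = max_face_count V \<H>"
    by (rule max_face_count_superset[symmetric]) (use assms in auto)
  finally show ?thesis .
qed

text \<open>A translation does not preserve V, so \<phi> is only asked to map the vertices that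
  occur in \<G> into V; both counts are computed on the vertices that occur.\<close>

lemma max_face_count_image:
  assumes inj: "inj \<phi>" and fin: "finite V" and sub: "\<Union>\<G> \<subseteq> V" "\<phi> ` \<Union>\<G> \<subseteq> V" and ne: "{} \<notin> \<G>"
  shows "max_face_count V ((`) \<phi> ` \<G>) = max_face_count V \<G>"
proof -
  let ?U = "\<Union>\<G>"
  have faces_img: "faces (\<phi> ` ?U) ((`) \<phi> ` \<G>) = (`) \<phi> ` faces ?U \<G>"
  proof (intro equalityI subsetI)
    fix B assume B: "B \<in> faces (\<phi> ` ?U) ((`) \<phi> ` \<G>)"
    then obtain A where A: "A \<subseteq> ?U" "B = \<phi> ` A" by (auto simp: faces_def subset_image_iff)
    then have "A \<in> faces ?U \<G>" using B by (auto simp: faces_def inj_image_subset_iff[OF inj])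
    then show "B \<in> (`) \<phi> ` faces ?U \<G>" using A by blast
  next
    fix B assume "B \<in> (`) \<phi> ` faces ?U \<G>"
    then obtain A where A: "A \<in> faces ?U \<G>" "B = \<phi> ` A" by blast
    then show "B \<in> faces (\<phi> ` ?U) ((`) \<phi> ` \<G>)"
      unfolding faces_def by (auto simp: inj_image_subset_iff[OF inj])
  qed
  have card: "card (\<phi> ` A) = card A" for A
    using inj by (metis card_image inj_on_subset subset_UNIV)
  have size: "max_face_size (\<phi> ` ?U) ((`) \<phi> ` \<G>) = max_face_size ?U \<G>"
    unfolding max_face_size_def faces_img image_image card ..
  have "{B \<in> faces (\<phi> ` ?U) ((`) \<phi> ` \<G>). card B = max_face_size (\<phi> ` ?U) ((`) \<phi> ` \<G>)} =
      (`) \<phi> ` {A \<in> faces ?U \<G>. card A = max_face_size ?U \<G>}"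
    unfolding size faces_img by (auto simp: card)
  moreover have "inj_on ((`) \<phi>) X" for X using inj by (auto simp: inj_on_def inj_image_eq_iff)
  ultimately have "max_face_count (\<phi> ` ?U) ((`) \<phi> ` \<G>) = max_face_count ?U \<G>"
    unfolding max_face_count_def by (simp add: card_image)
  moreover have "max_face_count V ((`) \<phi> ` \<G>) = max_face_count (\<phi> ` ?U) ((`) \<phi> ` \<G>)"
    by (rule max_face_count_superset) (use fin sub ne in auto)
  moreover have "max_face_count V \<G> = max_face_count ?U \<G>"
    by (rule max_face_count_superset) (use fin sub ne in auto)
  ultimately show ?thesis by simp
qed

section \<open>Counting standard monomials by their supports\<close>

definition support_count :: "(nat \<times> nat) set \<Rightarrow> nat \<Rightarrow> nat" where
  "support_count A d = card {m :: skew_mon. mkeys m = A \<and> total_degree m = d}"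

lemma finite_support_monomials: "finite A \<Longrightarrow> finite {m :: skew_mon. mkeys m = A \<and> total_degree m = d}"
  by (rule finite_subset[OF _ finite_monomials_degree[of A d]]) auto

lemma total_degree_eq_0_iff: "total_degree m = 0 \<longleftrightarrow> m = 0"
  by (auto simp: total_degree_def in_keys_iff intro: poly_mapping_eqI)

lemma support_count_empty [simp]: "support_count {} (Suc d) = 0"
  by (simp add: support_count_def)

lemma support_count_0: "support_count A 0 = (if A = {} then 1 else 0)"
proof -
  have "{m :: skew_mon. mkeys m = A \<and> total_degree m = 0} = (if A = {} then {0} else {})"
    by (auto simp: total_degree_eq_0_iff)
  then show ?thesis by (simp add: support_count_def)
qed

text \<open>Division by x leaves a monomial with support A - {x} or A.\<close>

lemma support_count_Suc:
  assumes "finite A" "x \<in> A"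
  shows "support_count A (Suc d) = support_count (A - {x}) d + support_count A d"
proof -
  let ?X = "\<lambda>A d. {m :: skew_mon. mkeys m = A \<and> total_degree m = d}"
  let ?s = "msingle x (1 :: nat)"
  have "?X A (Suc d) = (\<lambda>m. ?s + m) ` (?X (A - {x}) d \<union> ?X A d)"
  proof (intro equalityI subsetI)
    fix m assume m: "m \<in> ?X A (Suc d)"
    then have "mlookup m x \<ge> 1" using assms(2) by (auto simp: in_keys_iff)
    then have eq: "m = ?s + (m - ?s)"
      by (intro poly_mapping_eqI) (auto simp: lookup_add lookup_minus_nat lookup_single when_def)
    have "total_degree m = Suc (total_degree (m - ?s))" by (subst eq, subst total_degree_plus) simp
    moreover have "mkeys m = insert x (mkeys (m - ?s))" by (subst eq, subst keys_plus_nat) simp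
    ultimately have "A = insert x (mkeys (m - ?s))" "total_degree (m - ?s) = d" using m by auto
    then have "m - ?s \<in> ?X (A - {x}) d \<union> ?X A d" by (cases "x \<in> mkeys (m - ?s)") auto
    then show "m \<in> (\<lambda>m. ?s + m) ` (?X (A - {x}) d \<union> ?X A d)" using eq by blast
  next
    fix m assume "m \<in> (\<lambda>m. ?s + m) ` (?X (A - {x}) d \<union> ?X A d)"
    then obtain m' where m': "m = ?s + m'" "m' \<in> ?X (A - {x}) d \<union> ?X A d" by (rule imageE)
    then have "insert x (mkeys m') = A" "total_degree m' = d" using assms(2) by auto
    then show "m \<in> ?X A (Suc d)" unfolding m'(1) by (simp add: total_degree_plus keys_plus_nat)
  qed
  moreover have "inj_on (\<lambda>m. ?s + m) B" for B by (auto simp: inj_on_def)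
  ultimately have "support_count A (Suc d) = card (?X (A - {x}) d \<union> ?X A d)"
    unfolding support_count_def by (simp add: card_image)
  also have "\<dots> = support_count (A - {x}) d + support_count A d"
    unfolding support_count_def
    by (rule card_Un_disjoint) (use assms in \<open>auto intro: finite_support_monomials\<close>)
  finally show ?thesis .
qed

text \<open>These are the compositions of d + 1 into s + 1 positive parts;
  \<open>support_count_Suc\<close> is Pascal's rule.\<close>

lemma support_count_eq: "finite A \<Longrightarrow> card A = Suc s \<Longrightarrow> support_count A (Suc d) = d choose s"
proof (induction d arbitrary: A s)
  case 0
  then obtain x where x: "x \<in> A" by (metis card.empty equals0I nat.distinct(1))
  have "A - {x} = {} \<longleftrightarrow> s = 0" using 0 x by (metis card_0_eq card_Diff_singleton diff_Suc_1 finite_Diff)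
  then show ?case using 0 x support_count_Suc[OF 0(1) x, of 0] by (cases s) (auto simp: support_count_0)
next
  case (Suc d)
  then obtain x where x: "x \<in> A" by (metis card.empty equals0I nat.distinct(1))
  have rec: "support_count A (Suc (Suc d)) = support_count (A - {x}) (Suc d) + (d choose s)"
    using support_count_Suc[OF Suc.prems(1) x, of "Suc d"] Suc by simp
  have c: "card (A - {x}) = s" using Suc.prems x by simp
  show ?case
  proof (cases s)
    case 0
    then have "A - {x} = {}" using c Suc.prems(1) by (meson card_0_eq finite_Diff)
    then have "support_count (A - {x}) (Suc d) = 0" by (simp only: support_count_empty)
    then show ?thesis using rec 0 by simp
  next
    case (Suc s')
    then have "support_count (A - {x}) (Suc d) = d choose s'" using Suc.IH[of "A - {x}" s'] c \<open>finite A\<close> by simp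
    then show ?thesis using rec Suc by simp
  qed
qed

text \<open>The generators are squarefree, so divisibility depends on supports only.\<close>

lemma monomial_span_iff_support: "m \<in> monomial_span F \<longleftrightarrow> (\<exists>S\<in>F. mkeys (anti_mon S) \<subseteq> mkeys m)"
proof
  assume "m \<in> monomial_span F"
  then show "\<exists>S\<in>F. mkeys (anti_mon S) \<subseteq> mkeys m" by (auto simp: monomial_span_def keys_plus_nat)
next
  assume "\<exists>S\<in>F. mkeys (anti_mon S) \<subseteq> mkeys m"
  then obtain S where S: "S \<in> F" "mkeys (anti_mon S) \<subseteq> mkeys m" by blast
  have "mlookup (anti_mon S) v \<le> mlookup m v" for v
  proof (cases "v \<in> mkeys (anti_mon S)")
    case True
    then have "mlookup m v \<noteq> 0" using S(2) by (metis in_keys_iff subsetD)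
    then show ?thesis using lookup_anti_mon_le[of S v] by simp
  qed (simp add: in_keys_iff)
  then have "m = anti_mon S + (m - anti_mon S)"
    by (intro poly_mapping_eqI) (simp add: lookup_add lookup_minus_nat)
  then show "m \<in> monomial_span F" using S(1) by (auto simp: monomial_span_def)
qed

definition supports :: "nat set set \<Rightarrow> (nat \<times> nat) set set" where
  "supports F = (\<lambda>S. mkeys (anti_mon S)) ` F"

lemma card_std_monomials:
  "card (std_monomials n F d) = (\<Sum>A\<in>faces (skew_vars n) (supports F). support_count A d)"
proof -
  have "std_monomials n F d =
      (\<Union>A\<in>faces (skew_vars n) (supports F). {m :: skew_mon. mkeys m = A \<and> total_degree m = d})"
    by (auto simp: std_monomials_def faces_def supports_def monomial_span_iff_support)
  then show ?thesis unfolding support_count_def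
    by (simp only:, subst card_UN_disjoint)
       (auto intro!: finite_faces finite_support_monomials intro: faces_finite_face[OF finite_skew_vars])
qed

text \<open>The polynomial (z - 1 choose s) in z; the shift by 1 makes its value at z the number of
  monomials of degree z \<ge> 1 with a prescribed support of s + 1 variables.\<close>

definition binomial_poly :: "nat \<Rightarrow> rat poly" where
  "binomial_poly s = smult (1 / fact s) (\<Prod>i<s. [:- of_nat (Suc i), 1:])"

lemma poly_binomial_poly: "poly (binomial_poly s) (of_nat (Suc d)) = of_nat (d choose s)"
proof -
  have "poly (binomial_poly s) (of_nat (Suc d)) = (\<Prod>i<s. of_nat d - of_nat i) / fact s"
    by (simp add: binomial_poly_def poly_prod)
  also have "\<dots> = (of_nat d :: rat) gchoose s" by (simp add: gbinomial_prod_rev lessThan_atLeast0)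
  finally show ?thesis by (simp add: binomial_gbinomial)
qed

lemma degree_binomial_poly: "degree (binomial_poly s) = s"
  and coeff_binomial_poly: "coeff (binomial_poly s) s = 1 / fact s"
proof -
  let ?p = "\<Prod>i<s. [:- of_nat (Suc i), 1:] :: rat poly"
  have deg: "degree ?p = s" by (subst degree_prod_sum_eq) auto
  have "lead_coeff ?p = 1" by (subst lead_coeff_prod) auto
  then have "coeff ?p s = 1" using deg by simp
  then show "coeff (binomial_poly s) s = 1 / fact s" by (simp add: binomial_poly_def)
  show "degree (binomial_poly s) = s" using deg by (simp add: binomial_poly_def)
qed

text \<open>Polynomials that agree at all large integers coincide. The hypothesis starts in degree
  1, where the binomial formula for supports becomes valid.\<close>

lemma hilbert_polynomial_eqI:
  assumes "\<And>d. of_nat (hilbert_function n I (Suc d)) = poly p (of_nat (Suc d))"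
  shows "hilbert_polynomial n I = p"
  unfolding hilbert_polynomial_def
proof (rule the_equality)
  show ev: "\<forall>\<^sub>F d in sequentially. of_nat (hilbert_function n I d) = poly p (of_nat d)"
    unfolding eventually_sequentially using assms by (metis Suc_le_D)
  fix q :: "rat poly" assume "\<forall>\<^sub>F d in sequentially. of_nat (hilbert_function n I d) = poly q (of_nat d)"
  with ev have "\<forall>\<^sub>F d in sequentially. poly (q - p) (of_nat d) = 0"
    by eventually_elim simp
  then obtain N where N: "\<And>d. d \<ge> N \<Longrightarrow> poly (q - p) (of_nat d) = 0"
    unfolding eventually_sequentially by blast
  have "infinite (of_nat ` {N..} :: rat set)"
    by (metis finite_imageD inj_on_of_nat inj_on_subset infinite_Ici subset_UNIV)
  moreover have "of_nat ` {N..} \<subseteq> {x. poly (q - p) x = 0}" using N by auto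
  ultimately have "infinite {x. poly (q - p) x = 0}" using finite_subset by blast
  then have "q - p = 0" using poly_roots_finite by blast
  then show "q = p" by simp
qed

text \<open>Only faces of the maximal size N reach degree N - 1 in the Hilbert polynomial, each with
  coefficient 1 / (N - 1)!. The face {v} gives N \<ge> 1, so the polynomial is nonzero and the
  positive-dimensional branch of the definition applies.\<close>

theorem graded_multiplicity_eq_max_face_count:
  assumes F: "pf_family n F" and G: "pf_groebner TYPE('k::field) n F" and ne: "{} \<notin> supports F"
    and v: "{v} \<in> faces (skew_vars n) (supports F)"
  shows "graded_multiplicity n (skew_Idl n (pf ` F) :: 'k skew_poly set) =
    of_nat (max_face_count (skew_vars n) (supports F))"
proof -
  let ?I = "skew_Idl n (pf ` F) :: 'k skew_poly set"
  let ?D = "faces (skew_vars n) (supports F)"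
  let ?N = "max_face_size (skew_vars n) (supports F)"
  have fin: "finite ?D" by (simp add: finite_faces)
  note size = max_face_size_props[OF finite_skew_vars[of n] ne]
  have N: "1 \<le> ?N" using size(2)[OF v] by simp
  \<comment> \<open>The empty face is omitted: it carries only the monomial 1, of degree 0.\<close>
  define p where "p = (\<Sum>A\<in>?D - {{}}. binomial_poly (card A - 1))"
  have ne': "0 \<notin> monomial_span F"
    using ne by (auto simp: monomial_span_zero_iff supports_def image_iff)
  have cA: "card A = Suc (card A - 1)" if "A \<in> ?D - {{}}" for A
  proof -
    have "finite A" "A \<noteq> {}" using that faces_finite_face[OF finite_skew_vars, of A] by auto
    then have "0 < card A" by (simp add: card_gt_0_iff)
    then show ?thesis by simp
  qed
  have "hilbert_polynomial n ?I = p"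
  proof (rule hilbert_polynomial_eqI)
    fix d
    have "hilbert_function n ?I (Suc d) = (\<Sum>A\<in>?D. support_count A (Suc d))"
      using hilbert_function_eq_card_std[OF F G ne'] card_std_monomials by simp
    also have "\<dots> = (\<Sum>A\<in>?D - {{}}. support_count A (Suc d))"
      by (rule sum.mono_neutral_right) (use fin in auto)
    also have "\<dots> = (\<Sum>A\<in>?D - {{}}. d choose (card A - 1))"
      using cA faces_finite_face[OF finite_skew_vars] by (intro sum.cong refl support_count_eq) auto
    finally show "of_nat (hilbert_function n ?I (Suc d)) = poly p (of_nat (Suc d))"
      unfolding p_def poly_sum poly_binomial_poly by simp
  qed
  moreover have coeff: "coeff p (?N - 1) = of_nat (max_face_count (skew_vars n) (supports F)) / fact (?N - 1)"
  proof -
    have "coeff (binomial_poly (card A - 1)) (?N - 1) = (if card A = ?N then 1 / fact (?N - 1) else 0)"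
      if A: "A \<in> ?D - {{}}" for A
    proof (cases "card A = ?N")
      case False
      then have "card A - 1 < ?N - 1" using size(2)[of A] A cA[OF A] by simp
      then show ?thesis using False by (simp add: coeff_eq_0 degree_binomial_poly)
    qed (simp add: coeff_binomial_poly)
    then have "coeff p (?N - 1) = (\<Sum>A\<in>?D - {{}}. if card A = ?N then 1 / fact (?N - 1) else 0)"
      unfolding p_def coeff_sum by (intro sum.cong) auto
    also have "\<dots> = (\<Sum>A\<in>{A \<in> ?D - {{}}. card A = ?N}. 1 / fact (?N - 1))"
      by (rule sum.inter_filter[symmetric]) (use fin in simp)
    also have "{A \<in> ?D - {{}}. card A = ?N} = {A \<in> ?D. card A = ?N}" using N by auto
    finally show ?thesis by (simp add: max_face_count_def)
  qed
  moreover have "max_face_count (skew_vars n) (supports F) > 0"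
    unfolding max_face_count_def using size(1) fin by (auto simp: card_gt_0_iff)
  ultimately have nz: "coeff p (?N - 1) \<noteq> 0" by simp
  have "degree p \<le> ?N - 1"
    unfolding p_def
  proof (rule degree_sum_le)
    fix A assume "A \<in> ?D - {{}}"
    then show "degree (binomial_poly (card A - 1)) \<le> ?N - 1"
      using size(2)[of A] by (simp add: degree_binomial_poly diff_le_mono)
  qed (use fin in simp)
  then have "degree p = ?N - 1" using le_degree[OF nz] by simp
  moreover have "p \<noteq> 0" using nz by auto
  ultimately show ?thesis
    using \<open>hilbert_polynomial n ?I = p\<close> coeff unfolding graded_multiplicity_def Let_def by simp
qed

section \<open>The ladders of the theorem\<close>

lemma skew_Idl_empty: "skew_Idl n {} = ({0} :: 'k::field skew_poly set)"
proof (intro equalityI subsetI)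
  fix p :: "'k skew_poly" assume "p \<in> skew_Idl n {}"
  then show "p \<in> {0}" by (induction rule: skew_Idl_induct[OF empty_subsetI, consumes 1]) auto
qed (simp add: skew_Idl_zero)

lemma skew_Idl_mono:
  assumes "A \<subseteq> B" "B \<subseteq> carrier (skew_ring n)"
  shows "skew_Idl n A \<subseteq> skew_Idl n B"
  using ring.subset_Idl_subset[OF skew_ring_ring assms(2,1)] .

lemma skew_Idl_Un:
  assumes "A \<subseteq> carrier (skew_ring n)" "B \<subseteq> carrier (skew_ring n)"
  shows "skew_Idl n (A \<union> B) = skew_Idl n A <+>\<^bsub>skew_ring n\<^esub> skew_Idl n B"
proof -
  have AB: "A \<union> B \<subseteq> carrier (skew_ring n)" using assms by simp
  have "skew_Idl n (skew_Idl n A \<union> skew_Idl n B) = skew_Idl n (A \<union> B)"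
  proof (rule equalityI)
    show "skew_Idl n (skew_Idl n A \<union> skew_Idl n B) \<subseteq> skew_Idl n (A \<union> B)"
      by (rule ring.genideal_minimal[OF skew_ring_ring skew_Idl_ideal[OF AB]])
         (intro Un_least skew_Idl_mono AB Un_upper1 Un_upper2)
    have "A \<union> B \<subseteq> skew_Idl n A \<union> skew_Idl n B"
      using skew_Idl_gen[OF assms(1)] skew_Idl_gen[OF assms(2)] by auto
    moreover have "skew_Idl n A \<union> skew_Idl n B \<subseteq> carrier (skew_ring n)"
      using skew_Idl_carrier[OF assms(1)] skew_Idl_carrier[OF assms(2)] by auto
    ultimately show "skew_Idl n (A \<union> B) \<subseteq> skew_Idl n (skew_Idl n A \<union> skew_Idl n B)"
      by (rule skew_Idl_mono)
  qed
  then show ?thesis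
    using ring.union_genideal[OF skew_ring_ring skew_Idl_ideal[OF assms(1)] skew_Idl_ideal[OF assms(2)]] by simp
qed

definition corner_sets :: "nat \<times> nat \<times> nat \<Rightarrow> nat set set" where
  "corner_sets c = (case c of (a, b, u) \<Rightarrow> {S. S \<subseteq> {a..b} \<and> card S = 2 * u})"

lemma pfaffian_ideal_eq: "pfaffian_ideal n a b u = skew_Idl n (pf ` corner_sets (a, b, u))"
proof -
  have "{sub_pfaffian u S | S. S \<subseteq> {a..b} \<and> card S = 2 * u} = (sub_pfaffian u ` corner_sets (a, b, u) :: 'a skew_poly set)"
    by (simp add: corner_sets_def setcompr_eq_image)
  also have "\<dots> = pf ` corner_sets (a, b, u)"
    by (rule image_cong[OF refl]) (simp add: corner_sets_def sub_pfaffian_eq_pf)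
  finally have "{sub_pfaffian u S | S. S \<subseteq> {a..b} \<and> card S = 2 * u} = (pf ` corner_sets (a, b, u) :: 'a skew_poly set)" .
  then show ?thesis unfolding pfaffian_ideal_def by (simp only:)
qed

lemma pf_family_corner_sets: "1 \<le> a \<Longrightarrow> b \<le> n \<Longrightarrow> pf_family n (corner_sets (a, b, u))"
  unfolding pf_family_def corner_sets_def by (auto dest: finite_subset[OF _ finite_atLeastAtMost])

lemma ladder_ideal_eq:
  assumes "\<And>a b u. (a, b, u) \<in> set cs \<Longrightarrow> 1 \<le> a \<and> b \<le> n"
  shows "ladder_ideal n cs = (skew_Idl n (pf ` (\<Union>c\<in>set cs. corner_sets c)) :: 'k::field skew_poly set)"
  using assms
proof (induction cs)
  case Nil
  then show ?case by (simp add: ladder_ideal_def skew_Idl_empty)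
next
  case (Cons c cs)
  obtain a b u where c: "c = (a, b, u)" using prod_cases3 by blast
  let ?G = "\<Union>c\<in>set cs. corner_sets c"
  have ab: "1 \<le> a" "b \<le> n" using Cons.prems[of a b u] c by auto
  have "pf_family n ?G" unfolding pf_family_def
  proof (intro ballI)
    fix S assume "S \<in> ?G"
    then obtain a' b' u' where c': "(a', b', u') \<in> set cs" "S \<in> corner_sets (a', b', u')" by force
    have "1 \<le> a'" "b' \<le> n" using Cons.prems[of a' b' u'] c'(1) by auto
    from pf_family_corner_sets[OF this, of u'] show "finite S \<and> even (card S) \<and> S \<subseteq> {1..n}"
      using c'(2) unfolding pf_family_def by simp
  qed
  then have carr: "pf ` corner_sets c \<subseteq> carrier (skew_ring n :: 'k skew_poly ring)" "pf ` ?G \<subseteq> carrier (skew_ring n :: 'k skew_poly ring)"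
    unfolding c by (simp_all only: pf_family_carrier pf_family_corner_sets[OF ab])
  have "ladder_ideal n (c # cs) = (pfaffian_ideal n a b u <+>\<^bsub>skew_ring n\<^esub> ladder_ideal n cs :: 'k skew_poly set)"
    by (simp add: ladder_ideal_def c)
  also have "\<dots> = (skew_Idl n (pf ` corner_sets c) <+>\<^bsub>skew_ring n\<^esub> skew_Idl n (pf ` ?G) :: 'k skew_poly set)"
  proof -
    have "ladder_ideal n cs = (skew_Idl n (pf ` ?G) :: 'k skew_poly set)"
    proof (rule Cons.IH)
      fix a' b' u' assume "(a', b', u') \<in> set cs"
      then show "1 \<le> a' \<and> b' \<le> n" using Cons.prems[of a' b' u'] by simp
    qed
    then show ?thesis unfolding pfaffian_ideal_eq c by (simp only:)
  qed
  also have "\<dots> = skew_Idl n (pf ` corner_sets c \<union> pf ` ?G)"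
    by (rule skew_Idl_Un[OF carr, symmetric])
  finally show ?case by (simp add: image_Un)
qed

text \<open>Choosing 2h out of 2h + 1 indices means omitting one.\<close>

lemma corner_sets_win:
  assumes "h \<le> c"
  shows "corner_sets (c - h, c + h, h) = {win c h - {i} | i. i \<in> win c h}"
proof (intro equalityI subsetI)
  fix S assume "S \<in> corner_sets (c - h, c + h, h)"
  then have S: "S \<subseteq> win c h" "card S = 2 * h" by (auto simp: corner_sets_def win_def)
  then have "card (win c h - S) = 1" using assms by (simp add: card_Diff_subset finite_subset card_win)
  then obtain i where i: "win c h - S = {i}" by (rule card_1_singletonE)
  then have "S = win c h - {i}" "i \<in> win c h" using S(1) by blast+
  then show "S \<in> {win c h - {i} | i. i \<in> win c h}" by blast
next
  fix S assume "S \<in> {win c h - {i} | i. i \<in> win c h}"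
  then obtain i where "i \<in> win c h" "S = win c h - {i}" by blast
  then show "S \<in> corner_sets (c - h, c + h, h)"
    using card_win_remove[OF assms] by (auto simp: corner_sets_def win_def)
qed

abbreviation win_sets :: "nat set \<Rightarrow> (nat \<Rightarrow> nat) \<Rightarrow> nat set set" where
  "win_sets C h \<equiv> ladder_sets C h {} (\<lambda>_. 0)"

lemma win_sets_UN: "win_sets C h = (\<Union>c\<in>C. (\<lambda>i. win c (h c) - {i}) ` win c (h c))"
  unfolding ladder_sets_def by blast

lemma win_sets_eq: "(\<And>c. c \<in> C \<Longrightarrow> h c \<le> c) \<Longrightarrow> win_sets C h = (\<Union>c\<in>C. corner_sets (c - h c, c + h c, h c))"
  by (auto simp: ladder_sets_def corner_sets_win)

lemma win_sets_Un: "win_sets (C \<union> C') h = win_sets C h \<union> win_sets C' h"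
  by (auto simp: ladder_sets_def)

lemma win_sets_cong: "(\<And>c. c \<in> C \<Longrightarrow> h c = h' c) \<Longrightarrow> win_sets C h = win_sets C h'"
  by (simp add: win_sets_UN)

text \<open>The corner (m, 2u + m) spans the window with center u + m and height u.\<close>

lemma L_ideal_eq:
  assumes "2 * u + k \<le> n"
  shows "L_ideal n u k = skew_Idl n (pf ` win_sets {u + 1..u + k} (\<lambda>_. u))"
proof -
  have "(\<Union>c\<in>set (map (\<lambda>m. (m, 2 * u + m, u)) [1..<k + 1]). corner_sets c) =
      (\<Union>m\<in>{1..k}. corner_sets (m, 2 * u + m, u))"
    by (simp add: atLeastLessThanSuc_atLeastAtMost del: upt_Suc)
  also have "\<dots> = (\<Union>c\<in>{u + 1..u + k}. corner_sets (c - u, c + u, u))"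
  proof -
    have cs: "{u + 1..u + k} = (\<lambda>m. u + m) ` {1..k}" by simp
    show ?thesis unfolding cs image_image by (intro SUP_cong refl) (simp add: mult_2 add_ac)
  qed
  also have "\<dots> = win_sets {u + 1..u + k} (\<lambda>_. u)" by (subst win_sets_eq) auto
  finally show ?thesis unfolding L_ideal_def
    by (subst ladder_ideal_eq) (use assms in auto)
qed

text \<open>Corners (m, 2t + m - 2) have center t - 1 + m and height t - 1, corners (m, 2t + m) have
  center t + m and height t. Since m passes from j to j + 1 between the blocks, the center t + j is
  skipped.\<close>

lemma H_ideal_eq:
  assumes "t \<ge> 2" "2 * t + j + k \<le> n"
  shows "H_ideal n t j k = skew_Idl n (pf ` win_sets ({t..<t + j} \<union> {t + j + 1..t + j + k}) (\<lambda>c. if c < t + j then t - 1 else t))"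
proof -
  let ?cs = "map (\<lambda>m. (m, 2 * t + m - 2, t - 1)) [1..<j + 1] @ map (\<lambda>m. (m, 2 * t + m, t)) [j + 1..<j + k + 1]"
  have 1: "{t..<t + j} = (\<lambda>m. t - 1 + m) ` {1..j}"
  proof (intro equalityI subsetI)
    fix x assume "x \<in> {t..<t + j}"
    then show "x \<in> (\<lambda>m. t - 1 + m) ` {1..j}" using assms by (intro image_eqI[of _ _ "x - (t - 1)"]) auto
  qed (use assms in auto)
  have 2: "{t + j + 1..t + j + k} = (\<lambda>m. t + m) ` {j + 1..j + k}" by (simp add: add.assoc)
  have "(\<Union>c\<in>set ?cs. corner_sets c) =
      (\<Union>m\<in>{1..j}. corner_sets (m, 2 * t + m - 2, t - 1)) \<union> (\<Union>m\<in>{j + 1..j + k}. corner_sets (m, 2 * t + m, t))"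
    by (simp add: atLeastLessThanSuc_atLeastAtMost UN_Un del: upt_Suc)
  also have "(\<Union>m\<in>{1..j}. corner_sets (m, 2 * t + m - 2, t - 1)) =
      (\<Union>c\<in>{t..<t + j}. corner_sets (c - (t - 1), c + (t - 1), t - 1))"
  proof -
    have "t - 1 + m - (t - 1) = m" "t - 1 + m + (t - 1) = 2 * t + m - 2" for m using assms(1) by auto
    then show ?thesis unfolding 1 image_image by (simp only:)
  qed
  also have "(\<Union>m\<in>{j + 1..j + k}. corner_sets (m, 2 * t + m, t)) =
      (\<Union>c\<in>{t + j + 1..t + j + k}. corner_sets (c - t, c + t, t))"
    unfolding 2 image_image by (intro SUP_cong refl) (simp add: mult_2 add_ac)
  also have "(\<Union>c\<in>{t..<t + j}. corner_sets (c - (t - 1), c + (t - 1), t - 1)) = win_sets {t..<t + j} (\<lambda>c. if c < t + j then t - 1 else t)"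
    by (subst win_sets_eq) auto
  also have "(\<Union>c\<in>{t + j + 1..t + j + k}. corner_sets (c - t, c + t, t)) = win_sets {t + j + 1..t + j + k} (\<lambda>c. if c < t + j then t - 1 else t)"
    by (subst win_sets_eq) auto
  finally have "(\<Union>c\<in>set ?cs. corner_sets c) = win_sets ({t..<t + j} \<union> {t + j + 1..t + j + k}) (\<lambda>c. if c < t + j then t - 1 else t)"
    unfolding win_sets_Un .
  then show ?thesis unfolding H_ideal_def
    by (subst ladder_ideal_eq) (use assms in auto)
qed

section \<open>Variables occurring in the initial ideals\<close>

lemma keys_anti_mon_nonempty: "finite S \<Longrightarrow> 2 \<le> card S \<Longrightarrow> mkeys (anti_mon S) \<noteq> {}"
  by (subst anti_mon.simps) (simp add: keys_plus_nat)

lemma empty_not_in_supports: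
  assumes "\<And>c. c \<in> C \<Longrightarrow> 1 \<le> h c \<and> h c < c"
  shows "{} \<notin> supports (win_sets C h)"
proof
  assume "{} \<in> supports (win_sets C h)"
  then obtain c i where ci: "c \<in> C" "i \<in> win c (h c)" "mkeys (anti_mon (win c (h c) - {i})) = {}"
    unfolding supports_def win_sets_UN by (metis (no_types, lifting) UN_E image_iff)
  then have "2 \<le> card (win c (h c) - {i})" using card_win_remove[of "h c" c i] assms[OF ci(1)] by simp
  then show False using keys_anti_mon_nonempty ci(3) by simp
qed

lemma supports_sums:
  assumes "\<And>c. c \<in> C \<Longrightarrow> h c < c \<and> p \<le> c \<and> c \<le> q"
  shows "\<Union>(supports (win_sets C h)) \<subseteq> {(a, b). 2 * p - 1 \<le> a + b \<and> a + b \<le> 2 * q + 1}"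
proof
  fix v assume "v \<in> \<Union>(supports (win_sets C h))"
  then obtain c i where ci: "c \<in> C" "i \<in> win c (h c)" "v \<in> mkeys (anti_mon (win c (h c) - {i}))"
    unfolding supports_def ladder_sets_def by auto
  then have "v \<in> {(a, b). 2 * c - 1 \<le> a + b \<and> a + b \<le> 2 * c + 1}"
    using keys_anti_mon_win[OF _ ci(2)] assms[OF ci(1)] by blast
  then show "v \<in> {(a, b). 2 * p - 1 \<le> a + b \<and> a + b \<le> 2 * q + 1}" using assms[OF ci(1)] by auto
qed

lemma supports_skew_vars:
  assumes "pf_family n F" shows "\<Union>(supports F) \<subseteq> skew_vars n"
proof
  fix v assume "v \<in> \<Union>(supports F)"
  then obtain S where S: "S \<in> F" "v \<in> mkeys (anti_mon S)" by (auto simp: supports_def)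
  then have "v \<in> {(a, b). a \<in> S \<and> b \<in> S \<and> a < b}" using keys_anti_mon by blast
  moreover have "S \<subseteq> {1..n}" using assms S(1) by (simp add: pf_family_def)
  ultimately show "v \<in> skew_vars n" by (auto simp: skew_vars_def)
qed

theorem graded_multiplicity_win_sets:
  assumes C: "finite C" "\<And>c. c \<in> C \<Longrightarrow> 1 \<le> h c \<and> h c < c \<and> c + h c \<le> n \<and> c < n - 1"
    and adj: "\<And>c. c \<in> C \<Longrightarrow> c + 1 \<in> C \<Longrightarrow> h c \<le> h (c + 1) + 1 \<and> h (c + 1) \<le> h c + 1" and n: "2 \<le> n"
  shows "graded_multiplicity n (skew_Idl n (pf ` win_sets C h) :: 'k::field skew_poly set) =
    of_nat (max_face_count (skew_vars n) (supports (win_sets C h)))"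
proof (rule graded_multiplicity_eq_max_face_count)
  have adm: "admissible n C h {} (\<lambda>_. 0)" using assms by (simp add: admissible_def)
  show "pf_family n (win_sets C h)" by (rule pf_family_ladder_sets[OF adm])
  show "pf_groebner TYPE('k) n (win_sets C h)" by (rule pf_groebner_ladder[OF adm])
  show ne: "{} \<notin> supports (win_sets C h)" by (rule empty_not_in_supports) (use C in auto)
  \<comment> \<open>The variable of (n - 1, n) has index sum 2n - 1, while c \<le> n - 2 bounds all
    index sums in the leading monomials by 2n - 3.\<close>
  show "{(n - 1, n)} \<in> faces (skew_vars n) (supports (win_sets C h))"
    unfolding faces_def
  proof (intro CollectI conjI ballI notI)
    show "{(n - 1, n)} \<subseteq> skew_vars n" using n by (auto simp: skew_vars_def)
    fix g assume g: "g \<in> supports (win_sets C h)" "g \<subseteq> {(n - 1, n)}"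
    have "g \<noteq> {}" using g(1) ne by metis
    then have vg: "(n - 1, n) \<in> g" using g(2) by auto
    have "\<Union>(supports (win_sets C h)) \<subseteq> {(a, b). 2 * 0 - 1 \<le> a + b \<and> a + b \<le> 2 * (n - 2) + 1}"
      by (rule supports_sums) (use C(2) in force)
    then have "(n - 1, n) \<in> {(a, b). 2 * 0 - 1 \<le> a + b \<and> a + b \<le> 2 * (n - 2) + 1}" using g(1) vg by (meson UnionI subsetD)
    then have "n - 1 + n \<le> 2 * (n - 2) + 1" by simp
    then show False using n by linarith
  qed
qed

section \<open>Translation of windows\<close>

definition shift_var :: "nat \<Rightarrow> nat \<times> nat \<Rightarrow> nat \<times> nat" where
  "shift_var j v = (fst v + j, snd v + j)"

text \<open>A translation preserves minima and maxima, and with them the nested matching.\<close>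

lemma keys_anti_mon_shift: "mkeys (anti_mon ((\<lambda>x. x + j) ` S)) = shift_var j ` mkeys (anti_mon S)"
proof (induction S rule: anti_mon.induct)
  case (1 S)
  have inj: "inj_on (\<lambda>x. x + j) A" for A by (simp add: inj_on_def)
  show ?case
  proof (cases "finite S \<and> 2 \<le> card S")
    case True
    then have ne: "finite S" "S \<noteq> {}" by auto
    have mm: "Min ((\<lambda>x. x + j) ` S) = Min S + j" "Max ((\<lambda>x. x + j) ` S) = Max S + j"
      using ne by (auto simp: mono_Min_commute[of "\<lambda>x. x + j" S] mono_Max_commute[of "\<lambda>x. x + j" S] mono_def)
    have "(\<lambda>x. x + j) ` S - {Min S + j, Max S + j} = (\<lambda>x. x + j) ` (S - {Min S, Max S})" by auto
    moreover have "anti_mon ((\<lambda>x. x + j) ` S) = msingle (Min S + j, Max S + j) 1 +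
        anti_mon ((\<lambda>x. x + j) ` S - {Min S + j, Max S + j})"
      using True by (subst anti_mon.simps) (simp add: mm card_image[OF inj])
    ultimately have "mkeys (anti_mon ((\<lambda>x. x + j) ` S)) =
        insert (Min S + j, Max S + j) (mkeys (anti_mon ((\<lambda>x. x + j) ` (S - {Min S, Max S}))))"
      by (simp add: keys_plus_nat)
    moreover have "mkeys (anti_mon S) = insert (Min S, Max S) (mkeys (anti_mon (S - {Min S, Max S})))"
      using True by (subst anti_mon.simps) (simp add: keys_plus_nat)
    ultimately show ?thesis using 1[OF True] by (simp add: shift_var_def)
  next
    case False
    then have "anti_mon S = 0" "anti_mon ((\<lambda>x. x + j) ` S) = 0"
      by (subst anti_mon.simps, auto simp: card_image[OF inj] finite_image_iff[OF inj])+
    then show ?thesis by simp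
  qed
qed

text \<open>The bound t < a rules out truncation in c - t, so windows move with their
  centers.\<close>

lemma win_sets_shift:
  assumes "t < a"
  shows "win_sets {a + j..b + j} (\<lambda>_. t) = (`) (\<lambda>x. x + j) ` win_sets {a..b} (\<lambda>_. t)"
proof -
  have win: "win (c + j) t = (\<lambda>x. x + j) ` win c t" if "c \<in> {a..b}" for c
    using that assms by (simp add: win_def)
  have rem: "(\<lambda>x. x + j) ` (A - {i}) = (\<lambda>x. x + j) ` A - {i + j}" for A :: "nat set" and i by auto
  have cs: "{a + j..b + j} = (\<lambda>x. x + j) ` {a..b}" by simp
  show ?thesis
    unfolding win_sets_UN image_UN image_image cs
  proof (intro SUP_cong refl)
    fix c assume "c \<in> {a..b}"
    from win[OF this] show "(\<lambda>i. win (c + j) t - {i}) ` win (c + j) t =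
        (\<lambda>i. (\<lambda>x. x + j) ` (win c t - {i})) ` win c t"
      by (simp only: image_image rem)
  qed
qed

lemma supports_shift: "supports ((`) (\<lambda>x. x + j) ` F) = (`) (shift_var j) ` supports F"
  by (simp add: supports_def image_image keys_anti_mon_shift)

theorem proposition2p6:
  fixes t j k n :: nat
  assumes "t \<ge> 2" and "j \<ge> 1" and "k \<ge> 1"
    and "n \<ge> 2 * t + j + k"
  shows "graded_multiplicity n (H_ideal n t j k :: 'k::field skew_poly set) =
         graded_multiplicity n (L_ideal n (t - 1) j :: 'k skew_poly set) *
         graded_multiplicity n (L_ideal n t k :: 'k skew_poly set)"
proof -
  let ?h = "\<lambda>c. if c < t + j then t - 1 else t"
  let ?C1 = "{t..<t + j}" and ?C2 = "{t + j + 1..t + j + k}" and ?C3 = "{t + 1..t + k}"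
  let ?G1 = "supports (win_sets ?C1 (\<lambda>_. t - 1))" and ?G2 = "supports (win_sets ?C2 (\<lambda>_. t))"
    and ?G3 = "supports (win_sets ?C3 (\<lambda>_. t))"
  have H_sets: "win_sets (?C1 \<union> ?C2) ?h = win_sets ?C1 (\<lambda>_. t - 1) \<union> win_sets ?C2 (\<lambda>_. t)"
    unfolding win_sets_Un by (intro arg_cong2[of _ _ _ _ union] win_sets_cong) auto
  have C1: "{t - 1 + 1..t - 1 + j} = ?C1" using assms by auto
  have e_H: "graded_multiplicity n (H_ideal n t j k :: 'k skew_poly set) = of_nat (max_face_count (skew_vars n) (?G1 \<union> ?G2))"
  proof -
    \<comment> \<open>Consecutive centers belong to the same block, as t + j is missing, so adjacent
      heights agree.\<close>
    have "graded_multiplicity n (H_ideal n t j k :: 'k skew_poly set) =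
        of_nat (max_face_count (skew_vars n) (supports (win_sets (?C1 \<union> ?C2) ?h)))"
      unfolding H_ideal_eq[OF assms(1,4)]
      by (rule graded_multiplicity_win_sets) (use assms in auto)
    then show ?thesis unfolding H_sets by (simp add: supports_def image_Un)
  qed
  have e_L1: "graded_multiplicity n (L_ideal n (t - 1) j :: 'k skew_poly set) = of_nat (max_face_count (skew_vars n) ?G1)"
  proof -
    have "L_ideal n (t - 1) j = (skew_Idl n (pf ` win_sets ?C1 (\<lambda>_. t - 1)) :: 'k skew_poly set)"
      unfolding C1[symmetric] by (rule L_ideal_eq) (use assms in auto)
    then show ?thesis by (simp only:) (rule graded_multiplicity_win_sets; use assms in auto)
  qed
  have e_L2: "graded_multiplicity n (L_ideal n t k :: 'k skew_poly set) = of_nat (max_face_count (skew_vars n) ?G3)"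
  proof -
    have "L_ideal n t k = (skew_Idl n (pf ` win_sets ?C3 (\<lambda>_. t)) :: 'k skew_poly set)"
      by (rule L_ideal_eq) (use assms in auto)
    then show ?thesis by (simp only:) (rule graded_multiplicity_win_sets; use assms in auto)
  qed
  have fam: "pf_family n (win_sets ?C1 (\<lambda>_. t - 1))" "pf_family n (win_sets ?C2 (\<lambda>_. t))" "pf_family n (win_sets ?C3 (\<lambda>_. t))"
    by (rule pf_family_ladder_sets, use assms in \<open>auto simp: admissible_def\<close>)+
  have ne: "{} \<notin> ?G1" "{} \<notin> ?G2" "{} \<notin> ?G3"
    by (rule empty_not_in_supports, use assms in force)+
  \<comment> \<open>The centers of L_t(k) start at t + 1 and those of the second block at t + j + 1.
    The first block has the same centers as L_{t-1}(j) and needs no translation.\<close>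
  have shift: "?G2 = (`) (shift_var j) ` ?G3"
    using win_sets_shift[of t "t + 1" j "t + k"] by (simp add: supports_shift ac_simps)
  have "max_face_count (skew_vars n) (?G1 \<union> ?G2) = max_face_count (skew_vars n) ?G1 * max_face_count (skew_vars n) ?G2"
  proof (rule max_face_count_union)
    \<comment> \<open>Index sums are at most 2(t + j) - 1 in the first block and at least 2(t + j) +
      1 in the second; the skipped center t + j makes this gap.\<close>
    have "\<Union>?G1 \<subseteq> {(a, b). 2 * t - 1 \<le> a + b \<and> a + b \<le> 2 * (t + j - 1) + 1}"
      by (rule supports_sums) (use assms in auto)
    moreover have "\<Union>?G2 \<subseteq> {(a, b). 2 * (t + j + 1) - 1 \<le> a + b \<and> a + b \<le> 2 * (t + j + k) + 1}"
      by (rule supports_sums) (use assms in auto)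
    ultimately show "\<Union>?G1 \<inter> \<Union>?G2 = {}"
      by (rule keys_subset_disjoint) (use assms in arith)
  qed (use supports_skew_vars fam ne in auto)
  also have "max_face_count (skew_vars n) ?G2 = max_face_count (skew_vars n) ?G3"
    unfolding shift
  proof (rule max_face_count_image)
    show "inj (shift_var j)" by (auto simp: inj_def shift_var_def prod_eq_iff)
    have "shift_var j ` \<Union>?G3 = \<Union>?G2" unfolding shift by blast
    then show "shift_var j ` \<Union>?G3 \<subseteq> skew_vars n" using supports_skew_vars[OF fam(2)] by simp
  qed (use supports_skew_vars fam ne in auto)
  finally show ?thesis unfolding e_H e_L1 e_L2 by simp
qed

end
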